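(* Let $\alpha \ge 0$ and let $p$ be a real number. Suppose that either of the following conditions holds: (a) $2+\alpha+\sqrt{\alpha^2+\frac{7}{2}\alpha+3} \le p < 2(2+\alpha)$; (b) $2+2\alpha < p < 2+\alpha+\sqrt{\alpha^2+\frac{7}{2}\alpha+3}$ and $$\int_0^1 I_t\left(\frac{2+\alpha}{p}, 1-\frac{2+\alpha}{p}\right) t^{2p-4\alpha-5}(1-t^4)^\alpha\,dt - \frac{1}{4(\alpha+1)} \le 0 .$$ Then the Hilbert matrix operator $\mathcal{H}$ is bounded on $A^p_\alpha$ and $$\|\mathcal{H}\|_{A^p_\alpha \to A^p_\alpha} = \frac{\pi}{\sin\frac{(2+\alpha)\pi}{p}}.$$
   Context: $\mathbb{D}$ is the open unit disk. For $f(z)=\sum_{k\ge0} a_k z^k$ analytic on $\mathbb{D}$, the Hilbert matrix operator is $\mathcal{H}(f)(z)=\sum_{n=0}^\infty\left(\sum_{k=0}^\infty \frac{a_k}{n+k+1}\right)z^n$. For $\alpha\ge 0$ and $p\ge1$, the weighted Bergman space $A^p_\alpha$ consists of analytic $f$ on $\mathbb{D}$ with $\|f\|_{A^p_\alpha}=\left(\int_{\mathbb{D}}|f(w)|^p\,dA_\alpha(w)\right)^{1/p}<\infty$, where $dA_\alpha(w)=(\alpha+1)(1-|w|^2)^\alpha\,dA(w)$ and $dA$ is normalized Lebesgue area measure on $\mathbb{D}$. $B(x,y)=\int_0^1 s^{x-1}(1-s)^{y-1}ds$ is the Beta function, $B_t(x,y)=\int_0^t s^{x-1}(1-s)^{y-1}ds$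 the incomplete Beta function, and $I_t(x,y)=B_t(x,y)/B(x,y)$ the regularized incomplete Beta function. *)

theory Defs
  imports "HOL-Analysis.Analysis"
begin

text \<open>Weighted area measure dA_alpha on the unit disk (dA = Lebesgue area / pi).
  The p-th power integral of |f| against dA_alpha, as an extended nonnegative real.\<close>
definition bergman_integral :: "real \<Rightarrow> real \<Rightarrow> (complex \<Rightarrow> complex) \<Rightarrow> ennreal" where
  "bergman_integral \<alpha> p f =
     (\<integral>\<^sup>+ w. ennreal (indicator (ball 0 1) w * ((\<alpha> + 1) * (1 - (cmod w)\<^sup>2) powr \<alpha> / pi)
                         * cmod (f w) powr p) \<partial>lborel)"

definition in_bergman :: "real \<Rightarrow> real \<Rightarrow> (complex \<Rightarrow> complex) \<Rightarrow> bool" where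
  "in_bergman \<alpha> p f \<longleftrightarrow> f holomorphic_on ball 0 1 \<and> bergman_integral \<alpha> p f < \<infinity>"

definition bergman_norm :: "real \<Rightarrow> real \<Rightarrow> (complex \<Rightarrow> complex) \<Rightarrow> real" where
  "bergman_norm \<alpha> p f = enn2real (bergman_integral \<alpha> p f) powr (1 / p)"

definition taylor_coeff :: "(complex \<Rightarrow> complex) \<Rightarrow> nat \<Rightarrow> complex" where
  "taylor_coeff f k = (deriv ^^ k) f 0 / of_nat (fact k)"

definition hilbert_op :: "(complex \<Rightarrow> complex) \<Rightarrow> complex \<Rightarrow> complex" where
  "hilbert_op f z = (\<Sum>n. (\<Sum>k. taylor_coeff f k / of_nat (n + k + 1)) * z ^ n)"

definition hilbert_bounded :: "real \<Rightarrow> real \<Rightarrow> bool" where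
  "hilbert_bounded \<alpha> p \<longleftrightarrow>
     (\<exists>C. \<forall>f. in_bergman \<alpha> p f \<longrightarrow>
        (\<forall>n. summable (\<lambda>k. taylor_coeff f k / of_nat (n + k + 1))) \<and>
        (\<forall>z\<in>ball 0 1. summable (\<lambda>n. (\<Sum>k. taylor_coeff f k / of_nat (n + k + 1)) * z ^ n)) \<and>
        in_bergman \<alpha> p (hilbert_op f) \<and>
        bergman_norm \<alpha> p (hilbert_op f) \<le> C * bergman_norm \<alpha> p f)"

definition hilbert_opnorm :: "real \<Rightarrow> real \<Rightarrow> real" where
  "hilbert_opnorm \<alpha> p =
     (SUP f\<in>{f. in_bergman \<alpha> p f \<and> bergman_norm \<alpha> p f \<le> 1}. bergman_norm \<alpha> p (hilbert_op f))"

definition inc_beta :: "real \<Rightarrow> real \<Rightarrow> real \<Rightarrow> real" where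
  "inc_beta t x y = (LBINT s=0..t. s powr (x - 1) * (1 - s) powr (y - 1))"

definition reg_inc_beta :: "real \<Rightarrow> real \<Rightarrow> real \<Rightarrow> real" where
  "reg_inc_beta t x y = inc_beta t x y / Beta x y"

end

theory Submission
  imports Defs "HOL-Complex_Analysis.Complex_Analysis"
begin

text \<open>The density \<open>t^(a-1) (1-t)^(-a)\<close> is singled out twice. The substitution
  costs a factor \<open>t^(2+\<alpha>-p) (1-t)^(-2-\<alpha>)\<close>, and since
  \<open>a p = 2 + \<alpha>\<close> this density is what reappears after multiplying that factor by
  its own power \<open>1 - p\<close> from Jensen. It is also the limit of the kernel of
  \<open>g_\<gamma>\<close> at \<open>(a, 1)\<close>. This agreement is why the constant stays
  sharp. Two estimates lose something, both harmlessly. The bound for \<open>1 - |z|^2\<close> drops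
  a multiple of \<open>|1 - z|^2\<close>, which vanishes at the point where the test functions
  concentrate. The image of the disk under the map for \<open>t\<close> is replaced by the larger
  region \<open>|w| > t^2\<close>, which keeps the remaining weight radial. The obstacle is the
  factor \<open>|w|^(-c)\<close>, singular at the origin. Only the values of \<open>t\<close> lost
  near \<open>w = 0\<close> can pay for it, pointwise in case (a) and merely on average in case (b);
  the average suffices because the excess weight is radial, so that only circular means of
  \<open>|f|^p\<close> matter.\<close>

text \<open>
  With \<open>\<phi>\<^sub>t(z) = t / (1 - (1 - t) z)\<close> and \<open>w\<^sub>t = \<phi>\<^sub>t / t\<close> one has \<open>H f = \<integral>\<^sub>0\<^sup>1 w\<^sub>t (f \<circ> \<phi>\<^sub>t) dt\<close>. Put
  \<open>a = (2 + \<alpha>) / p\<close>, \<open>c = 4 + 2 \<alpha> - p > 0\<close> and \<open>B = B(a, 1 - a) = \<pi> / sin (\<pi> a)\<close>.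

  Upper bound. Apply Jensen's inequality to the average over \<open>t\<close> with respect to the probability
  density \<open>t\<^sup>a\<^sup>-\<^sup>1 (1 - t)\<^sup>-\<^sup>a / B\<close> and substitute \<open>w = \<phi>\<^sub>t(z)\<close>; since \<open>|w| > t\<^sup>2\<close>, this gives
  \<open>\<parallel>H f\<parallel>\<^sup>p \<le> B\<^sup>p \<integral> |f(w)|\<^sup>p |w|\<^sup>-\<^sup>c I(|w|\<^sup>1\<^sup>/\<^sup>2) dA\<^sub>\<alpha>(w)\<close>, where \<open>I(t) = I\<^sub>t(a, 1 - a)\<close>. Condition (a) says exactly
  that \<open>2 c \<le> a\<close>, and then \<open>I(t) \<le> t\<^sup>2\<^sup>c\<close> on \<open>[0, 1]\<close>. Otherwise \<open>I(t) - t\<^sup>2\<^sup>c\<close> changes sign once, from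
  plus to minus; as the circular means of \<open>|f|\<^sup>p\<close> increase, it suffices to treat a constant \<open>f\<close>, and
  for constants the inequality is condition (b) after the substitution \<open>|w| = t\<^sup>2\<close>.

  Lower bound. For \<open>f(z) = (1 - z)\<^sup>-\<^sup>\<gamma>\<close> with \<open>\<gamma> < a\<close> one finds \<open>H f = f g\<^sub>\<gamma>\<close>, where \<open>g\<^sub>\<gamma>(z) \<rightarrow> B\<close> as
  \<open>(\<gamma>, z) \<rightarrow> (a, 1)\<close>, while the norm of \<open>f\<close> blows up and concentrates at \<open>1\<close> as \<open>\<gamma> \<rightarrow> a\<close>.
\<close>

section \<open>Holomorphic and polar substitution in planar integrals\<close>

abbreviation bergman_weight :: "real \<Rightarrow> complex \<Rightarrow> real" where
  "bergman_weight \<alpha> z \<equiv> indicator (ball 0 1) z * ((\<alpha> + 1) * (1 - (cmod z)\<^sup>2) powr \<alpha> / pi)"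

no_notation fps_nth (infixl "$" 75)

text \<open>This moves planar integrals to \<open>real^2\<close>, where derivatives are matrices and
  the determinant form of change of variables applies. Both measures agree on boxes, which determine
  \<open>lborel\<close>.\<close>

lemma lborel_complex_eq_distr_vec:
  "(lborel :: complex measure) = distr lborel borel (\<lambda>v::real^2. Complex (v$1) (v$2))"
proof (rule lborel_eqI)
  fix l u :: complex
  assume le: "\<And>b. b \<in> Basis \<Longrightarrow> l \<bullet> b \<le> u \<bullet> b"
  have meas [measurable]: "(\<lambda>v::real^2. Complex (v$1) (v$2)) \<in> borel_measurable borel"
    by (intro borel_measurable_continuous_onI continuous_intros)
  have vim: "(\<lambda>v::real^2. Complex (v$1) (v$2)) -` box l u
      = box (vector [Re l, Im l]) (vector [Re u, Im u] :: real^2)"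
    by (rule set_eqI) (simp add: mem_box_cart forall_2 mem_box Basis_complex_def conj_ac)
  have "emeasure (distr lborel borel (\<lambda>v::real^2. Complex (v$1) (v$2))) (box l u)
      = emeasure lborel (box (vector [Re l, Im l]) (vector [Re u, Im u] :: real^2))"
    by (subst emeasure_distr) (auto simp: vim)
  also have "\<dots> = ennreal (\<Prod>b\<in>Basis. ((vector [Re u, Im u] :: real^2) - vector [Re l, Im l]) \<bullet> b)"
  proof (intro emeasure_lborel_box)
    fix b :: "real^2" assume "b \<in> Basis"
    then obtain i where b: "b = axis i 1"
      by (auto simp: Basis_vec_def)
    show "vector [Re l, Im l] \<bullet> b \<le> vector [Re u, Im u] \<bullet> b"
    proof -
      have "Re l \<le> Re u" "Im l \<le> Im u"
        using le[of 1] le[of \<i>] by (simp_all add: Basis_complex_def)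
      then show ?thesis
        using exhaust_2[of i] by (elim disjE) (simp_all add: b inner_axis)
    qed
  qed
  also have "(\<Prod>b\<in>Basis. ((vector [Re u, Im u] :: real^2) - vector [Re l, Im l]) \<bullet> b)
      = (Re u - Re l) * (Im u - Im l)"
  proof -
    have B: "(Basis :: (real^2) set) = {axis 1 1, axis 2 1}"
      by (auto simp: Basis_vec_def) (metis exhaust_2)
    show ?thesis unfolding B
      by (subst prod.insert) (auto simp: inner_axis axis_eq_axis)
  qed
  also have "\<dots> = (\<Prod>b\<in>Basis. (u - l) \<bullet> b)"
    by (simp add: Basis_complex_def)
  finally show "emeasure (distr lborel borel (\<lambda>v::real^2. Complex (v$1) (v$2))) (box l u)
      = ennreal (\<Prod>b\<in>Basis. (u - l) \<bullet> b)" .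
qed auto

lemma nn_integral_lborel_complex_vec:
  assumes "F \<in> borel_measurable borel"
  shows "(\<integral>\<^sup>+z. F z \<partial>lborel) = integral\<^sup>N lborel (\<lambda>v::real^2. F (Complex (v$1) (v$2)))"
proof -
  have "(\<lambda>v::real^2. Complex (v$1) (v$2)) \<in> borel_measurable borel"
    by (intro borel_measurable_continuous_onI continuous_intros)
  then show ?thesis
    using assms by (subst lborel_complex_eq_distr_vec) (simp add: nn_integral_distr)
qed

text \<open>A holomorphic map multiplies area by \<open>|\<phi>'|^2\<close>. If the right side is
  infinite there is nothing to prove; if it is finite, the nonnegative integrand is integrable on
  the image, and change of variables even gives equality.\<close>

lemma nn_integral_holomorphic_substitution_le:
  fixes G :: "complex \<Rightarrow> real"
  assumes S: "open S" and holo: "\<phi> holomorphic_on S" and inj: "inj_on \<phi> S"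
    and G [measurable]: "G \<in> borel_measurable borel" and G0: "\<And>w. 0 \<le> G w"
  shows "(\<integral>\<^sup>+z. ennreal (indicator S z * ((cmod (deriv \<phi> z))\<^sup>2 * G (\<phi> z))) \<partial>lborel)
       \<le> (\<integral>\<^sup>+w. ennreal (indicator (\<phi> ` S) w * G w) \<partial>lborel)"
proof (cases "(\<integral>\<^sup>+w. ennreal (indicator (\<phi> ` S) w * G w) \<partial>lborel)")
  case (real r)
  define h where "h = (\<lambda>v::real^2. Complex (v$1) (v$2))"
  define k where "k = (\<lambda>z. vector [Re z, Im z] :: real^2)"
  have hk [simp]: "h (k z) = z" and kh [simp]: "k (h v) = v" for z v
    by (simp_all add: h_def k_def vec_eq_iff forall_2)
  have blh: "bounded_linear h" and blk: "bounded_linear k"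
    unfolding linear_conv_bounded_linear[symmetric]
    by (auto intro!: linearI simp: h_def k_def complex_eq_iff vec_eq_iff forall_2)
  obtain \<psi> where \<psi>: "\<psi> holomorphic_on (\<phi> ` S)" "\<And>z. z \<in> S \<Longrightarrow> deriv \<phi> z * deriv \<psi> (\<phi> z) = 1"
      "\<And>z. z \<in> S \<Longrightarrow> \<psi> (\<phi> z) = z"
    using holomorphic_has_inverse[OF holo S inj] by metis
  have oT: "open (\<phi> ` S)"
    by (rule open_mapping_thm3[OF holo S inj])
  have conj: "((\<lambda>v. k (F (h v))) has_derivative (\<lambda>x. k (deriv F (h v) * h x))) (at v within X)"
    if "F holomorphic_on U" "open U" "h v \<in> U" for F U v X
  proof -
    have "(F has_derivative (*) (deriv F (h v))) (at (h v))"
      using holomorphic_derivI[OF that(1,2,3)] by (simp add: has_field_derivative_def)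
    then have "((\<lambda>v. F (h v)) has_derivative (\<lambda>x. deriv F (h v) * h x)) (at v within X)"
      by (rule has_derivative_compose[OF bounded_linear_imp_has_derivative[OF blh]])
    then show ?thesis
      by (rule bounded_linear.has_derivative[OF blk])
  qed
  \<comment> \<open>Multiplication by \<open>d\<close> has columns \<open>(Re d, Im d)\<close> and
    \<open>(- Im d, Re d)\<close>.\<close>
  have det: "det (matrix (\<lambda>x. k (d * h x))) = (cmod d)\<^sup>2" for d
  proof -
    have "h (axis 1 1) = 1" "h (axis 2 1) = \<i>"
      by (simp_all add: h_def axis_def complex_eq_iff)
    then have "det (matrix (\<lambda>x. k (d * h x))) = Re d * Re d + Im d * Im d"
      by (simp add: det_2 matrix_def k_def)
    then show ?thesis
      by (simp only: cmod_power2 power2_eq_square[of "Re d"] power2_eq_square[of "Im d"])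
  qed
  have mT [measurable]: "\<phi> ` S \<in> sets borel" and mS [measurable]: "S \<in> sets borel"
    using oT S by auto
  have [measurable]: "h \<in> borel_measurable borel"
    using bounded_linear.continuous_on[OF blh continuous_on_id] by (rule borel_measurable_continuous_onI)
  have "(\<integral>\<^sup>+v. ennreal (indicator (\<phi> ` S) (h v) * G (h v)) \<partial>lborel) = ennreal r"
    unfolding real(2)[symmetric] h_def
    by (rule nn_integral_lborel_complex_vec[symmetric]) measurable
  then have "((\<lambda>v. indicator (\<phi> ` S) (h v) * G (h v)) has_integral r) UNIV"
    using real(1) G0 by (intro nn_integral_has_integral) auto
  then have "((\<lambda>v. G (h v)) has_integral r) (h -` \<phi> ` S)"
    by (subst has_integral_restrict_UNIV[symmetric], elim has_integral_eq[rotated])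
       (auto simp: indicator_def)
  moreover have "((\<lambda>v. \<bar>det (matrix (\<lambda>x. k (deriv \<phi> (h v) * h x)))\<bar> * G (h (k (\<phi> (h v))))) has_integral r) (h -` S)
     \<longleftrightarrow> ((\<lambda>v. G (h v)) has_integral r) (h -` \<phi> ` S)"
  proof (rule cov_invertible_nonneg_eq[where h = "\<lambda>v. k (\<psi> (h v))" and h' = "\<lambda>v x. k (deriv \<psi> (h v) * h x)"])
    show "((\<lambda>v. k (\<phi> (h v))) has_derivative (\<lambda>x. k (deriv \<phi> (h v) * h x))) (at v within h -` S)"
      if "v \<in> h -` S" for v
      using that by (intro conj[OF holo S]) auto
    show "((\<lambda>v. k (\<psi> (h v))) has_derivative (\<lambda>x. k (deriv \<psi> (h v) * h x))) (at v within h -` \<phi> ` S)"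
      if "v \<in> h -` \<phi> ` S" for v
      using that by (intro conj[OF \<psi>(1) oT]) auto
    fix v assume "v \<in> h -` \<phi> ` S"
    then obtain z where z: "z \<in> S" "h v = \<phi> z"
      by auto
    then have v: "v = k (\<phi> z)"
      by (metis kh)
    show "k (\<psi> (h v)) \<in> h -` S \<and> k (\<phi> (h (k (\<psi> (h v))))) = v"
      using z \<psi>(3) by (simp add: v)
    show "(\<lambda>x. k (deriv \<psi> (h v) * h x)) \<circ> (\<lambda>x. k (deriv \<phi> (h (k (\<psi> (h v)))) * h x)) = id"
    proof
      fix x
      have "deriv \<psi> (\<phi> z) * (deriv \<phi> z * h x) = (deriv \<phi> z * deriv \<psi> (\<phi> z)) * h x"
        by (simp only: mult_ac)
      also have "\<dots> = h x"
        using z(1) by (simp add: \<psi>(2))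
      finally have e: "deriv \<psi> (\<phi> z) * (deriv \<phi> z * h x) = h x" .
      show "((\<lambda>x. k (deriv \<psi> (h v) * h x)) \<circ> (\<lambda>x. k (deriv \<phi> (h (k (\<psi> (h v)))) * h x))) x = id x"
        by (simp only: o_apply v hk kh \<psi>(3)[OF z(1)] e id_apply)
    qed
  qed (use G0 \<psi>(3) in auto)
  ultimately have "((\<lambda>v. \<bar>det (matrix (\<lambda>x. k (deriv \<phi> (h v) * h x)))\<bar> * G (h (k (\<phi> (h v))))) has_integral r) (h -` S)"
    by simp
  then have "(\<integral>\<^sup>+v. ennreal (indicator (h -` S) v * ((cmod (deriv \<phi> (h v)))\<^sup>2 * G (\<phi> (h v)))) \<partial>lborel) = ennreal r"
    using G0 by (intro nn_integral_has_integral_lebesgue) (auto simp: det)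
  also have "(\<lambda>v. indicator (h -` S) v) = (\<lambda>v. indicator S (h v) :: real)"
    by (auto simp: indicator_def)
  finally have "(\<integral>\<^sup>+v. ennreal (indicator S (h v) * ((cmod (deriv \<phi> (h v)))\<^sup>2 * G (\<phi> (h v)))) \<partial>lborel) = ennreal r" .
  \<comment> \<open>Off \<open>S\<close> the maps are arbitrary, so measurability is proved for
    their cut-off versions, which give the same integrand.\<close>
  moreover have "(\<lambda>z. ennreal (indicator S z * ((cmod (deriv \<phi> z))\<^sup>2 * G (\<phi> z)))) \<in> borel_measurable borel"
  proof -
    have [measurable]: "(\<lambda>z. indicator S z *\<^sub>R deriv \<phi> z) \<in> borel_measurable borel"
      "(\<lambda>z. indicator S z *\<^sub>R \<phi> z) \<in> borel_measurable borel"
      using holo S by (auto intro!: borel_measurable_continuous_on_indicator holomorphic_on_imp_continuous_on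
          holomorphic_deriv)
    have "(\<lambda>z. ennreal (indicator S z * ((cmod (indicator S z *\<^sub>R deriv \<phi> z))\<^sup>2 * G (indicator S z *\<^sub>R \<phi> z))))
        \<in> borel_measurable borel"
      by measurable
    also have "(\<lambda>z. ennreal (indicator S z * ((cmod (indicator S z *\<^sub>R deriv \<phi> z))\<^sup>2 * G (indicator S z *\<^sub>R \<phi> z))))
       = (\<lambda>z. ennreal (indicator S z * ((cmod (deriv \<phi> z))\<^sup>2 * G (\<phi> z))))"
      by (auto simp: indicator_def)
    finally show ?thesis .
  qed
  ultimately show ?thesis
    using real(2) by (subst nn_integral_lborel_complex_vec) (auto simp: h_def)
qed auto

section \<open>Polar coordinates and rotations\<close>

lemma ball_in_borel [measurable]: "ball (c :: 'a :: metric_space) r \<in> sets borel"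
  by simp

text \<open>The image of area under \<open>cmod\<close> gives \<open>{..r}\<close> the area of a
  disk, \<open>pi * r^2\<close>, whose derivative is the density \<open>2 * pi * r\<close>;
  half-lines determine the measure.\<close>

lemma nn_integral_complex_norm:
  fixes k :: "real \<Rightarrow> ennreal"
  assumes [measurable]: "k \<in> borel_measurable borel"
  shows "(\<integral>\<^sup>+z. k (cmod z) \<partial>lborel) = (\<integral>\<^sup>+r. k r * ennreal (2 * pi * r) * indicator {0..} r \<partial>lborel)"
proof -
  let ?N = "density lborel (\<lambda>r::real. ennreal (2 * pi * r) * indicator {0..} r)"
  have E: "emeasure ?N {..r} = emeasure (distr lborel borel cmod) {..r}" for r
  proof (cases "r \<ge> 0")
    case True
    have "emeasure ?N {..r} = (\<integral>\<^sup>+x. ennreal (2 * pi * x) * indicator {0..} x * indicator {..r} x \<partial>lborel)"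
      by (subst emeasure_density) auto
    also have "\<dots> = (\<integral>\<^sup>+x. ennreal (2 * pi * x) * indicator {0..r} x \<partial>lborel)"
      by (intro nn_integral_cong) (auto simp: indicator_def)
    also have "\<dots> = ennreal (pi * r\<^sup>2 - pi * 0\<^sup>2)"
      by (rule nn_integral_FTC_Icc) (use True in \<open>auto intro!: derivative_eq_intros\<close>)
    also have "\<dots> = emeasure lborel (cball (0::complex) r)"
      using True by (simp add: emeasure_cball unit_ball_vol_2)
    also have "cball (0::complex) r = cmod -` {..r}"
      by (auto simp: cball_def)
    finally show ?thesis
      by (simp add: emeasure_distr)
  next
    case False
    then have "cmod -` {..r} = {}"
      by (auto intro: order_trans[OF norm_ge_zero])
    then have "emeasure (distr lborel borel cmod) {..r} = 0"
      by (simp add: emeasure_distr)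
    moreover have "emeasure ?N {..r} = 0"
      using False by (subst emeasure_density) (auto simp: nn_integral_0_iff_AE indicator_def)
    ultimately show ?thesis
      by simp
  qed
  have "?N = distr lborel borel cmod"
  proof (rule measure_eqI_generator_eq[where E = "range atMost" and \<Omega> = UNIV and A = "\<lambda>i. {..real i}"])
    show "Int_stable (range atMost :: real set set)"
      by (auto simp: Int_stable_def)
    show "(\<Union>i. {..real i}) = UNIV"
      by (auto intro: real_arch_simple)
    show "emeasure ?N {..real i} \<noteq> \<infinity>" for i
    proof -
      have "cmod -` {..real i} = cball 0 (real i)"
        by (auto simp: cball_def)
      then show ?thesis
        by (simp add: E emeasure_distr emeasure_cball)
    qed
  qed (auto simp: E borel_eq_atMost[where 'a=real] sets_density)
  then have "(\<integral>\<^sup>+z. k (cmod z) \<partial>lborel) = (\<integral>\<^sup>+r. k r \<partial>?N)"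
    by (simp add: nn_integral_distr)
  also have "\<dots> = (\<integral>\<^sup>+r. k r * ennreal (2 * pi * r) * indicator {0..} r \<partial>lborel)"
    by (subst nn_integral_density) (auto simp: mult_ac)
  finally show ?thesis .
qed

text \<open>The substitution inequality for \<open>u\<close> and for its inverse gives the two
  directions.\<close>

lemma nn_integral_rotate:
  fixes G :: "complex \<Rightarrow> real"
  assumes [measurable]: "G \<in> borel_measurable borel" and G0: "\<And>w. 0 \<le> G w" and u: "cmod u = 1"
  shows "(\<integral>\<^sup>+z. ennreal (G (u * z)) \<partial>lborel) = (\<integral>\<^sup>+z. ennreal (G z) \<partial>lborel)"
proof -
  have le: "(\<integral>\<^sup>+z. ennreal (F (v * z)) \<partial>lborel) \<le> (\<integral>\<^sup>+z. ennreal (F z) \<partial>lborel)"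
    if "F \<in> borel_measurable borel" "\<And>w. 0 \<le> F w" "cmod v = 1" for F :: "complex \<Rightarrow> real" and v
  proof -
    have "v \<noteq> 0"
      using that(3) by auto
    then have "range ((*) v) = UNIV"
      by (auto simp: surj_def intro: exI[of _ "_ / v"])
    moreover have "deriv ((*) v) z = v" for z
      by (rule DERIV_imp_deriv) (auto intro!: derivative_eq_intros)
    ultimately show ?thesis
      using nn_integral_holomorphic_substitution_le[of UNIV "(*) v" F] that \<open>v \<noteq> 0\<close>
      by (auto simp: inj_on_def intro!: holomorphic_intros)
  qed
  have "u \<noteq> 0"
    using u by auto
  then have "G (u * (inverse u * z)) = G z" for z
    by (simp add: mult.assoc[symmetric])
  then show ?thesis
    using le[of G u] le[of "\<lambda>z. G (u * z)" "inverse u"] G0 u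
    by (intro antisym) (auto simp: norm_inverse)
qed

section \<open>Circular means\<close>

text \<open>The base point is a complex number rather than a radius, so that the mean is itself a
  function on the disk; \<open>circle_mean_rotate\<close> shows that it is radial.\<close>

definition circle_mean :: "(complex \<Rightarrow> real) \<Rightarrow> complex \<Rightarrow> real" where
  "circle_mean g w = integral {0..2*pi} (\<lambda>\<theta>. g (w * cis \<theta>)) / (2 * pi)"

lemma continuous_on_circle:
  assumes "continuous_on (ball 0 r) g" "cmod w < r"
  shows "continuous_on A (\<lambda>\<theta>. g (w * cis \<theta>))"
  by (rule continuous_on_compose2[OF assms(1)])
     (use assms(2) in \<open>auto intro!: continuous_intros simp: norm_mult\<close>)

lemma has_integral_circle:
  fixes g :: "complex \<Rightarrow> real"
  assumes "continuous_on (ball 0 r) g" "cmod w < r"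
  shows "((\<lambda>\<theta>. g (w * cis \<theta>)) has_integral (2 * pi * circle_mean g w)) {0..2*pi}"
  using integrable_continuous_real[OF continuous_on_circle[OF assms]]
  by (simp add: circle_mean_def has_integral_integral)

lemma circle_mean_nonneg:
  assumes "\<And>z. 0 \<le> g z"
  shows "0 \<le> circle_mean g w"
  \<comment> \<open>Without integrability the integral takes the default value 0, so
    \<open>g\<close> need not be continuous here.\<close>
  unfolding circle_mean_def
  by (cases "(\<lambda>\<theta>. g (w * cis \<theta>)) integrable_on {0..2*pi}")
     (auto intro!: divide_nonneg_pos integral_nonneg assms simp: not_integrable_integral)

text \<open>Turning the base point by \<open>s\<close> shifts the interval of integration; by
  periodicity the piece that sticks out at \<open>2*pi\<close> returns to the beginning.\<close>

lemma circle_mean_rotate: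
  assumes g: "continuous_on (ball 0 r) g" and w: "cmod w < r" and z: "cmod z = cmod w"
  shows "circle_mean g z = circle_mean g w"
proof -
  obtain s where s: "0 \<le> s" "s \<le> 2 * pi" "z = w * cis s"
  proof (cases "w = 0")
    case True
    with z that[of 0] show ?thesis by simp
  next
    case False
    with z have "cmod (z / w) = 1"
      by (simp add: norm_divide)
    then obtain t where "0 \<le> t" "t < 2 * pi" "z / w = cis t"
      by (metis Arg2pi_ge_0 Arg2pi_lt_2pi Arg2pi_eq cis_conv_exp mult.commute mult_1 of_real_1)
    with False that[of t] show ?thesis
      by (auto simp: field_simps)
  qed
  let ?G = "\<lambda>\<theta>. g (w * cis \<theta>)"
  have int: "?G integrable_on {a..b}" for a b
    by (rule integrable_continuous_real[OF continuous_on_circle[OF g w]])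
  have shift: "integral {a..b} (\<lambda>\<theta>. ?G (\<theta> + c)) = integral {a + c..b + c} ?G" for a b c
    using integral_shift_Icc_real[of a b ?G c] by (simp add: o_def add.commute)
  have "integral {0..2*pi} (\<lambda>\<theta>. g (z * cis \<theta>)) = integral {0..2*pi} (\<lambda>\<theta>. ?G (\<theta> + s))"
    by (simp add: s(3) cis_mult[symmetric] mult_ac)
  also have "\<dots> = integral {s..2*pi + s} ?G"
    by (simp add: shift)
  also have "\<dots> = integral {s..2*pi} ?G + integral {2*pi..2*pi + s} ?G"
    using s by (intro Henstock_Kurzweil_Integration.integral_combine[symmetric] int) auto
  also have "integral {2*pi..2*pi + s} ?G = integral {0..s} (\<lambda>\<theta>. ?G (\<theta> + 2 * pi))"
    by (simp add: shift add_ac)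
  also have "\<dots> = integral {0..s} ?G"
    by (simp add: cis_mult[symmetric])
  also have "integral {s..2*pi} ?G + integral {0..s} ?G = integral {0..2*pi} ?G"
    using s Henstock_Kurzweil_Integration.integral_combine[of 0 s "2*pi" ?G] int by (simp add: add_ac)
  finally show ?thesis
    by (simp add: circle_mean_def)
qed

text \<open>By rotation invariance the integral on the left is unchanged when \<open>g w\<close> is
  replaced by \<open>g (w * cis \<theta>)\<close>; averaging over \<open>\<theta>\<close> and
  exchanging the integrals puts the mean in place of \<open>g\<close>. The same parameter integral
  \<open>J\<close> yields the measurability of the mean.\<close>

lemma
  fixes g :: "complex \<Rightarrow> real" and k :: "real \<Rightarrow> real"
  assumes g: "continuous_on (ball 0 1) g" "\<And>z. 0 \<le> g z"
    and k [measurable]: "k \<in> borel_measurable borel" and k0: "\<And>r. 0 \<le> k r"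
  shows borel_measurable_circle_mean:
      "(\<lambda>w. ennreal (indicator (ball 0 1) w * (k (cmod w) * circle_mean g w))) \<in> borel_measurable borel"
    and nn_integral_circle_mean:
      "(\<integral>\<^sup>+w. ennreal (indicator (ball 0 1) w * (k (cmod w) * g w)) \<partial>lborel)
       = (\<integral>\<^sup>+w. ennreal (indicator (ball 0 1) w * (k (cmod w) * circle_mean g w)) \<partial>lborel)"
    (is "?I = _")
proof -
  let ?M = "\<lambda>w. ennreal (indicator (ball 0 1) w * (k (cmod w) * circle_mean g w))"
  define g0 where "g0 = (\<lambda>w. indicator (ball 0 1) w * g w)"
  have [measurable]: "g0 \<in> borel_measurable borel"
    using borel_measurable_continuous_on_indicator[OF _ g(1)] by (simp add: g0_def)
  have [measurable]: "cis \<in> borel_measurable borel"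
    by (intro borel_measurable_continuous_onI continuous_intros)
  have I: "?I = (\<integral>\<^sup>+w. ennreal (k (cmod w) * g0 (w * cis \<theta>)) \<partial>lborel)" for \<theta>
  proof -
    have "(\<integral>\<^sup>+w. ennreal (k (cmod (cis \<theta> * w)) * g0 (cis \<theta> * w)) \<partial>lborel)
        = (\<integral>\<^sup>+w. ennreal (k (cmod w) * g0 w) \<partial>lborel)"
      using k0 g(2) by (intro nn_integral_rotate mult_nonneg_nonneg) (measurable, auto simp: g0_def)
    then show ?thesis
      by (simp add: g0_def norm_mult mult_ac)
  qed
  define J where "J w = (\<integral>\<^sup>+\<theta>. ennreal (k (cmod w) * g0 (w * cis \<theta>)) * indicator {0..2*pi} \<theta> \<partial>lborel)" for w
  have [measurable]: "J \<in> borel_measurable borel"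
    unfolding J_def by measurable
  have "ennreal (2 * pi) * ?I = (\<integral>\<^sup>+\<theta>. ?I * indicator {0..2*pi} \<theta> \<partial>lborel)"
    by (subst nn_integral_cmult_indicator) (auto simp: mult.commute)
  also have "\<dots> = (\<integral>\<^sup>+\<theta>. (\<integral>\<^sup>+w. ennreal (k (cmod w) * g0 (w * cis \<theta>)) * indicator {0..2*pi} \<theta> \<partial>lborel) \<partial>lborel)"
    by (subst nn_integral_multc) (auto simp: I[symmetric])
  also have "\<dots> = (\<integral>\<^sup>+w. J w \<partial>lborel)"
    unfolding J_def by (rule lborel_pair.Fubini') measurable
  finally have J: "ennreal (2 * pi) * ?I = (\<integral>\<^sup>+w. J w \<partial>lborel)" .
  have mean: "?M w = ennreal (1 / (2 * pi)) * J w" for w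
  proof (cases "cmod w < 1")
    case True
    have "(\<integral>\<^sup>+\<theta>. ennreal (k (cmod w) * g (w * cis \<theta>)) * indicator {0..2*pi} \<theta> \<partial>lborel)
        = ennreal (k (cmod w) * (2 * pi * circle_mean g w))"
      using k0 g(2) True
      by (intro nn_integral_has_integral_lebesgue' has_integral_mult_right has_integral_circle[OF g(1)]) auto
    then show ?thesis
      using True k0 circle_mean_nonneg[of g w] g(2)
      by (simp add: J_def g0_def norm_mult ennreal_mult'[symmetric])
  qed (auto simp: J_def g0_def norm_mult)
  show "(\<lambda>w. ?M w) \<in> borel_measurable borel"
    unfolding mean by measurable
  have "(\<integral>\<^sup>+w. ?M w \<partial>lborel)
      = ennreal (1 / (2 * pi)) * (\<integral>\<^sup>+w. J w \<partial>lborel)"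
    unfolding mean by (simp add: nn_integral_cmult)
  also have "\<dots> = ?I"
    unfolding J[symmetric] by (simp add: mult.assoc[symmetric] ennreal_mult'[symmetric])
  finally show "?I = (\<integral>\<^sup>+w. ?M w \<partial>lborel)" ..
qed

text \<open>Let \<open>h = |F|\<^sup>p\<^sup>-\<^sup>2\<close> times the conjugate of \<open>F\<close>, where \<open>F(\<theta>) = f(u e\<^sup>i\<^sup>\<theta>)\<close>. The maximum principle for the
  holomorphic function \<open>g(w) = \<integral> f(w e\<^sup>i\<^sup>\<theta>) h(\<theta>) d\<theta>\<close>, whose value at \<open>u\<close> is the integral of \<open>|F|\<^sup>p\<close>, and
  Young's inequality on the circle through \<open>v\<close> give the claim.\<close>

lemma circle_mean_powr_mono:
  assumes f: "f holomorphic_on ball 0 r" and p: "p > 2" and uv: "cmod u \<le> cmod v" "cmod v < r"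
  shows "circle_mean (\<lambda>z. cmod (f z) powr p) u \<le> circle_mean (\<lambda>z. cmod (f z) powr p) v"
proof (cases "v = 0")
  case True
  with uv show ?thesis by simp
next
  case False
  have u: "cmod u < r" using uv by simp
  have cf: "continuous_on (ball 0 r) f" and cdf: "continuous_on (ball 0 r) (deriv f)"
    using f by (auto intro!: holomorphic_on_imp_continuous_on holomorphic_deriv)
  have cp: "continuous_on (ball 0 r) (\<lambda>z. cmod (f z) powr p)"
    using p cf by (intro continuous_on_powr' continuous_intros) auto
  define \<psi> where "\<psi> = circle_mean (\<lambda>z. cmod (f z) powr p)"
  define h where "h = (\<lambda>\<theta>. cnj (f (u * cis \<theta>)) * of_real (cmod (f (u * cis \<theta>)) powr (p - 2)))"
  have ch: "continuous_on A h" for A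
    unfolding h_def using p continuous_on_circle[OF cf u]
    by (intro continuous_intros continuous_on_of_real continuous_on_powr') auto
  have nh: "cmod (h \<theta>) = cmod (f (u * cis \<theta>)) powr (p - 1)" for \<theta>
    using powr_add[of "cmod (f (u * cis \<theta>))" 1 "p - 2"] p
    by (simp add: h_def norm_mult) 
  define g where "g = (\<lambda>w. integral {0..2*pi} (\<lambda>\<theta>. f (w * cis \<theta>) * h \<theta>))"
  have gh: "g holomorphic_on ball 0 r"
    unfolding g_def box_real[symmetric]
  proof (rule leibniz_rule_holomorphic)
    fix w t assume w: "w \<in> ball (0::complex) r"
    show "((\<lambda>w. f (w * cis t) * h t) has_field_derivative (deriv f (w * cis t) * cis t * h t)) (at w within ball 0 r)"
    proof -
      have 1: "(f has_field_derivative deriv f (w * cis t)) (at (w * cis t))"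
        using w by (intro holomorphic_derivI[OF f]) (auto simp: norm_mult)
      have 2: "((\<lambda>w. w * cis t) has_field_derivative cis t) (at w within ball 0 r)"
        by (auto intro!: derivative_eq_intros)
      show ?thesis
        using DERIV_cmult_right[OF DERIV_chain2[OF 1 2]] .
    qed
  next
    show "(\<lambda>\<theta>. f (w * cis \<theta>) * h \<theta>) integrable_on cbox 0 (2 * pi)" if "w \<in> ball 0 r" for w
      using that by (intro integrable_continuous continuous_intros ch continuous_on_circle[OF cf]) auto
    show "continuous_on (ball 0 r \<times> cbox 0 (2 * pi)) (\<lambda>(w, t). deriv f (w * cis t) * cis t * h t)"
    proof -
      have "continuous_on (ball 0 r \<times> cbox 0 (2 * pi)) (\<lambda>x. deriv f (fst x * cis (snd x)))"
        by (rule continuous_on_compose2[OF cdf]) (auto intro!: continuous_intros simp: norm_mult)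
      moreover have "continuous_on (ball 0 r \<times> cbox 0 (2 * pi)) (\<lambda>x. h (snd x))"
        by (rule continuous_on_compose2[OF ch[of UNIV]]) (auto intro!: continuous_intros)
      ultimately show ?thesis
        unfolding split_beta by (intro continuous_intros)
    qed
  qed auto
  have gu: "g u = of_real (2 * pi * \<psi> u)"
  proof -
    have "f (u * cis \<theta>) * h \<theta> = of_real (cmod (f (u * cis \<theta>)) powr p)" for \<theta>
    proof -
      have "f (u * cis \<theta>) * h \<theta> = of_real ((cmod (f (u * cis \<theta>)))\<^sup>2 * cmod (f (u * cis \<theta>)) powr (p - 2))"
        by (simp add: h_def complex_norm_square[symmetric] mult.assoc[symmetric])
      also have "(cmod (f (u * cis \<theta>)))\<^sup>2 * cmod (f (u * cis \<theta>)) powr (p - 2) = cmod (f (u * cis \<theta>)) powr p"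
        using p by (cases "f (u * cis \<theta>) = 0") (auto simp: powr_diff powr_numeral)
      finally show ?thesis .
    qed
    then have "g u = integral {0..2*pi} (\<lambda>\<theta>. complex_of_real (cmod (f (u * cis \<theta>)) powr p))"
      by (simp add: g_def)
    also have "\<dots> = of_real (integral {0..2*pi} (\<lambda>\<theta>. cmod (f (u * cis \<theta>)) powr p))"
      by (rule integral_unique)
         (intro has_integral_of_real integrable_integral integrable_continuous_real continuous_on_circle[OF cp u])
    finally show ?thesis
      by (simp add: \<psi>_def circle_mean_def)
  qed
  have "cmod (g u) \<le> 2 * pi * (\<psi> v / p + (1 - 1 / p) * \<psi> u)"
  proof (rule maximum_modulus_frontier[of g "cball 0 (cmod v)"])
    have sub: "cball 0 (cmod v) \<subseteq> ball 0 r" using uv by auto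
    then show "g holomorphic_on interior (cball 0 (cmod v))"
      by (auto intro!: holomorphic_on_subset[OF gh])
    show "continuous_on (closure (cball 0 (cmod v))) g"
      using sub by (auto intro!: holomorphic_on_imp_continuous_on holomorphic_on_subset[OF gh])
    show "u \<in> cball 0 (cmod v)"
      using uv by auto
    fix z :: complex assume "z \<in> frontier (cball 0 (cmod v))"
    then have z: "cmod z = cmod v" "cmod z < r"
      using False uv by auto
    have bd: "((\<lambda>\<theta>. cmod (f (z * cis \<theta>)) powr p / p + (1 - 1 / p) * cmod (f (u * cis \<theta>)) powr p)
       has_integral (2 * pi * \<psi> z / p + (1 - 1 / p) * (2 * pi * \<psi> u))) {0..2*pi}"
      unfolding \<psi>_def
      by (intro has_integral_add has_integral_divide has_integral_mult_right has_integral_circle[OF cp] u z)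
    have pq: "(p - 1) * (p / (p - 1)) = p" "1 / p + 1 / (p / (p - 1)) = 1" "1 < p / (p - 1)"
      using p by (simp_all add: field_simps)
    have q: "x / (p / (p - 1)) = (1 - 1 / p) * x" for x
      using p by (simp add: field_simps)
    have young: "cmod (f (z * cis \<theta>) * h \<theta>) \<le> cmod (f (z * cis \<theta>)) powr p / p + (1 - 1 / p) * cmod (f (u * cis \<theta>)) powr p" for \<theta>
      using Youngs_inequality[of p "p / (p - 1)" "cmod (f (z * cis \<theta>))" "cmod (h \<theta>)"] p pq
      unfolding norm_mult q nh powr_powr pq(1) by simp
    have "cmod (g z) \<le> integral {0..2*pi} (\<lambda>\<theta>. cmod (f (z * cis \<theta>)) powr p / p + (1 - 1 / p) * cmod (f (u * cis \<theta>)) powr p)"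
      unfolding g_def
      by (rule integral_norm_bound_integral[OF _ has_integral_integrable[OF bd] young])
         (intro integrable_continuous_real continuous_intros ch continuous_on_circle[OF cf] z)
    then have "cmod (g z) \<le> 2 * pi * \<psi> z / p + (1 - 1 / p) * (2 * pi * \<psi> u)"
      by (simp only: integral_unique[OF bd])
    moreover have "\<psi> z = \<psi> v"
      unfolding \<psi>_def using circle_mean_rotate[OF cp uv(2) z(1)] .
    ultimately show "cmod (g z) \<le> 2 * pi * (\<psi> v / p + (1 - 1 / p) * \<psi> u)"
      by (simp add: algebra_simps)
  qed auto
  moreover have "0 \<le> \<psi> u"
    unfolding \<psi>_def by (rule circle_mean_nonneg) auto
  \<comment> \<open>The part \<open>(1 - 1/p) * \<psi> u\<close> is absorbed by the left side, and
    what remains is \<open>\<psi> u / p \<le> \<psi> v / p\<close>.\<close>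
  ultimately have "2 * pi * \<psi> u \<le> 2 * pi * (\<psi> v / p + (1 - 1 / p) * \<psi> u)"
    by (simp add: gu norm_mult)
  then have "\<psi> u \<le> \<psi> v"
    using p by (simp add: field_simps)
  then show ?thesis
    by (simp add: \<psi>_def)
qed

section \<open>Taylor coefficients of Bergman functions\<close>

lemma has_integral_cis_int:
  fixes m :: int
  shows "((\<lambda>\<theta>. cis (of_int m * \<theta>)) has_integral (if m = 0 then 2 * of_real pi else 0)) {0..2*pi}"
proof (cases "m = 0")
  case True
  then show ?thesis
    using has_integral_const_real[of "1::complex" 0 "2*pi"] by (simp add: scaleR_conv_of_real)
next
  case False
  let ?F = "\<lambda>z. exp (\<i> * of_int m * z) / (\<i> * of_int m)"
  have "((\<lambda>\<theta>. exp (\<i> * of_int m * of_real \<theta>)) has_integral (?F (of_real (2*pi)) - ?F (of_real 0))) {0..2*pi}"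
    using False
    by (intro fundamental_theorem_of_calculus has_vector_derivative_real_field)
       (auto intro!: derivative_eq_intros)
  moreover have "exp (\<i> * of_int m * of_real (2*pi)) = 1"
    using exp_two_pi_i exp_integer_2pi[of "of_int m"] by (simp add: mult_ac)
  ultimately show ?thesis
    using False by (simp add: cis_conv_exp mult_ac)
qed

text \<open>Parseval for polynomials: orthogonality of the exponentials leaves the diagonal of the
  double sum.\<close>

lemma circle_mean_polynomial:
  fixes c :: "nat \<Rightarrow> complex"
  shows "circle_mean (\<lambda>z. (cmod (\<Sum>k<n. c k * z ^ k))\<^sup>2) w = (\<Sum>k<n. (cmod (c k))\<^sup>2 * (cmod w)\<^sup>2 ^ k)"
proof -
  define d where "d k = c k * w ^ k" for k
  have "((\<lambda>\<theta>. \<Sum>j<n. \<Sum>k<n. d j * cnj (d k) * cis (of_int (int j - int k) * \<theta>))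
       has_integral (\<Sum>j<n. \<Sum>k<n. d j * cnj (d k) * (if int j - int k = 0 then 2 * of_real pi else 0))) {0..2*pi}"
    by (intro has_integral_sum finite_lessThan has_integral_mult_right has_integral_cis_int)
  also have "(\<Sum>j<n. \<Sum>k<n. d j * cnj (d k) * (if int j - int k = 0 then 2 * of_real pi else 0))
     = (\<Sum>j<n. \<Sum>k<n. if k = j then d j * cnj (d k) * (2 * of_real pi) else 0)"
    by (intro sum.cong) auto
  also have "\<dots> = (\<Sum>j<n. d j * cnj (d j) * (2 * of_real pi))"
    by (intro sum.cong) (auto simp: sum.delta)
  also have "\<dots> = of_real (2 * pi * (\<Sum>j<n. (cmod (d j))\<^sup>2))"
    unfolding complex_norm_square[symmetric] by (simp add: sum_distrib_left mult_ac)
  finally have "((\<lambda>\<theta>. Re (\<Sum>j<n. \<Sum>k<n. d j * cnj (d k) * cis (of_int (int j - int k) * \<theta>)))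
       has_integral Re (of_real (2 * pi * (\<Sum>j<n. (cmod (d j))\<^sup>2)))) {0..2*pi}"
    by (rule has_integral_Re)
  moreover have "Re (\<Sum>j<n. \<Sum>k<n. d j * cnj (d k) * cis (of_int (int j - int k) * \<theta>))
      = (cmod (\<Sum>k<n. c k * (w * cis \<theta>) ^ k))\<^sup>2" for \<theta>
  proof -
    have "complex_of_real ((cmod (\<Sum>k<n. c k * (w * cis \<theta>) ^ k))\<^sup>2)
       = (\<Sum>j<n. \<Sum>k<n. (d j * cis (of_nat j * \<theta>)) * cnj (d k * cis (of_nat k * \<theta>)))"
      unfolding complex_norm_square cnj_sum sum_product
      by (simp add: d_def power_mult_distrib Complex.DeMoivre mult_ac)
    also have "\<dots> = (\<Sum>j<n. \<Sum>k<n. d j * cnj (d k) * cis (of_int (int j - int k) * \<theta>))"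
    proof (intro sum.cong refl)
      fix j k
      have "cis (of_int (int j - int k) * \<theta>) = cis (of_nat j * \<theta>) * cnj (cis (of_nat k * \<theta>))"
        by (simp add: cis_cnj cis_mult algebra_simps)
      then show "(d j * cis (of_nat j * \<theta>)) * cnj (d k * cis (of_nat k * \<theta>))
          = d j * cnj (d k) * cis (of_int (int j - int k) * \<theta>)"
        by simp
    qed
    finally show ?thesis
      by (metis Re_complex_of_real)
  qed
  ultimately have "((\<lambda>\<theta>. (cmod (\<Sum>k<n. c k * (w * cis \<theta>) ^ k))\<^sup>2) has_integral (2 * pi * (\<Sum>j<n. (cmod (d j))\<^sup>2))) {0..2*pi}"
    by simp
  then show ?thesis
    by (simp add: circle_mean_def integral_unique d_def norm_mult norm_power power_mult_distrib
        power_mult[symmetric] mult.commute[of 2])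
qed

lemma taylor_sums:
  assumes "f holomorphic_on ball 0 1" "cmod z < 1"
  shows "(\<lambda>k. taylor_coeff f k * z ^ k) sums f z"
  using holomorphic_power_series[of f 0 1 z] assms by (simp add: taylor_coeff_def)

lemma taylor_summable_norm:
  assumes f: "f holomorphic_on ball 0 1" and r: "0 \<le> r" "r < 1"
  shows "summable (\<lambda>k. cmod (taylor_coeff f k) * r ^ k)"
proof -
  have "summable (\<lambda>k. taylor_coeff f k * of_real ((1 + r) / 2) ^ k)"
    using taylor_sums[OF f, of "of_real ((1 + r) / 2)"] r
    by (intro sums_summable) (auto simp del: of_real_divide of_real_add)
  from powser_insidea[OF this, of "of_real r"] r show ?thesis
    by (simp add: norm_mult norm_power del: of_real_divide of_real_add)
qed

text \<open>Parseval for the Taylor polynomials passes to the limit, with the constant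
  \<open>M^2\<close> as dominating function since the series converges absolutely on the circle; the
  first \<open>n\<close> terms are at most every later partial sum.\<close>

lemma bessel_circle:
  assumes f: "f holomorphic_on ball 0 1" and w: "cmod w < 1"
  shows "(\<Sum>k<n. (cmod (taylor_coeff f k))\<^sup>2 * (cmod w)\<^sup>2 ^ k) \<le> circle_mean (\<lambda>z. (cmod (f z))\<^sup>2) w"
proof -
  let ?a = "taylor_coeff f"
  let ?S = "\<lambda>N z. \<Sum>k<N. ?a k * z ^ k"
  have cf: "continuous_on (ball 0 1) f"
    using f by (rule holomorphic_on_imp_continuous_on)
  have sm: "summable (\<lambda>k. cmod (?a k) * cmod w ^ k)"
    using taylor_summable_norm[OF f, of "cmod w"] w by simp
  define M where "M = (\<Sum>k. cmod (?a k) * cmod w ^ k)"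
  have M: "cmod (?S N (w * cis \<theta>)) \<le> M" for N \<theta>
  proof -
    have "cmod (?S N (w * cis \<theta>)) \<le> (\<Sum>k<N. cmod (?a k) * cmod w ^ k)"
      by (rule order_trans[OF norm_sum]) (simp add: norm_mult norm_power)
    also have "\<dots> \<le> M"
      unfolding M_def by (rule sum_le_suminf[OF sm]) auto
    finally show ?thesis .
  qed
  have "(\<lambda>N. integral {0..2*pi} (\<lambda>\<theta>. (cmod (?S N (w * cis \<theta>)))\<^sup>2))
      \<longlonglongrightarrow> integral {0..2*pi} (\<lambda>\<theta>. (cmod (f (w * cis \<theta>)))\<^sup>2)"
  proof (rule dominated_convergence(2)[where h = "\<lambda>_. M\<^sup>2"])
    show "(\<lambda>\<theta>. (cmod (?S N (w * cis \<theta>)))\<^sup>2) integrable_on {0..2*pi}" for N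
      by (intro integrable_continuous_real continuous_intros)
    show "norm ((cmod (?S N (w * cis \<theta>)))\<^sup>2) \<le> M\<^sup>2" for N \<theta>
      using M[of \<theta> N] by (simp add: power_mono)
    show "(\<lambda>N. (cmod (?S N (w * cis \<theta>)))\<^sup>2) \<longlonglongrightarrow> (cmod (f (w * cis \<theta>)))\<^sup>2" for \<theta>
      using taylor_sums[OF f, of "w * cis \<theta>"] w
      by (intro tendsto_intros) (auto simp: sums_def norm_mult)
  qed auto
  then have "(\<lambda>N. circle_mean (\<lambda>z. (cmod (?S N z))\<^sup>2) w) \<longlonglongrightarrow> circle_mean (\<lambda>z. (cmod (f z))\<^sup>2) w"
    unfolding circle_mean_def by (intro tendsto_divide tendsto_const) auto
  then have "(\<lambda>N. \<Sum>k<N. (cmod (?a k))\<^sup>2 * (cmod w)\<^sup>2 ^ k) \<longlonglongrightarrow> circle_mean (\<lambda>z. (cmod (f z))\<^sup>2) w"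
    unfolding circle_mean_polynomial .
  then show ?thesis
    by (rule LIMSEQ_le_const)
       (auto intro!: exI[of _ n] sum_mono2)
qed

lemma nn_integral_annulus_powr:
  assumes "\<gamma> > -1" and x: "0 \<le> x" "x \<le> 1"
  shows "(\<integral>\<^sup>+w. ennreal (indicator (ball 0 1) w * (indicator {x..} ((cmod w)\<^sup>2) * (1 - (cmod w)\<^sup>2) powr \<gamma>)) \<partial>lborel)
       = ennreal (pi * (1 - x) powr (\<gamma> + 1) / (\<gamma> + 1))"
proof -
  have lt1: "r\<^sup>2 < 1" if "0 \<le> r" "r < 1" for r :: real
    using that by (simp add: power_less_one_iff)
  have sx: "sqrt x \<le> 1" "0 \<le> sqrt x" using x by simp_all
  have "(\<integral>\<^sup>+w. ennreal (indicator (ball 0 1) w * (indicator {x..} ((cmod w)\<^sup>2) * (1 - (cmod w)\<^sup>2) powr \<gamma>)) \<partial>lborel)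
     = (\<integral>\<^sup>+w. (\<lambda>r. ennreal (indicator {..<1} r * (indicator {x..} (r\<^sup>2) * (1 - r\<^sup>2) powr \<gamma>))) (cmod w) \<partial>lborel)"
    by (intro nn_integral_cong) (auto simp: indicator_def)
  also have "\<dots> = (\<integral>\<^sup>+r. ennreal (indicator {..<1} r * (indicator {x..} (r\<^sup>2) * (1 - r\<^sup>2) powr \<gamma>)) * ennreal (2 * pi * r) * indicator {0..} r \<partial>lborel)"
    by (rule nn_integral_complex_norm) measurable
  also have "\<dots> = (\<integral>\<^sup>+r. ennreal ((1 - r\<^sup>2) powr \<gamma> * (2 * pi * r)) * indicator {sqrt x..1} r \<partial>lborel)"
  proof (rule nn_integral_cong)
    fix r :: real
    show "ennreal (indicator {..<1} r * (indicator {x..} (r\<^sup>2) * (1 - r\<^sup>2) powr \<gamma>)) * ennreal (2 * pi * r) * indicator {0..} r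
       = ennreal ((1 - r\<^sup>2) powr \<gamma> * (2 * pi * r)) * indicator {sqrt x..1} r"
    proof (cases "0 \<le> r \<and> r < 1")
      case True
      then have "x \<le> r\<^sup>2 \<longleftrightarrow> sqrt x \<le> r"
        using x by (simp add: real_sqrt_le_iff' real_le_lsqrt sqrt_le_D iff_conv_conj_imp)
      with True show ?thesis
        by (simp add: indicator_def ennreal_mult')
    next
      case False
      \<comment> \<open>At \<open>r = 1\<close> both sides vanish, the right one because
        \<open>0 powr \<gamma> = 0\<close> for every \<open>\<gamma>\<close>.\<close>
      then have "r = 1 \<or> r \<notin> {sqrt x..1}"
        using order_trans[OF sx(2)] by fastforce
      with False show ?thesis
        by (auto simp: indicator_def)
    qed
  qed
  also have "\<dots> = ennreal (- pi * (1 - 1\<^sup>2) powr (\<gamma> + 1) / (\<gamma> + 1) - (- pi * (1 - (sqrt x)\<^sup>2) powr (\<gamma> + 1) / (\<gamma> + 1)))"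
  proof (rule nn_integral_has_integral_lebesgue')
    show "((\<lambda>r. (1 - r\<^sup>2) powr \<gamma> * (2 * pi * r)) has_integral
        (- pi * (1 - 1\<^sup>2) powr (\<gamma> + 1) / (\<gamma> + 1) - (- pi * (1 - (sqrt x)\<^sup>2) powr (\<gamma> + 1) / (\<gamma> + 1)))) {sqrt x..1}"
    \<comment> \<open>For \<open>\<gamma> < 0\<close> the integrand blows up at \<open>r = 1\<close>
      while the antiderivative is still continuous there, so differentiability is asked for in the
      interior only.\<close>
    proof (rule fundamental_theorem_of_calculus_interior[OF sx(1)])
      show "continuous_on {sqrt x..1} (\<lambda>r. - pi * (1 - r\<^sup>2) powr (\<gamma> + 1) / (\<gamma> + 1))"
        using assms sx by (intro continuous_on_powr' continuous_intros) (auto intro!: power_le_one order_trans[OF sx(2)])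
      fix r assume r: "r \<in> {sqrt x<..<1}"
      then have r1: "1 - r\<^sup>2 > 0"
        using lt1[of r] order_trans[OF sx(2), of r] by auto
      have "((\<lambda>r. (1 - r\<^sup>2) powr (\<gamma> + 1)) has_real_derivative (\<gamma> + 1) * (1 - r\<^sup>2) powr \<gamma> * (- 2 * r)) (at r)"
        using r1 by (auto intro!: derivative_eq_intros)
      from DERIV_cmult[OF this, of "- pi / (\<gamma> + 1)"]
      show "((\<lambda>r. - pi * (1 - r\<^sup>2) powr (\<gamma> + 1) / (\<gamma> + 1)) has_vector_derivative (1 - r\<^sup>2) powr \<gamma> * (2 * pi * r)) (at r)"
        using assms unfolding has_real_derivative_iff_has_vector_derivative[symmetric]
        by (simp add: mult_ac)
    qed
    fix r assume "r \<in> {sqrt x..1}"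
    then have "0 \<le> r"
      using order_trans[OF sx(2)] by auto
    then show "0 \<le> (1 - r\<^sup>2) powr \<gamma> * (2 * pi * r)"
      by simp
  qed
  finally show ?thesis
    using x by simp
qed

lemma nn_integral_bergman_weight:
  assumes "\<alpha> \<ge> 0"
  shows "(\<integral>\<^sup>+w. ennreal (bergman_weight \<alpha> w) \<partial>lborel) = 1"
proof -
  have "(\<integral>\<^sup>+w. ennreal (bergman_weight \<alpha> w) \<partial>lborel)
    = (\<integral>\<^sup>+w. ennreal ((\<alpha> + 1) / pi) * ennreal (indicator (ball 0 1) w * (indicator {0..} ((cmod w)\<^sup>2) * (1 - (cmod w)\<^sup>2) powr \<alpha>)) \<partial>lborel)"
    using assms by (intro nn_integral_cong) (simp add: ennreal_mult'[symmetric])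
  also have "\<dots> = ennreal ((\<alpha> + 1) / pi) * ennreal (pi * (1 - 0) powr (\<alpha> + 1) / (\<alpha> + 1))"
    using assms nn_integral_annulus_powr[of \<alpha> 0] by (subst nn_integral_cmult) auto
  also have "\<dots> = 1"
    using assms by (simp add: ennreal_mult'[symmetric])
  finally show ?thesis .
qed

text \<open>For \<open>k > 0\<close> this is \<open>(1 + 1/k)^k \<le> e\<close>. It says that
  \<open>|w|^(2k)\<close> stays above \<open>1/e\<close> on the annulus
  \<open>|w|^2 \<ge> 1 - 1/(k+1)\<close>, from which the size of the \<open>k\<close>-th coefficient
  is read off.\<close>

lemma exp_minus_one_le_power:
  "exp (- 1) \<le> (1 - 1 / (real k + 1)) ^ k"
proof (cases "k = 0")
  case False
  have "1 + 1 / real k \<le> exp (1 / real k)"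
    by (rule exp_ge_add_one_self)
  then have "exp (- (1 / real k)) \<le> 1 / (1 + 1 / real k)"
    using False by (simp add: exp_minus field_simps)
  also have "\<dots> = 1 - 1 / (real k + 1)"
    using False by (simp add: field_simps)
  finally have "exp (- (1 / real k)) ^ k \<le> (1 - 1 / (real k + 1)) ^ k"
    by (rule power_mono) simp
  then show ?thesis
    using False by (simp add: exp_of_nat_mult[symmetric])
qed simp

text \<open>Functions in the Bergman space are unconstrained off the disk, so measurability is
  argued throughout for this cut-off version, called \<open>fi\<close>.\<close>

lemma borel_measurable_indicator_ball_scaleR:
  assumes "continuous_on (ball 0 1) f"
  shows "(\<lambda>w. indicator (ball 0 1) w *\<^sub>R f w :: complex) \<in> borel_measurable borel"
  using assms by (intro borel_measurable_continuous_on_indicator) auto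

text \<open>A pointwise form of Hoelder: with \<open>y = 1 - |w|^2\<close> and
  \<open>s = |f w|\<close>, either \<open>s^(p-2) \<ge> y^(\<beta>-\<alpha>)\<close>, and
  \<open>y^\<beta> s^2\<close> is at most \<open>y^\<alpha> s^p\<close>, or \<open>s\<close> is
  bounded by a power of \<open>y\<close>, and it is at most \<open>y^\<gamma>\<close>. The second
  alternative determines \<open>\<gamma> = \<beta> + 2 (\<beta>-\<alpha>)/(p-2)\<close>, and the
  hypothesis on \<open>\<beta>\<close> is precisely \<open>\<gamma> > -1\<close>.\<close>

lemma nn_integral_disk_weighted_square_le:
  assumes al: "\<alpha> \<ge> 0" and p: "p > 2" and f: "in_bergman \<alpha> p f"
    and \<beta>: "\<beta> > (2 * \<alpha> + 2) / p - 1"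
  shows "(\<integral>\<^sup>+w. ennreal (indicator (ball 0 1) w * ((1 - (cmod w)\<^sup>2) powr \<beta> * (cmod (f w))\<^sup>2)) \<partial>lborel) < \<infinity>"
proof -
  have cf: "continuous_on (ball 0 1) f"
    using f by (auto simp: in_bergman_def intro: holomorphic_on_imp_continuous_on)
  define fi where "fi = (\<lambda>w. indicator (ball 0 1) w *\<^sub>R f w)"
  have [measurable]: "fi \<in> borel_measurable borel"
    unfolding fi_def by (rule borel_measurable_indicator_ball_scaleR[OF cf])
  define \<gamma> where "\<gamma> = (\<beta> * p - 2 * \<alpha>) / (p - 2)"
  have \<gamma>: "\<gamma> > -1"
    using \<beta> p by (simp add: \<gamma>_def field_simps)
  have young: "y powr \<beta> * s\<^sup>2 \<le> y powr \<alpha> * s powr p + y powr \<gamma>" if y: "0 < y" and s: "0 \<le> s" for y s :: real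
  proof (cases "s powr (p - 2) \<ge> y powr (\<beta> - \<alpha>)")
    case True
    have "y powr \<beta> * s\<^sup>2 = y powr \<alpha> * s\<^sup>2 * y powr (\<beta> - \<alpha>)"
      using y by (simp add: powr_diff)
    also have "\<dots> \<le> y powr \<alpha> * s\<^sup>2 * s powr (p - 2)"
      using True by (intro mult_left_mono) auto
    also have "\<dots> = y powr \<alpha> * s powr p"
      using s p by (cases "s = 0") (auto simp: powr_diff powr_numeral)
    finally show ?thesis
      by (smt (verit) powr_ge_zero)
  next
    case False
    show ?thesis
    proof (cases "s = 0")
      case False
      with s have s0: "s > 0" by simp
      have "s\<^sup>2 = (s powr (p - 2)) powr (2 / (p - 2))"
      proof -
        have "q * (2 / q) = 2" if "q > 0" for q :: real
          using that by simp
        from this[of "p - 2"] show ?thesis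
          using s0 p by (simp only: powr_powr powr_numeral less_imp_le)
      qed
      also have "\<dots> \<le> (y powr (\<beta> - \<alpha>)) powr (2 / (p - 2))"
        using \<open>\<not> s powr (p - 2) \<ge> y powr (\<beta> - \<alpha>)\<close> p by (intro powr_mono2) auto
      finally have "y powr \<beta> * s\<^sup>2 \<le> y powr \<beta> * y powr ((\<beta> - \<alpha>) * (2 / (p - 2)))"
        using y by (intro mult_left_mono) (auto simp: powr_powr)
      also have "\<dots> = y powr \<gamma>"
        using p by (simp add: powr_add[symmetric] \<gamma>_def field_simps)
      finally show ?thesis
        by (smt (verit) powr_ge_zero mult_nonneg_nonneg)
    qed auto
  qed
  define F where "F w = ennreal (bergman_weight \<alpha> w * cmod (fi w) powr p)" for w
  define H where "H w = ennreal (indicator (ball 0 1) w * (indicator {0..} ((cmod w)\<^sup>2) * (1 - (cmod w)\<^sup>2) powr \<gamma>))" for w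
  have [measurable]: "F \<in> borel_measurable borel" "H \<in> borel_measurable borel"
    unfolding F_def H_def by measurable
  have "(\<integral>\<^sup>+w. ennreal (indicator (ball 0 1) w * ((1 - (cmod w)\<^sup>2) powr \<beta> * (cmod (f w))\<^sup>2)) \<partial>lborel)
    \<le> (\<integral>\<^sup>+w. ennreal (pi / (\<alpha> + 1)) * F w + H w \<partial>lborel)"
  proof (rule nn_integral_mono)
    fix w :: complex
    show "ennreal (indicator (ball 0 1) w * ((1 - (cmod w)\<^sup>2) powr \<beta> * (cmod (f w))\<^sup>2))
      \<le> ennreal (pi / (\<alpha> + 1)) * F w + H w"
    proof (cases "cmod w < 1")
      case True
      then have "0 < 1 - (cmod w)\<^sup>2"
        by (simp add: power_less_one_iff)
      from young[OF this, of "cmod (f w)"] True al show ?thesis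
        by (simp add: F_def H_def fi_def ennreal_mult'[symmetric] ennreal_plus[symmetric] del: ennreal_plus)
    qed auto
  qed
  also have "\<dots> = ennreal (pi / (\<alpha> + 1)) * integral\<^sup>N lborel F + integral\<^sup>N lborel H"
    by (simp add: nn_integral_add nn_integral_cmult)
  also have "integral\<^sup>N lborel F = bergman_integral \<alpha> p f"
    unfolding bergman_integral_def F_def fi_def by (intro nn_integral_cong) (auto simp: indicator_def)
  also have "integral\<^sup>N lborel H = ennreal (pi * (1 - 0) powr (\<gamma> + 1) / (\<gamma> + 1))"
    unfolding H_def using \<gamma> by (intro nn_integral_annulus_powr) auto
  also have "ennreal (pi / (\<alpha> + 1)) * bergman_integral \<alpha> p f + ennreal (pi * (1 - 0) powr (\<gamma> + 1) / (\<gamma> + 1)) < \<infinity>"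
    using f by (auto simp: in_bergman_def ennreal_mult_less_top)
  finally show ?thesis .
qed

text \<open>Absolute convergence needs \<open>p > 2 + 2 \<alpha>\<close>: only then can \<open>\<beta>\<close> in the previous lemma be negative, so
  that \<open>|a\<^sub>k| / (k + 1)\<close> splits into \<open>|a\<^sub>k|\<^sup>2 (k + 1)\<^sup>-\<^sup>1\<^sup>-\<^sup>\<beta>\<close> and \<open>(k + 1)\<^sup>-\<^sup>1\<^sup>+\<^sup>\<beta>\<close>.\<close>

lemma summable_taylor_coeff_div:
  assumes al: "\<alpha> \<ge> 0" and p: "p > 2 + 2 * \<alpha>" and f: "in_bergman \<alpha> p f"
  shows "summable (\<lambda>k. cmod (taylor_coeff f k) / (real k + 1))"
proof -
  let ?a = "\<lambda>k. cmod (taylor_coeff f k)"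
  have hf: "f holomorphic_on ball 0 1"
    using f by (auto simp: in_bergman_def)
  then have cf: "continuous_on (ball 0 1) f"
    by (rule holomorphic_on_imp_continuous_on)
  define u where "u = (2 * \<alpha> + 2) / p"
  \<comment> \<open>The admissible negative values form the interval \<open>(u - 1, 0)\<close>; this
    is its midpoint.\<close>
  define \<beta> where "\<beta> = (u - 1) / 2"
  have "0 < u" "u < 1"
    using p al by (simp_all add: u_def field_simps)
  then have \<beta>: "-1 < \<beta>" "\<beta> < 0" "\<beta> > (2 * \<alpha> + 2) / p - 1"
    unfolding u_def[symmetric] unfolding \<beta>_def by auto
  let ?I = "\<integral>\<^sup>+w. ennreal (indicator (ball 0 1) w * ((1 - (cmod w)\<^sup>2) powr \<beta> * (cmod (f w))\<^sup>2)) \<partial>lborel"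
  have "?I < \<infinity>"
    using nn_integral_disk_weighted_square_le[OF al _ f \<beta>(3)] p al by simp
  then obtain r where r: "0 \<le> r" "?I = ennreal r"
    by (cases ?I) auto
  define c where "c = exp (- 1) * pi / (\<beta> + 1)"
  have c: "c > 0"
    using \<beta> by (simp add: c_def)
  define b where "b k = (?a k)\<^sup>2 * (real k + 1) powr (- \<beta> - 1)" for k
  have "(\<Sum>k<n. c * b k) \<le> r" for n
  proof -
    let ?J = "\<lambda>k w. ennreal (indicator (ball 0 1) w * ((1 - (cmod w)\<^sup>2) powr \<beta> * ((?a k)\<^sup>2 * (cmod w)\<^sup>2 ^ k)))"
    have trm: "ennreal (c * b k) \<le> (\<integral>\<^sup>+w. ?J k w \<partial>lborel)" for k
    proof -
      \<comment> \<open>On the annulus \<open>x \<le> |w|^2\<close> the power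
        \<open>|w|^(2k)\<close> is at least \<open>exp (- 1)\<close>, and the weighted mass of the
        annulus is \<open>pi * (k+1)^(-\<beta>-1) / (\<beta>+1)\<close>. Together they give
        \<open>c * b k\<close>.\<close>
      define x where "x = 1 - 1 / (real k + 1)"
      have x: "0 \<le> x" "x \<le> 1"
        by (simp_all add: x_def)
      have "ennreal (c * b k) = ennreal ((?a k)\<^sup>2 * exp (- 1)) * ennreal (pi * (1 - x) powr (\<beta> + 1) / (\<beta> + 1))"
      proof -
        have "(1 - x) powr (\<beta> + 1) = (real k + 1) powr (- \<beta> - 1)"
          using powr_minus_divide[of "real k + 1" "\<beta> + 1"] by (simp add: x_def powr_divide)
        then show ?thesis
          using \<beta> by (simp add: ennreal_mult'[symmetric] c_def b_def mult_ac)
      qed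
      also have "\<dots> = (\<integral>\<^sup>+w. ennreal ((?a k)\<^sup>2 * exp (- 1)) * ennreal (indicator (ball 0 1) w * (indicator {x..} ((cmod w)\<^sup>2) * (1 - (cmod w)\<^sup>2) powr \<beta>)) \<partial>lborel)"
        using nn_integral_annulus_powr[OF \<beta>(1) x] by (subst nn_integral_cmult) auto
      also have "\<dots> \<le> (\<integral>\<^sup>+w. ?J k w \<partial>lborel)"
      proof (rule nn_integral_mono)
        fix w :: complex
        have "exp (- 1) \<le> (cmod w)\<^sup>2 ^ k" if "x \<le> (cmod w)\<^sup>2"
          using exp_minus_one_le_power[of k] power_mono[OF that x(1), of k] by (simp add: x_def)
        then have "indicator {x..} ((cmod w)\<^sup>2) * exp (- 1) \<le> (cmod w)\<^sup>2 ^ k"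
          by (auto simp: indicator_def)
        then have "(indicator (ball 0 1) w * (1 - (cmod w)\<^sup>2) powr \<beta> * (?a k)\<^sup>2) * (indicator {x..} ((cmod w)\<^sup>2) * exp (- 1))
             \<le> (indicator (ball 0 1) w * (1 - (cmod w)\<^sup>2) powr \<beta> * (?a k)\<^sup>2) * (cmod w)\<^sup>2 ^ k"
          by (rule mult_left_mono) auto
        then show "ennreal ((?a k)\<^sup>2 * exp (- 1)) * ennreal (indicator (ball 0 1) w * (indicator {x..} ((cmod w)\<^sup>2) * (1 - (cmod w)\<^sup>2) powr \<beta>)) \<le> ?J k w"
          by (subst ennreal_mult'[symmetric]) (auto intro!: ennreal_leI simp: mult_ac)
      qed
      finally show ?thesis .
    qed
    have "ennreal (\<Sum>k<n. c * b k) = (\<Sum>k<n. ennreal (c * b k))"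
      using c by (intro sum_ennreal[symmetric]) (auto simp: b_def)
    also have "\<dots> \<le> (\<Sum>k<n. \<integral>\<^sup>+w. ?J k w \<partial>lborel)"
      by (intro sum_mono trm)
    also have "\<dots> = (\<integral>\<^sup>+w. (\<Sum>k<n. ?J k w) \<partial>lborel)"
      by (intro nn_integral_sum[symmetric]) measurable
    also have "\<dots> \<le> (\<integral>\<^sup>+w. ennreal (indicator (ball 0 1) w * ((1 - (cmod w)\<^sup>2) powr \<beta> * circle_mean (\<lambda>z. (cmod (f z))\<^sup>2) w)) \<partial>lborel)"
    proof (rule nn_integral_mono)
      fix w :: complex
      have "(\<Sum>k<n. ?J k w) = ennreal (indicator (ball 0 1) w * ((1 - (cmod w)\<^sup>2) powr \<beta> * (\<Sum>k<n. (?a k)\<^sup>2 * (cmod w)\<^sup>2 ^ k)))"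
        by (subst sum_ennreal) (auto simp: sum_distrib_left)
      also have "\<dots> \<le> ennreal (indicator (ball 0 1) w * ((1 - (cmod w)\<^sup>2) powr \<beta> * circle_mean (\<lambda>z. (cmod (f z))\<^sup>2) w))"
        using bessel_circle[OF hf, of w n]
        by (cases "cmod w < 1") (auto intro!: ennreal_leI mult_left_mono)
      finally show "(\<Sum>k<n. ?J k w) \<le> ennreal (indicator (ball 0 1) w * ((1 - (cmod w)\<^sup>2) powr \<beta> * circle_mean (\<lambda>z. (cmod (f z))\<^sup>2) w))" .
    qed
    also have "\<dots> = ?I"
      by (rule nn_integral_circle_mean[symmetric]) (use cf in \<open>auto intro!: continuous_intros\<close>)
    finally show ?thesis
      using r by (simp add: ennreal_le_iff)
  qed
  then have "summable (\<lambda>k. c * b k)"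
    using c by (intro summableI_nonneg_bounded) (auto simp: b_def)
  then have sb: "summable b"
    using c by (simp add: summable_cmult_iff)
  have "summable (\<lambda>k. real (Suc k) powr (\<beta> - 1))"
    using \<beta> summable_real_powr_iff[of "\<beta> - 1"] by (subst summable_Suc_iff) auto
  then have sc: "summable (\<lambda>k. (real k + 1) powr (\<beta> - 1))"
    by (simp add: add.commute)
  show ?thesis
  proof (rule summable_comparison_test'[OF summable_add[OF sb sc]])
    fix k :: nat
    define y where "y = real k + 1"
    have y: "y > 0" by (simp add: y_def)
    have sq: "u * v \<le> u\<^sup>2 + v\<^sup>2" if "0 \<le> u" "0 \<le> v" for u v :: real
      using sum_squares_bound[of u v] mult_nonneg_nonneg[OF that] by linarith
    have "(?a k * y powr ((- \<beta> - 1) / 2)) * y powr ((\<beta> - 1) / 2) \<le> (?a k * y powr ((- \<beta> - 1) / 2))\<^sup>2 + (y powr ((\<beta> - 1) / 2))\<^sup>2"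
      by (rule sq) auto
    moreover have "y powr ((- \<beta> - 1) / 2) * y powr ((\<beta> - 1) / 2) = 1 / y"
      using y by (simp add: powr_add[symmetric] powr_minus_divide add_divide_distrib[symmetric])
    moreover have "(y powr (s / 2))\<^sup>2 = y powr s" for s
      using y by (simp add: powr_half_sqrt_powr)
    ultimately show "norm (?a k / (real k + 1)) \<le> b k + (real k + 1) powr (\<beta> - 1)"
      using y by (simp add: b_def y_def[symmetric] power_mult_distrib mult.assoc)
  qed
qed

section \<open>The Hilbert matrix as an average of weighted composition operators\<close>

definition moeb_weight :: "real \<Rightarrow> complex \<Rightarrow> complex" where
  "moeb_weight t z = 1 / (1 - of_real (1 - t) * z)"

definition moeb :: "real \<Rightarrow> complex \<Rightarrow> complex" where
  "moeb t z = of_real t * moeb_weight t z"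

lemma moeb_denom_lower:
  assumes "0 \<le> t" "t \<le> 1"
  shows "1 - (1 - t) * cmod z \<le> cmod (1 - of_real (1 - t) * z)"
  using norm_triangle_ineq2[of 1 "of_real (1 - t) * z"] assms
  by (simp add: norm_mult del: of_real_diff)

lemma moeb_denom_pos:
  assumes "0 \<le> t" "t \<le> 1" "cmod z < 1"
  shows "0 < 1 - (1 - t) * cmod z" "1 - of_real (1 - t) * z \<noteq> 0"
proof -
  have "(1 - t) * cmod z \<le> cmod z"
    using assms by (intro mult_left_le_one_le) auto
  then show "0 < 1 - (1 - t) * cmod z"
    using assms by linarith
  then show "1 - of_real (1 - t) * z \<noteq> 0"
    using moeb_denom_lower[OF assms(1,2), of z] by (metis norm_zero not_le)
qed

lemma norm_moeb_less_one:
  assumes t: "0 \<le> t" "t < 1" and z: "cmod z < 1"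
  shows "cmod (moeb t z) < 1"
proof -
  have "t < 1 - (1 - t) * cmod z"
    using mult_strict_left_mono[OF z, of "1 - t"] t by (simp add: algebra_simps)
  also have "\<dots> \<le> cmod (1 - of_real (1 - t) * z)"
    using t by (intro moeb_denom_lower) auto
  finally show ?thesis
    using t by (simp add: moeb_def moeb_weight_def norm_divide divide_simps del: of_real_diff)
qed

text \<open>Substitute \<open>x = moeb t z\<close>. Since
  \<open>1 - x z = (1 - z) * moeb_weight t z\<close>, the integrand becomes
  \<open>x^k / (1 - x z) dx\<close> along a path from 0 to 1, and the antiderivative
  \<open>G\<close> of this function has the required series as its value at 1. The value is the
  Hilbert operator applied to the monomial of degree \<open>k\<close>.\<close>

lemma has_integral_moeb_power:
  assumes z: "cmod z < 1"
  shows "((\<lambda>t. moeb t z ^ k * moeb_weight t z) has_integral (\<Sum>n. z ^ n / of_nat (n + k + 1))) {0..1}"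
proof -
  \<comment> \<open>Coefficients of \<open>G\<close>: the geometric series of
    \<open>x^k / (1 - x z)\<close> integrated term by term.\<close>
  define c where "c m = (if m \<le> k then 0 else z ^ (m - k - 1) / of_nat m)" for m
  \<comment> \<open>A point beyond the unit circle at which the series of \<open>G\<close> still
    converges; the path ends at \<open>moeb 1 z = 1\<close>, so differentiability is needed on the
    closed disk.\<close>
  define K :: complex where "K = of_real (2 / (1 + cmod z))"
  have K: "cmod K > 1" "cmod (z * K) < 1"
    using z by (simp_all add: K_def norm_mult norm_divide less_divide_eq divide_less_eq add_pos_nonneg
        del: of_real_divide of_real_add)
  have sumK: "summable (\<lambda>m. c m * K ^ m)"
  proof -
    have "summable (\<lambda>n. c (n + (k + 1)) * K ^ (n + (k + 1)))"
    proof (rule summable_comparison_test')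
      show "summable (\<lambda>n. cmod K ^ (k + 1) * cmod (z * K) ^ n)"
        using K by (intro summable_mult summable_geometric) simp
      show "norm (c (n + (k + 1)) * K ^ (n + (k + 1))) \<le> cmod K ^ (k + 1) * cmod (z * K) ^ n" for n
      proof -
        have "norm (c (n + (k + 1)) * K ^ (n + (k + 1))) = cmod K ^ (k + 1) * cmod (z * K) ^ n / real (n + (k + 1))"
          by (simp add: c_def norm_mult norm_divide norm_power power_add power_mult_distrib del: of_nat_add of_nat_Suc)
        also have "\<dots> \<le> cmod K ^ (k + 1) * cmod (z * K) ^ n / 1"
          by (intro divide_left_mono) auto
        finally show ?thesis by simp
      qed
    qed
    then show ?thesis
      by (subst (asm) summable_iff_shift)
  qed
  define G where "G x = (\<Sum>m. c m * x ^ m)" for x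
  have dG: "(G has_field_derivative x ^ k / (1 - x * z)) (at x)" if x: "cmod x \<le> 1" for x
  proof -
    have xz: "cmod (x * z) < 1"
      using x z by (simp add: norm_mult) (meson le_less_trans mult_left_le_one_le norm_ge_zero)
    have "(\<lambda>n. x ^ k * (x * z) ^ n) sums (x ^ k * (1 / (1 - x * z)))"
      using xz by (intro sums_mult geometric_sums)
    also have "(\<lambda>n. x ^ k * (x * z) ^ n) = (\<lambda>n. diffs c (n + k) * x ^ (n + k))"
      by (auto simp: diffs_def c_def power_add power_mult_distrib simp del: of_nat_Suc of_nat_add)
    finally have "(\<lambda>n. diffs c n * x ^ n) sums (x ^ k * (1 / (1 - x * z)))"
      by (subst (asm) sums_iff_shift) (auto simp: diffs_def c_def)
    then show ?thesis
      unfolding G_def using termdiffs_strong[OF sumK, of x] x K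
      by (simp add: sums_iff)
  qed
  have "((\<lambda>t. moeb t z ^ k * moeb_weight t z) has_integral (G (moeb 1 z) - G (moeb 0 z))) {0..1}"
  proof (rule fundamental_theorem_of_calculus)
    fix t :: real assume t: "t \<in> {0..1}"
    have nz: "1 - of_real (1 - t) * z \<noteq> 0"
      using moeb_denom_pos(2)[of t z] t z by auto
    have "cmod (moeb t z) \<le> 1"
    proof (cases "t = 1")
      case True
      then show ?thesis by (simp add: moeb_def moeb_weight_def)
    next
      case False
      then show ?thesis using norm_moeb_less_one[of t z] t z by auto
    qed
    from dG[OF this] have d1: "(G has_field_derivative moeb t z ^ k / (1 - moeb t z * z)) (at (moeb t z))" .
    define q where "q s = s / (1 - (1 - s) * z)" for s :: complex
    have q: "q (of_real s) = moeb s z" for s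
      by (simp add: q_def moeb_def moeb_weight_def)
    have nz': "1 - (1 - complex_of_real t) * z \<noteq> 0"
      using nz by simp
    have "(q has_field_derivative (1 - z) / (1 - (1 - of_real t) * z)\<^sup>2) (at (of_real t))"
      unfolding q_def using nz'
      by (auto intro!: derivative_eq_intros simp: power2_eq_square algebra_simps)
    then have "((\<lambda>s. G (q s)) has_field_derivative (moeb t z ^ k / (1 - moeb t z * z)) * ((1 - z) / (1 - (1 - of_real t) * z)\<^sup>2)) (at (of_real t))"
      using d1 by (intro DERIV_chain2[of G]) (auto simp: q)
    then have "((\<lambda>s. G (q (of_real s))) has_vector_derivative (moeb t z ^ k / (1 - moeb t z * z)) * ((1 - z) / (1 - (1 - of_real t) * z)\<^sup>2)) (at t within {0..1})"
      by (rule has_vector_derivative_real_field)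
    moreover have "(moeb t z ^ k / (1 - moeb t z * z)) * ((1 - z) / (1 - (1 - of_real t) * z)\<^sup>2) = moeb t z ^ k * moeb_weight t z"
    proof -
      have "1 - moeb t z * z = (1 - z) / (1 - (1 - of_real t) * z)"
        using nz' by (simp add: moeb_def moeb_weight_def field_simps)
      moreover have "1 - z \<noteq> 0"
        using z by auto
      ultimately show ?thesis
        using nz' by (simp add: moeb_weight_def power2_eq_square)
    qed
    ultimately show "((\<lambda>s. G (moeb s z)) has_vector_derivative moeb t z ^ k * moeb_weight t z) (at t within {0..1})"
      by (simp add: q)
  qed auto
  moreover have "G (moeb 0 z) = 0"
    by (simp add: G_def moeb_def c_def)
  moreover have "G (moeb 1 z) = (\<Sum>n. z ^ n / of_nat (n + k + 1))"
  proof -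
    have "summable (\<lambda>m. c m * 1 ^ m)"
      using powser_inside[OF sumK, of 1] K by simp
    then have "G 1 = (\<Sum>n. c (n + (k + 1))) + (\<Sum>m<k + 1. c m)"
      unfolding G_def by (subst suminf_split_initial_segment[of _ "k + 1"]) auto
    then show ?thesis
      by (simp add: moeb_def moeb_weight_def c_def add.assoc)
  qed
  ultimately show ?thesis
    by simp
qed

text \<open>Replacing \<open>z\<close> by its modulus only shrinks the denominator, so the integrand
  is dominated by its value at \<open>cmod z\<close>. That integral is a series with nonnegative
  terms, bounded by a geometric one. The decay \<open>1/(k+1)\<close> is what matters later.\<close>

lemma integral_norm_moeb_power_le:
  assumes z: "cmod z < 1"
  shows "integral {0..1} (\<lambda>t. cmod (moeb t z ^ k * moeb_weight t z)) \<le> 1 / ((real k + 1) * (1 - cmod z))"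
    and "continuous_on {0..1} (\<lambda>t. moeb t z ^ k * moeb_weight t z)"
proof -
  show cont: "continuous_on {0..1} (\<lambda>t. moeb t z ^ k * moeb_weight t z)"
    unfolding moeb_def moeb_weight_def using moeb_denom_pos(2)[of _ z] z
    by (intro continuous_intros) auto
  let ?r = "complex_of_real (cmod z)"
  let ?L = "\<Sum>n. ?r ^ n / of_nat (n + k + 1)"
  have I: "((\<lambda>t. moeb t ?r ^ k * moeb_weight t ?r) has_integral ?L) {0..1}"
    using z by (intro has_integral_moeb_power) simp
  have sl: "summable (\<lambda>n. cmod (?r ^ n / of_nat (n + k + 1)))"
    and le: "cmod (?r ^ n / of_nat (n + k + 1)) \<le> cmod z ^ n * (1 / (real k + 1))" for n
  proof -
    show le: "cmod (?r ^ n / of_nat (n + k + 1)) \<le> cmod z ^ n * (1 / (real k + 1))" for n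
      unfolding norm_divide norm_power norm_of_nat times_divide_eq_right
      by (intro frac_le) auto
    show "summable (\<lambda>n. cmod (?r ^ n / of_nat (n + k + 1)))"
      by (rule summable_comparison_test'[OF summable_mult2[OF summable_geometric[of "cmod z"], of "1 / (real k + 1)"]])
         (use z le in auto)
  qed
  have "integral {0..1} (\<lambda>t. cmod (moeb t z ^ k * moeb_weight t z)) \<le> Re ?L"
  proof (rule integral_le[OF _ _ , of _ "{0..1}" "\<lambda>t. Re (moeb t ?r ^ k * moeb_weight t ?r)", THEN order_trans])
    show "(\<lambda>t. cmod (moeb t z ^ k * moeb_weight t z)) integrable_on {0..1}"
      by (intro integrable_continuous_real continuous_on_norm cont)
    show "(\<lambda>t. Re (moeb t ?r ^ k * moeb_weight t ?r)) integrable_on {0..1}"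
      using has_integral_Re[OF I] by (rule has_integral_integrable)
    show "integral {0..1} (\<lambda>t. Re (moeb t ?r ^ k * moeb_weight t ?r)) \<le> Re ?L"
      using has_integral_Re[OF I] by (simp add: integral_unique)
    fix t :: real assume t: "t \<in> {0..1}"
    define d where "d = 1 - (1 - t) * cmod z"
    have d: "0 < d" "d \<le> cmod (1 - of_real (1 - t) * z)"
      using moeb_denom_pos(1)[of t z] moeb_denom_lower[of t z] t z by (auto simp: d_def)
    have W: "cmod (moeb_weight t z) \<le> 1 / d"
      unfolding moeb_weight_def norm_divide norm_one by (intro frac_le d) auto
    have "moeb_weight t ?r = of_real (1 / d)"
      by (simp add: moeb_weight_def d_def)
    then have "moeb t ?r ^ k * moeb_weight t ?r = of_real ((t * (1 / d)) ^ k * (1 / d))"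
      by (simp add: moeb_def)
    moreover have "cmod (moeb t z ^ k * moeb_weight t z) \<le> (t * (1 / d)) ^ k * (1 / d)"
      using W t d unfolding moeb_def norm_mult norm_power
      by (intro mult_mono power_mono) auto
    ultimately show "cmod (moeb t z ^ k * moeb_weight t z) \<le> Re (moeb t ?r ^ k * moeb_weight t ?r)"
      by (metis Re_complex_of_real)
  qed
  also have "Re ?L \<le> cmod ?L"
    by (rule complex_Re_le_cmod)
  also have "\<dots> \<le> (\<Sum>n. cmod (?r ^ n / of_nat (n + k + 1)))"
    by (rule summable_norm[OF sl])
  also have "\<dots> \<le> (\<Sum>n. cmod z ^ n * (1 / (real k + 1)))"
    using z by (intro suminf_le le sl summable_mult2 summable_geometric) auto
  also have "\<dots> = 1 / ((real k + 1) * (1 - cmod z))"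
    using z by (subst suminf_mult2[symmetric]) (auto simp: suminf_geometric summable_geometric)
  finally show "integral {0..1} (\<lambda>t. cmod (moeb t z ^ k * moeb_weight t z)) \<le> 1 / ((real k + 1) * (1 - cmod z))" .
qed

text \<open>The product bound gives absolute summability over pairs, so Fubini applies; the rest
  translates between \<open>infsum\<close> and \<open>suminf\<close>.\<close>

lemma sums_swap:
  fixes u :: "nat \<Rightarrow> nat \<Rightarrow> complex"
  assumes le: "\<And>n k. cmod (u n k) \<le> x n * y k" and x: "summable x" and y: "summable y"
  shows "(\<Sum>n. \<Sum>k. u n k) = (\<Sum>k. \<Sum>n. u n k)"
proof -
  have xy: "0 \<le> x n * y k" for n k
    using le[of n k] norm_ge_zero[of "u n k"] by linarith
  have su: "summable (\<lambda>k. cmod (u n k))" for n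
    by (rule summable_comparison_test'[OF summable_mult[OF y]]) (use le in auto)
  have "summable (\<lambda>n. \<Sum>k. cmod (u n k))"
  proof (rule summable_comparison_test'[OF summable_mult2[OF x, of "suminf y"]])
    show "norm (\<Sum>k. cmod (u n k)) \<le> x n * suminf y" for n
      using suminf_le[OF le su summable_mult[OF y], of n] suminf_nonneg[OF su, of n]
      by (simp add: suminf_mult[OF y])
  qed
  note sn = this
  have infsum: "infsum v UNIV = suminf v" if "summable (\<lambda>n. norm (v n))" for v :: "nat \<Rightarrow> 'a :: banach"
    using norm_summable_imp_has_sum[OF that summable_sums[OF summable_norm_cancel[OF that]]] by (rule infsumI)
  have "(\<lambda>p. norm ((\<lambda>(n, k). u n k) p)) summable_on (UNIV \<times> UNIV)"
  proof (rule Infinite_Sum.abs_summable_on_Sigma_iff[THEN iffD2], intro conjI ballI)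
    show "(\<lambda>k. norm ((\<lambda>(n, k). u n k) (n, k))) summable_on UNIV" for n
      using su[of n] by (intro norm_summable_imp_summable_on) simp
    have "(\<Sum>\<^sub>\<infinity>k. norm ((\<lambda>(n, k). u n k) (n, k))) = (\<Sum>k. cmod (u n k))" for n
      using su[of n] by (subst infsum) auto
    then show "(\<lambda>n. norm (\<Sum>\<^sub>\<infinity>k. norm ((\<lambda>(n, k). u n k) (n, k)))) summable_on UNIV"
      using sn su by (intro norm_summable_imp_summable_on) (simp add: suminf_nonneg)
  qed
  then have sumon: "(\<lambda>(n, k). u n k) summable_on (UNIV \<times> UNIV)"
    by (rule abs_summable_summable)
  have su': "summable (\<lambda>n. cmod (u n k))" for k
    by (rule summable_comparison_test'[OF summable_mult2[OF x]]) (use le in auto)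
  have sn': "summable (\<lambda>k. norm (\<Sum>n. u n k))"
  proof (rule summable_comparison_test'[OF summable_mult[OF y, of "suminf x"]])
    show "norm (norm (\<Sum>n. u n k)) \<le> suminf x * y k" for k
      using norm_suminf_le[OF le summable_mult2[OF x], of k] by (simp add: suminf_mult2[OF x])
  qed
  have sn'': "summable (\<lambda>n. norm (\<Sum>k. u n k))"
  proof (rule summable_comparison_test'[OF summable_mult2[OF x, of "suminf y"]])
    show "norm (norm (\<Sum>k. u n k)) \<le> x n * suminf y" for n
      using norm_suminf_le[OF le summable_mult[OF y], of n] by (simp add: suminf_mult[OF y])
  qed
  show ?thesis
    using infsum_swap_banach[OF sumon] by (simp add: infsum su su' sn' sn'')
qed

text \<open>Expand \<open>f (moeb t z)\<close> in its Taylor series and integrate term by term. The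
  norms of the terms integrate to at most \<open>|a_k| / ((k+1) (1 - |z|))\<close>, so the
  summability hypothesis is the natural condition for the exchange.\<close>

lemma hilbert_op_eq_integral:
  assumes f: "f holomorphic_on ball 0 1" and a: "summable (\<lambda>k. cmod (taylor_coeff f k) / (real k + 1))"
  shows "summable (\<lambda>k. taylor_coeff f k / of_nat (n + k + 1))"
    and "cmod z < 1 \<Longrightarrow> summable (\<lambda>n. (\<Sum>k. taylor_coeff f k / of_nat (n + k + 1)) * z ^ n)"
    and "cmod z < 1 \<Longrightarrow> integrable lborel (\<lambda>t. indicator {0<..<1} t *\<^sub>R (moeb_weight t z * f (moeb t z)))"
    and "cmod z < 1 \<Longrightarrow> hilbert_op f z = integral\<^sup>L lborel (\<lambda>t. indicator {0<..<1} t *\<^sub>R (moeb_weight t z * f (moeb t z)))"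
    and "hilbert_op f holomorphic_on ball 0 1"
proof -
  let ?a = "taylor_coeff f"
  define M where "M = (\<Sum>k. cmod (?a k) / (real k + 1))"
  have term_le: "cmod (?a k / of_nat (n + k + 1)) \<le> cmod (?a k) / (real k + 1)" for n k
    unfolding norm_divide norm_of_nat by (intro divide_left_mono) auto
  show s1: "summable (\<lambda>k. ?a k / of_nat (n + k + 1))" for n
    by (rule summable_comparison_test'[OF a term_le])
  have cM: "cmod (\<Sum>k. ?a k / of_nat (n + k + 1)) \<le> M" for n
    unfolding M_def by (rule norm_suminf_le[OF term_le a]) 
  have s2: "summable (\<lambda>n. (\<Sum>k. ?a k / of_nat (n + k + 1)) * z ^ n)" if z: "cmod z < 1" for z
  proof (rule summable_comparison_test'[OF summable_mult[OF summable_geometric, of "cmod z" M]])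
    show "norm ((\<Sum>k. ?a k / of_nat (n + k + 1)) * z ^ n) \<le> M * cmod z ^ n" for n
      unfolding norm_mult norm_power by (intro mult_right_mono cM) auto
  qed (use z in auto)
  then show "cmod z < 1 \<Longrightarrow> summable (\<lambda>n. (\<Sum>k. ?a k / of_nat (n + k + 1)) * z ^ n)" .
  show "hilbert_op f holomorphic_on ball 0 1"
    unfolding hilbert_op_def
    by (rule power_series_holomorphic[of 0 1 "\<lambda>n. \<Sum>k. ?a k / of_nat (n + k + 1)"])
       (use s2 in \<open>auto simp: summable_sums\<close>)
  assume z: "cmod z < 1"
  let ?g = "\<lambda>k t. moeb t z ^ k * moeb_weight t z"
  \<comment> \<open>The open interval matters: \<open>moeb 1 z = 1\<close> lies outside the disk,
    where nothing is known about \<open>f\<close>.\<close>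
  define F where "F k t = indicator {0<..<1} t *\<^sub>R (?a k * ?g k t)" for k t
  have Feq: "F k t = ?a k * (indicator {0<..<1} t *\<^sub>R ?g k t)" for k t
    by (simp add: F_def)
  have gi: "set_integrable lborel {0<..<1} (?g k)" for k
    by (rule set_integrable_subset[OF borel_integrable_compact[OF compact_Icc integral_norm_moeb_power_le(2)[OF z], folded set_integrable_def]]) auto
  have "integrable lborel (F k)" for k
    unfolding Feq using gi[of k] by (intro integrable_mult_right) (auto simp: set_integrable_def)
  have gn: "integral\<^sup>L lborel (\<lambda>t. norm (indicator {0<..<1} t *\<^sub>R ?g k t)) \<le> 1 / ((real k + 1) * (1 - cmod z))" for k
  proof -
    have "integral\<^sup>L lborel (\<lambda>t. norm (indicator {0<..<1} t *\<^sub>R ?g k t)) = integral {0<..<1} (\<lambda>t. cmod (?g k t))"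
      using set_borel_integral_eq_integral(2)[OF set_integrable_norm[OF gi[of k]]]
      by (simp add: set_lebesgue_integral_def)
    also have "\<dots> = integral {0..1} (\<lambda>t. cmod (?g k t))"
      by (simp add: integral_open_interval_real)
    finally show ?thesis
      using integral_norm_moeb_power_le(1)[OF z, of k] by simp
  qed
  have gv: "integral\<^sup>L lborel (\<lambda>t. indicator {0<..<1} t *\<^sub>R ?g k t) = (\<Sum>n. z ^ n / of_nat (n + k + 1))" for k
    using set_borel_integral_eq_integral(2)[OF gi[of k]] integral_unique[OF has_integral_moeb_power[OF z, of k]]
    by (simp add: set_lebesgue_integral_def integral_open_interval_real)
  have Fsums: "(\<lambda>k. F k t) sums (indicator {0<..<1} t *\<^sub>R (moeb_weight t z * f (moeb t z)))" for t
  proof (cases "t \<in> {0<..<1}")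
    case True
    then have "(\<lambda>k. moeb_weight t z * (?a k * moeb t z ^ k)) sums (moeb_weight t z * f (moeb t z))"
      using norm_moeb_less_one[of t z] z by (intro sums_mult taylor_sums[OF f]) auto
    with True show ?thesis
      by (simp add: F_def mult_ac)
  qed (simp add: F_def)
  have Fs: "(\<Sum>k. F k t) = indicator {0<..<1} t *\<^sub>R (moeb_weight t z * f (moeb t z))" for t
    using sums_unique[OF Fsums[of t]] by simp
  have AE: "AE t in lborel. summable (\<lambda>k. norm (F k t))"
  proof (rule AE_I2)
    fix t :: real
    show "summable (\<lambda>k. norm (F k t))"
    proof (cases "t \<in> {0<..<1}")
      case True
      then have "summable (\<lambda>k. cmod (?a k) * cmod (moeb t z) ^ k * cmod (moeb_weight t z))"
        using norm_moeb_less_one[of t z] z by (intro summable_mult2 taylor_summable_norm[OF f]) auto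
      with True show ?thesis
        by (simp add: F_def norm_mult norm_power mult_ac)
    qed (simp add: F_def)
  qed
  have sn: "summable (\<lambda>k. integral\<^sup>L lborel (\<lambda>t. norm (F k t)))"
  proof (rule summable_comparison_test'[OF summable_mult2[OF a, of "1 / (1 - cmod z)"]])
    fix k
    have "integral\<^sup>L lborel (\<lambda>t. norm (F k t)) = cmod (?a k) * integral\<^sup>L lborel (\<lambda>t. norm (indicator {0<..<1} t *\<^sub>R ?g k t))"
      unfolding Feq norm_mult by simp
    also have "\<dots> \<le> cmod (?a k) * (1 / ((real k + 1) * (1 - cmod z)))"
      by (intro mult_left_mono gn) auto
    finally show "norm (integral\<^sup>L lborel (\<lambda>t. norm (F k t))) \<le> cmod (?a k) / (real k + 1) * (1 / (1 - cmod z))"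
      by simp
  qed
  show "integrable lborel (\<lambda>t. indicator {0<..<1} t *\<^sub>R (moeb_weight t z * f (moeb t z)))"
    using integrable_suminf[OF \<open>\<And>k. integrable lborel (F k)\<close> AE sn] unfolding Fs .
  have "integral\<^sup>L lborel (\<lambda>t. indicator {0<..<1} t *\<^sub>R (moeb_weight t z * f (moeb t z)))
      = (\<Sum>k. integral\<^sup>L lborel (F k))"
    using integral_suminf[OF \<open>\<And>k. integrable lborel (F k)\<close> AE sn] unfolding Fs .
  also have "\<dots> = (\<Sum>k. \<Sum>n. ?a k / of_nat (n + k + 1) * z ^ n)"
  proof (intro suminf_cong)
    fix k
    have "integral\<^sup>L lborel (F k) = ?a k * (\<Sum>n. z ^ n / of_nat (n + k + 1))"
      unfolding Feq by (simp only: integral_mult_right_zero gv)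
    also have "\<dots> = (\<Sum>n. ?a k * (z ^ n / of_nat (n + k + 1)))"
    proof (rule suminf_mult[symmetric], rule summable_comparison_test'[OF summable_geometric])
      show "norm (cmod z) < 1" using z by simp
      show "norm (z ^ n / of_nat (n + k + 1)) \<le> cmod z ^ n" for n
        unfolding norm_divide norm_power norm_of_nat
        using divide_left_mono[of 1 "real (n + k + 1)" "cmod z ^ n"] by simp
    qed
    finally show "integral\<^sup>L lborel (F k) = (\<Sum>n. ?a k / of_nat (n + k + 1) * z ^ n)"
      by simp
  qed
  also have "\<dots> = (\<Sum>n. \<Sum>k. ?a k / of_nat (n + k + 1) * z ^ n)"
  proof (rule sums_swap[OF _ a summable_geometric, of _ "cmod z"])
    show "cmod (?a k / of_nat (n + k + 1) * z ^ n) \<le> cmod (?a k) / (real k + 1) * cmod z ^ n" for n k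
      unfolding norm_mult[of _ "z ^ n"] norm_power by (intro mult_right_mono term_le) auto
  qed (use z in auto)
  also have "\<dots> = hilbert_op f z"
    unfolding hilbert_op_def by (intro suminf_cong suminf_mult2[symmetric] s1)
  finally show "hilbert_op f z = integral\<^sup>L lborel (\<lambda>t. indicator {0<..<1} t *\<^sub>R (moeb_weight t z * f (moeb t z)))" ..
qed

section \<open>The regularized incomplete Beta function\<close>

lemma Beta_one_minus:
  fixes a :: real
  assumes "0 < a" "a < 1"
  shows "Beta a (1 - a) = pi / sin (pi * a)"
proof -
  have "complex_of_real (Gamma a * Gamma (1 - a)) = complex_of_real (pi / sin (pi * a))"
  proof -
    have "Gamma (1 - complex_of_real a) = of_real (Gamma (1 - a))"
      using Gamma_complex_of_real[of "1 - a"] by simp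
    moreover have "sin (complex_of_real pi * of_real a) = of_real (sin (pi * a))"
      using sin_of_real[of "pi * a", where 'a = complex] by simp
    ultimately show ?thesis
      using Gamma_reflection_complex[of "of_real a"]
      by (simp only: Gamma_complex_of_real of_real_mult of_real_divide)
  qed
  then have "Gamma a * Gamma (1 - a) = pi / sin (pi * a)"
    by (simp only: of_real_eq_iff)
  then show ?thesis
    by (simp add: Beta_def)
qed

context
  fixes a :: real
  assumes a: "0 < a" "a < 1"
begin

abbreviation beta_density :: "real \<Rightarrow> real" where
  "beta_density \<equiv> \<lambda>s. s powr (a - 1) * (1 - s) powr (- a)"

lemma has_integral_beta_density:
  "(beta_density has_integral Beta a (1 - a)) {0..1}"
  using has_integral_Beta_real[of a "1 - a"] a by simp

lemma beta_density_absolutely_integrable: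
  assumes "0 \<le> t" "t \<le> 1"
  shows "set_integrable lborel {0<..<t} beta_density"
proof -
  have "beta_density absolutely_integrable_on {0..1}"
    using has_integral_beta_density by (intro nonnegative_absolutely_integrable_1) auto
  then have "beta_density absolutely_integrable_on {0<..<t}"
    by (rule set_integrable_subset) (use assms in auto)
  then show ?thesis
    by (simp add: set_integrable_def integrable_completion)
qed

lemma inc_beta_eq_integral:
  assumes "0 \<le> t" "t \<le> 1"
  shows "inc_beta t a (1 - a) = integral {0..t} beta_density"
proof -
  have "inc_beta t a (1 - a) = set_lebesgue_integral lborel {0<..<t} beta_density"
    using assms by (simp add: inc_beta_def interval_lebesgue_integral_def zero_ereal_def)
  also have "\<dots> = integral {0<..<t} beta_density"
    by (rule set_borel_integral_eq_integral(2)[OF beta_density_absolutely_integrable[OF assms]])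
  finally show ?thesis
    by (simp add: integral_open_interval_real)
qed

lemma Beta_pos: "0 < Beta a (1 - a)"
  using a by (simp add: Beta_def Gamma_real_pos)

lemma nn_integral_beta_density:
  assumes t: "0 \<le> t" "t \<le> 1"
  shows "(\<integral>\<^sup>+s. ennreal (indicator {0<..<t} s * (s powr (a - 1) * (1 - s) powr (- a))) \<partial>lborel)
       = ennreal (Beta a (1 - a) * reg_inc_beta t a (1 - a))"
proof -
  have "(\<integral>\<^sup>+s. ennreal (indicator {0<..<t} s * (s powr (a - 1) * (1 - s) powr (- a))) \<partial>lborel)
     = ennreal (set_lebesgue_integral lborel {0<..<t} beta_density)"
    unfolding set_lebesgue_integral_def real_scaleR_def
    using beta_density_absolutely_integrable[OF t]
    by (intro nn_integral_eq_integral) (auto simp: set_integrable_def)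
  also have "set_lebesgue_integral lborel {0<..<t} beta_density = inc_beta t a (1 - a)"
    using t by (simp add: inc_beta_def interval_lebesgue_integral_def zero_ereal_def)
  finally show ?thesis
    using Beta_pos by (simp add: reg_inc_beta_def)
qed

lemma reg_inc_beta_0: "reg_inc_beta 0 a (1 - a) = 0"
  by (simp add: reg_inc_beta_def inc_beta_eq_integral)

lemma reg_inc_beta_1: "reg_inc_beta 1 a (1 - a) = 1"
  using Beta_pos integral_unique[OF has_integral_beta_density]
  by (simp add: reg_inc_beta_def inc_beta_eq_integral)

lemma reg_inc_beta_nonneg:
  assumes "0 \<le> t" "t \<le> 1"
  shows "0 \<le> reg_inc_beta t a (1 - a)"
proof -
  have "beta_density integrable_on {0..t}"
    using integrable_on_subinterval[OF has_integral_integrable[OF has_integral_beta_density], of 0 t] assms by simp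
  then have "0 \<le> inc_beta t a (1 - a)"
    unfolding inc_beta_eq_integral[OF assms] by (rule integral_nonneg) auto
  then show ?thesis
    using Beta_pos by (simp add: reg_inc_beta_def)
qed

lemma continuous_on_reg_inc_beta:
  "continuous_on {0..1} (\<lambda>t. reg_inc_beta t a (1 - a))"
proof -
  have "continuous_on {0..1} (\<lambda>t. integral {0..t} beta_density / Beta a (1 - a))"
    using has_integral_integrable[OF has_integral_beta_density] Beta_pos
    by (intro continuous_intros indefinite_integral_continuous_1) auto
  then show ?thesis
    by (rule continuous_on_eq) (simp add: reg_inc_beta_def inc_beta_eq_integral)
qed

lemma DERIV_reg_inc_beta:
  assumes t: "0 < t" "t < 1"
  shows "((\<lambda>t. reg_inc_beta t a (1 - a)) has_real_derivative t powr (a - 1) * (1 - t) powr (- a) / Beta a (1 - a)) (at t)"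
proof -
  let ?m = "\<lambda>s. s powr (a - 1) * (1 - s) powr (- a)"
  have "isCont ?m t"
    using t by (intro continuous_intros) auto
  then have "((\<lambda>u. integral {0..u} ?m) has_vector_derivative ?m t) (at t within ({0..1} - {}))"
    using t has_integral_integrable[OF has_integral_beta_density]
    by (intro integral_has_vector_derivative_continuous_at) (auto intro: continuous_at_imp_continuous_at_within)
  then have "((\<lambda>u. integral {0..u} ?m) has_vector_derivative ?m t) (at t within {0<..<1})"
    by (rule has_vector_derivative_within_subset) auto
  then have "((\<lambda>u. integral {0..u} ?m) has_real_derivative ?m t) (at t)"
    using t by (simp add: has_real_derivative_iff_has_vector_derivative at_within_open[of t "{0<..<1}"])
  then have "((\<lambda>u. integral {0..u} ?m / Beta a (1 - a)) has_real_derivative ?m t / Beta a (1 - a)) (at t)"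
    by (rule DERIV_cdivide)
  then show ?thesis
  proof (rule has_field_derivative_transform_within_open[where S = "{0<..<1}"])
    show "integral {0..u} ?m / Beta a (1 - a) = reg_inc_beta u a (1 - a)" if "u \<in> {0<..<1}" for u
      using that by (simp add: reg_inc_beta_def inc_beta_eq_integral)
  qed (use t in auto)
qed

context
  fixes q :: real
  assumes q: "q > 0"
begin

text \<open>Up to the positive factor \<open>q t\<^sup>q\<^sup>-\<^sup>1\<close>, the derivative of \<open>I\<^sub>t - t\<^sup>q\<close> is
  \<open>\<rho> - 1\<close>, where \<open>ln \<rho>\<close> is the function below up to a constant.\<close>

lemma reg_inc_beta_diff_MVT:
  assumes "0 \<le> x" "x < y" "y \<le> 1"
  obtains \<xi> r where "x < \<xi>" "\<xi> < y" "r > 0"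
    "(reg_inc_beta y a (1 - a) - y powr q) - (reg_inc_beta x a (1 - a) - x powr q)
      = r * (exp ((a - q) * ln \<xi> - a * ln (1 - \<xi>)) - q * Beta a (1 - a))"
proof -
  let ?D = "\<lambda>t. reg_inc_beta t a (1 - a) - t powr q"
  have "continuous_on {0..1} (\<lambda>t::real. t powr q)"
    using q by (intro continuous_on_powr' continuous_on_id continuous_on_const) auto
  then have cont: "continuous_on {x..y} ?D"
    by (rule continuous_on_subset[OF continuous_on_diff[OF continuous_on_reg_inc_beta]]) (use assms in auto)
  have der: "(?D has_real_derivative t powr (a - 1) * (1 - t) powr (- a) / Beta a (1 - a) - q * t powr (q - 1)) (at t)"
    if "0 < t" "t < 1" for t
    using that by (auto intro!: derivative_eq_intros DERIV_reg_inc_beta)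
  have "\<exists>l z. x < z \<and> z < y \<and> (?D has_real_derivative l) (at z) \<and> ?D y - ?D x = (y - x) * l"
  proof (rule MVT[OF assms(2) cont])
    fix u assume "x < u" "u < y"
    then have "0 < u" "u < 1"
      using assms by auto
    from der[OF this] show "?D differentiable (at u)"
      unfolding real_differentiable_def by blast
  qed
  then obtain l \<xi> where \<xi>: "x < \<xi>" "\<xi> < y" "(?D has_real_derivative l) (at \<xi>)" "?D y - ?D x = (y - x) * l"
    by blast
  have \<xi>01: "0 < \<xi>" "\<xi> < 1"
    using \<xi> assms by auto
  have "l = \<xi> powr (a - 1) * (1 - \<xi>) powr (- a) / Beta a (1 - a) - q * \<xi> powr (q - 1)"
    by (rule DERIV_unique[OF \<xi>(3) der[OF \<xi>01]])
  also have "\<dots> = \<xi> powr (q - 1) / Beta a (1 - a) * (\<xi> powr (a - q) * (1 - \<xi>) powr (- a) - q * Beta a (1 - a))"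
    using \<xi>01 Beta_pos powr_add[of \<xi> "q - 1" "a - q"] by (simp add: field_simps)
  also have "\<xi> powr (a - q) * (1 - \<xi>) powr (- a) = exp ((a - q) * ln \<xi> - a * ln (1 - \<xi>))"
    using \<xi>01 by (simp add: powr_def exp_add[symmetric])
  finally show ?thesis
    using that[of \<xi> "(y - x) * (\<xi> powr (q - 1) / Beta a (1 - a))"] \<xi> \<xi>01 assms Beta_pos
    by (simp add: mult.assoc)
qed

text \<open>The difference \<open>I_t - t^q\<close> vanishes at 0 and 1. If it were positive at
  \<open>t\<close>, its derivative would be positive somewhere before \<open>t\<close> and negative
  somewhere after. But for \<open>q \<le> a\<close> the function deciding the sign of the derivative
  is increasing.\<close>

lemma reg_inc_beta_le_powr:
  assumes qa: "q \<le> a" and t: "0 \<le> t" "t \<le> 1"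
  shows "reg_inc_beta t a (1 - a) \<le> t powr q"
proof (rule ccontr)
  assume neg: "\<not> ?thesis"
  have "t \<noteq> 0" "t \<noteq> 1"
    using neg q reg_inc_beta_0 reg_inc_beta_1 by auto
  with t have t': "0 < t" "t < 1"
    by auto
  obtain x r where x: "0 < x" "x < t" "r > 0"
    "(reg_inc_beta t a (1 - a) - t powr q) - (reg_inc_beta 0 a (1 - a) - 0 powr q)
      = r * (exp ((a - q) * ln x - a * ln (1 - x)) - q * Beta a (1 - a))"
    using reg_inc_beta_diff_MVT[of 0 t] t' by auto
  obtain y s where y: "t < y" "y < 1" "s > 0"
    "(reg_inc_beta 1 a (1 - a) - 1 powr q) - (reg_inc_beta t a (1 - a) - t powr q)
      = s * (exp ((a - q) * ln y - a * ln (1 - y)) - q * Beta a (1 - a))"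
    using reg_inc_beta_diff_MVT[of t 1] t' by auto
  have "0 < r * (exp ((a - q) * ln x - a * ln (1 - x)) - q * Beta a (1 - a))"
    using x(4) neg by (simp add: reg_inc_beta_0)
  moreover have "s * (exp ((a - q) * ln y - a * ln (1 - y)) - q * Beta a (1 - a)) < 0"
    using y(4) neg by (simp add: reg_inc_beta_1)
  moreover have "C < A" if "0 < k * (A - C)" "k > 0" for A C k :: real
    using that by (simp add: zero_less_mult_iff)
  moreover have "A < C" if "k * (A - C) < 0" "k > 0" for A C k :: real
    using that by (simp add: mult_less_0_iff)
  ultimately have "exp ((a - q) * ln y - a * ln (1 - y)) < exp ((a - q) * ln x - a * ln (1 - x))"
    using x(3) y(3) by (meson less_trans)
  then have "(a - q) * ln y - a * ln (1 - y) < (a - q) * ln x - a * ln (1 - x)"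
    by (simp only: exp_less_cancel_iff)
  moreover have "(a - q) * ln x \<le> (a - q) * ln y" "a * ln (1 - y) \<le> a * ln (1 - x)"
    using x y t' qa a by (auto intro!: mult_left_mono)
  ultimately show False
    by simp
qed

text \<open>For \<open>q \<ge> a\<close> the function \<open>L\<close> deciding the sign of the
  derivative is convex. A failure at \<open>t\<close> would give points \<open>u < v < w\<close>
  where the derivative is nonpositive, positive and negative, so \<open>L v\<close> would exceed
  both \<open>L u\<close> and \<open>L w\<close>.\<close>

lemma reg_inc_beta_le_powr_upward:
  assumes qa: "a \<le> q" and xt: "0 < x" "x < t" "t \<le> 1" and le: "reg_inc_beta x a (1 - a) \<le> x powr q"
  shows "reg_inc_beta t a (1 - a) \<le> t powr q"
proof (rule ccontr)
  assume neg: "\<not> ?thesis"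
  have "t \<noteq> 1"
    using neg reg_inc_beta_1 by auto
  with xt have t: "t < 1"
    by auto
  define L where "L = (\<lambda>u. (a - q) * ln u - a * ln (1 - u))"
  have conv: "convex_on {0<..<1} L"
  proof (rule f''_ge0_imp_convex)
    fix u :: real assume u: "u \<in> {0<..<1}"
    show "(L has_real_derivative (a - q) / u + a / (1 - u)) (at u)"
      unfolding L_def using u by (auto intro!: derivative_eq_intros simp: field_simps)
    show "((\<lambda>u. (a - q) / u + a / (1 - u)) has_real_derivative (q - a) / u\<^sup>2 + a / (1 - u)\<^sup>2) (at u)"
      using u by (auto intro!: derivative_eq_intros simp: power2_eq_square)
    show "0 \<le> (q - a) / u\<^sup>2 + a / (1 - u)\<^sup>2"
      using qa a by simp
  qed auto
  obtain u r where u: "0 < u" "u < x" "r > 0"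
    "(reg_inc_beta x a (1 - a) - x powr q) - (reg_inc_beta 0 a (1 - a) - 0 powr q)
      = r * (exp (L u) - q * Beta a (1 - a))"
    unfolding L_def using reg_inc_beta_diff_MVT[of 0 x] xt by auto
  obtain v s where v: "x < v" "v < t" "s > 0"
    "(reg_inc_beta t a (1 - a) - t powr q) - (reg_inc_beta x a (1 - a) - x powr q)
      = s * (exp (L v) - q * Beta a (1 - a))"
    unfolding L_def using reg_inc_beta_diff_MVT[of x t] xt by auto
  obtain w k where w: "t < w" "w < 1" "k > 0"
    "(reg_inc_beta 1 a (1 - a) - 1 powr q) - (reg_inc_beta t a (1 - a) - t powr q)
      = k * (exp (L w) - q * Beta a (1 - a))"
    unfolding L_def using reg_inc_beta_diff_MVT[of t 1] xt t by auto
  have "r * (exp (L u) - q * Beta a (1 - a)) \<le> 0"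
    using u(4) le by (simp add: reg_inc_beta_0)
  then have 1: "exp (L u) \<le> q * Beta a (1 - a)"
    using u(3) by (simp add: mult_le_0_iff)
  have "0 < s * (exp (L v) - q * Beta a (1 - a))"
    using v(4) le neg by simp
  then have 2: "q * Beta a (1 - a) < exp (L v)"
    using v(3) by (simp add: zero_less_mult_iff)
  have "k * (exp (L w) - q * Beta a (1 - a)) < 0"
    using w(4) neg by (simp add: reg_inc_beta_1)
  then have 3: "exp (L w) < q * Beta a (1 - a)"
    using w(3) by (simp add: mult_less_0_iff)
  have "v \<in> {u..w}" "{u..w} \<subseteq> {0<..<1}"
    using u(1,2) v(1,2) w(1,2) by auto
  then have "L v \<le> max (L u) (L w)"
    using convex_on_le_max[OF convex_on_subset[OF conv]] by blast
  then have "exp (L v) \<le> max (exp (L u)) (exp (L w))"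
    by (auto simp: max_def split: if_splits)
  with 1 2 3 show False
    by auto
qed

text \<open>The factor \<open>(1-t)^(-a)\<close> makes the difference strictly increasing near 1,
  where it reaches 0; hence it is negative just before. This is what keeps the crossing point below
  1.\<close>

lemma ex_reg_inc_beta_le_powr:
  obtains t where "0 < t" "t < 1" "reg_inc_beta t a (1 - a) \<le> t powr q"
proof -
  have "\<exists>t. 0 < t \<and> t < 1 \<and> reg_inc_beta t a (1 - a) \<le> t powr q"
  proof (rule ccontr)
    assume neg: "\<not> ?thesis"
    have "filterlim (\<lambda>u. exp ((a - q) * ln u - a * ln (1 - u))) at_top (at_left 1)"
      using a by real_asymp
    then have "eventually (\<lambda>u. q * Beta a (1 - a) < exp ((a - q) * ln u - a * ln (1 - u))) (at_left 1)"
      by (simp add: filterlim_at_top_dense)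
    then obtain b where b: "b < 1" "\<And>u. b < u \<Longrightarrow> u < 1 \<Longrightarrow> q * Beta a (1 - a) < exp ((a - q) * ln u - a * ln (1 - u))"
      by (auto simp: eventually_at_left_field)
    define t where "t = max b (1 / 2)"
    have t: "0 < t" "t < 1" "b \<le> t"
      using b by (auto simp: t_def)
    obtain w k where w: "t < w" "w < 1" "k > 0"
      "(reg_inc_beta 1 a (1 - a) - 1 powr q) - (reg_inc_beta t a (1 - a) - t powr q)
        = k * (exp ((a - q) * ln w - a * ln (1 - w)) - q * Beta a (1 - a))"
      using reg_inc_beta_diff_MVT[of t 1] t by auto
    have "0 < k * (exp ((a - q) * ln w - a * ln (1 - w)) - q * Beta a (1 - a))"
      using w b(2)[of w] t by simp
    then have "reg_inc_beta t a (1 - a) < t powr q"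
      using w(4) by (simp add: reg_inc_beta_1)
    with neg t show False
      by auto
  qed
  then show ?thesis
    using that by blast
qed

text \<open>By the upward lemma the set \<open>S\<close> where the power dominates contains every
  later point of the interval, so its infimum is the crossing. If the infimum is 0, the first range
  is empty.\<close>

lemma reg_inc_beta_powr_crossing:
  assumes qa: "a \<le> q"
  obtains \<tau> where "0 \<le> \<tau>" "\<tau> < 1"
    "\<And>t. 0 < t \<Longrightarrow> t < \<tau> \<Longrightarrow> t powr q \<le> reg_inc_beta t a (1 - a)"
    "\<And>t. \<tau> < t \<Longrightarrow> t \<le> 1 \<Longrightarrow> reg_inc_beta t a (1 - a) \<le> t powr q"
proof -
  define S where "S = {t. 0 < t \<and> t < 1 \<and> reg_inc_beta t a (1 - a) \<le> t powr q}"
  obtain s where s: "s \<in> S"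
    using ex_reg_inc_beta_le_powr by (auto simp: S_def)
  have bdd: "bdd_below S"
    by (auto simp: S_def intro!: bdd_belowI[of _ 0])
  show ?thesis
  proof (rule that[of "Inf S"])
    show "0 \<le> Inf S"
      using s by (intro cInf_greatest) (auto simp: S_def)
    show lt: "Inf S < 1"
      using cInf_lower[OF s bdd] s by (auto simp: S_def)
    show "t powr q \<le> reg_inc_beta t a (1 - a)" if "0 < t" "t < Inf S" for t
    proof (rule ccontr)
      assume "\<not> ?thesis"
      then have "t \<in> S"
        using that lt by (auto simp: S_def)
      then show False
        using cInf_lower[OF _ bdd] that by fastforce
    qed
    show "reg_inc_beta t a (1 - a) \<le> t powr q" if t: "Inf S < t" "t \<le> 1" for t
    proof -
      obtain x where "x \<in> S" "x < t"
        using cInf_lessD[of S t] s t by auto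
      then show ?thesis
        using t qa by (intro reg_inc_beta_le_powr_upward[of x t]) (auto simp: S_def)
    qed
  qed
qed

end

end

section \<open>The upper bound\<close>

lemma borel_measurable_moeb_weight [measurable]:
  assumes [measurable]: "f \<in> borel_measurable M" "g \<in> borel_measurable M"
  shows "(\<lambda>x. moeb_weight (f x) (g x)) \<in> borel_measurable M"
  unfolding moeb_weight_def by measurable

lemma borel_measurable_moeb [measurable]:
  assumes [measurable]: "f \<in> borel_measurable M" "g \<in> borel_measurable M"
  shows "(\<lambda>x. moeb (f x) (g x)) \<in> borel_measurable M"
  unfolding moeb_def by measurable

text \<open>With \<open>d\<close> the denominator of \<open>moeb_weight\<close>, everything comes
  from \<open>|d|^2 - t^2 - t (1-t) (1 - |z|^2) = (1-t) |1-z|^2\<close>, whose right side is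
  dropped, and from \<open>|d| < 2 - t\<close> together with \<open>t (2-t) \<le> 1\<close>. The
  derivative of \<open>moeb t\<close> is \<open>(1-t)/t\<close> times its square, so all factors of
  the substitution are powers of \<open>t\<close>, \<open>1 - t\<close> and
  \<open>|moeb t z|\<close>.\<close>

lemma
  assumes t: "0 < t" "t < 1" and z: "cmod z < 1"
  shows moeb_nonzero: "moeb t z \<noteq> 0"
    and moeb_weight_norm: "cmod (moeb_weight t z) = cmod (moeb t z) / t"
    and norm_moeb_gt: "t\<^sup>2 < cmod (moeb t z)"
    and one_minus_norm_le_moeb: "1 - (cmod z)\<^sup>2 \<le> (1 - (cmod (moeb t z))\<^sup>2) * (t / ((1 - t) * (cmod (moeb t z))\<^sup>2))"
    and deriv_moeb: "cmod (deriv (moeb t) z) = (1 - t) * (cmod (moeb t z))\<^sup>2 / t"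
    and moeb_differentiable: "moeb t field_differentiable (at z)"
proof -
  define d where "d = 1 - of_real (1 - t) * z"
  have d: "d \<noteq> 0"
    using moeb_denom_pos(2)[of t z] t z by (simp add: d_def)
  have w: "moeb_weight t z = 1 / d" "moeb t z = of_real t / d"
    by (simp_all add: moeb_def moeb_weight_def d_def)
  show "moeb t z \<noteq> 0"
    using d t by (simp add: w)
  show "cmod (moeb_weight t z) = cmod (moeb t z) / t"
    using t by (simp add: w norm_divide)
  have "cmod d \<le> 1 + (1 - t) * cmod z"
    using norm_triangle_ineq4[of 1 "of_real (1 - t) * z"] t by (simp add: d_def norm_mult del: of_real_diff)
  also have "\<dots> < 2 - t"
    using mult_strict_left_mono[OF z, of "1 - t"] t by simp
  finally have d2: "cmod d < 2 - t" .
  have "t * cmod d < t * (2 - t)"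
    using d2 t by (intro mult_strict_left_mono) auto
  also have "\<dots> \<le> 1"
    using zero_le_power2[of "1 - t"] by (simp add: power2_eq_square algebra_simps)
  finally have "t * cmod d < 1" .
  then have "t * (t * cmod d) < t * 1"
    using t by (intro mult_strict_left_mono) auto
  then show "t\<^sup>2 < cmod (moeb t z)"
    using t d by (simp add: w norm_divide power2_eq_square less_divide_eq mult.assoc)
  have n2: "(cmod d)\<^sup>2 = (1 - (1 - t) * Re z)\<^sup>2 + ((1 - t) * Im z)\<^sup>2"
    unfolding cmod_power2 d_def by (simp add: power2_eq_square)
  have "(cmod d)\<^sup>2 - t\<^sup>2 - t * (1 - t) * (1 - (cmod z)\<^sup>2) = (1 - t) * (cmod (1 - z))\<^sup>2"
    unfolding n2 cmod_power2[of z] cmod_power2[of "1 - z"] by (simp add: power2_eq_square algebra_simps)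
  moreover have "0 \<le> (1 - t) * (cmod (1 - z))\<^sup>2"
    using t by simp
  ultimately have "t * (1 - t) * (1 - (cmod z)\<^sup>2) \<le> (cmod d)\<^sup>2 - t\<^sup>2"
    by linarith
  then have "1 - (cmod z)\<^sup>2 \<le> ((cmod d)\<^sup>2 - t\<^sup>2) / (t * (1 - t))"
    using t by (simp add: pos_le_divide_eq mult.commute)
  also have "\<dots> = (1 - (cmod (moeb t z))\<^sup>2) * (t / ((1 - t) * (cmod (moeb t z))\<^sup>2))"
    using t d by (simp add: w norm_divide power_divide) (simp add: field_simps power2_eq_square)
  finally show "1 - (cmod z)\<^sup>2 \<le> (1 - (cmod (moeb t z))\<^sup>2) * (t / ((1 - t) * (cmod (moeb t z))\<^sup>2))" .
  have "((\<lambda>z. of_real t * (1 / (1 - of_real (1 - t) * z))) has_field_derivative of_real t * of_real (1 - t) / d\<^sup>2) (at z)"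
    using d unfolding d_def by (auto intro!: derivative_eq_intros simp: power2_eq_square minus_divide_left right_diff_distrib)
  then have der: "(moeb t has_field_derivative of_real t * of_real (1 - t) / d\<^sup>2) (at z)"
    by (simp only: moeb_def[abs_def] moeb_weight_def)
  then show "moeb t field_differentiable (at z)"
    by (auto simp: field_differentiable_def)
  have "cmod (deriv (moeb t) z) = t * (1 - t) / (cmod d)\<^sup>2"
    unfolding DERIV_imp_deriv[OF der] using t by (simp add: norm_mult norm_divide norm_power del: of_real_diff)
  then show "cmod (deriv (moeb t) z) = (1 - t) * (cmod (moeb t z))\<^sup>2 / t"
    using t d by (simp add: w norm_divide power_divide power2_eq_square)
qed

lemma inj_on_moeb:
  assumes t: "0 < t" "t < 1"
  shows "inj_on (moeb t) (ball 0 1)"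
proof (rule inj_onI)
  fix x y assume xy: "x \<in> ball 0 1" "y \<in> ball 0 1" and eq: "moeb t x = moeb t y"
  have "1 - of_real (1 - t) * x \<noteq> 0" "1 - of_real (1 - t) * y \<noteq> 0"
    using moeb_denom_pos(2)[of t] t xy by auto
  then have "of_real (1 - t) * x = of_real (1 - t) * y"
    using eq t by (simp add: moeb_def moeb_weight_def frac_eq_eq del: of_real_diff)
  then show "x = y"
    using t by (simp del: of_real_diff)
qed

text \<open>Substituting \<open>w = moeb t z\<close> contributes \<open>(|w|/t)^p\<close> from the
  weight function, \<open>t^2 / ((1-t)^2 |w|^4)\<close> from the Jacobian and
  \<open>(t / ((1-t) |w|^2))^\<alpha>\<close> from the measure. Of the image of the disk only
  \<open>t < sqrt |w|\<close> is retained.\<close>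

lemma bergman_integral_moeb_le:
  assumes t: "0 < t" "t < 1" and al: "\<alpha> \<ge> 0" and f: "continuous_on (ball 0 1) f"
  shows "(\<integral>\<^sup>+z. ennreal (bergman_weight \<alpha> z
            * cmod (moeb_weight t z * f (moeb t z)) powr p) \<partial>lborel)
    \<le> ennreal (t powr (2 + \<alpha> - p) * (1 - t) powr (- 2 - \<alpha>)) *
      (\<integral>\<^sup>+w. ennreal (indicator {0<..<sqrt (cmod w)} t) * ennreal (bergman_weight \<alpha> w
            * cmod w powr (p - 2 * \<alpha> - 4) * cmod (f w) powr p) \<partial>lborel)"
proof -
  define fi where "fi = (\<lambda>w. indicator (ball 0 1) w *\<^sub>R f w)"
  have [measurable]: "fi \<in> borel_measurable borel"
    unfolding fi_def by (rule borel_measurable_indicator_ball_scaleR[OF f])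
  define K where "K = t powr (2 + \<alpha> - p) * (1 - t) powr (- 2 - \<alpha>)"
  have K0: "K \<ge> 0"
    by (simp add: K_def)
  define G where "G w = indicator {0<..<sqrt (cmod w)} t * (bergman_weight \<alpha> w
            * cmod w powr (p - 2 * \<alpha> - 4) * cmod (fi w) powr p)" for w
  have [measurable]: "(\<lambda>w::complex. indicator {0<..<sqrt (cmod w)} t :: real) \<in> borel_measurable borel"
    unfolding indicator_def greaterThanLessThan_iff by measurable
  have [measurable]: "G \<in> borel_measurable borel"
    unfolding G_def by measurable
  have G0: "0 \<le> G w" for w
    using al by (auto simp: G_def indicator_def)
  have "(\<integral>\<^sup>+z. ennreal (bergman_weight \<alpha> z
            * cmod (moeb_weight t z * f (moeb t z)) powr p) \<partial>lborel)
      \<le> (\<integral>\<^sup>+z. ennreal (indicator (ball 0 1) z * ((cmod (deriv (moeb t) z))\<^sup>2 * (K * G (moeb t z)))) \<partial>lborel)"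
  proof (rule nn_integral_mono)
    fix z :: complex
    show "ennreal (bergman_weight \<alpha> z
            * cmod (moeb_weight t z * f (moeb t z)) powr p)
      \<le> ennreal (indicator (ball 0 1) z * ((cmod (deriv (moeb t) z))\<^sup>2 * (K * G (moeb t z))))"
    proof (cases "cmod z < 1")
      case True
      define w where "w = moeb t z"
      define r where "r = cmod w"
      have r: "0 < r" "r < 1" "t\<^sup>2 < r"
        using moeb_nonzero[OF t True] norm_moeb_less_one[of t z] norm_moeb_gt[OF t True] t True
        by (auto simp: r_def w_def)
      have tr: "t < sqrt r"
        using r t by (simp add: real_less_rsqrt)
      have r2: "1 - r\<^sup>2 > 0"
        using r by (simp add: power_less_one_iff)
      have z2: "1 - (cmod z)\<^sup>2 > 0"
        using True by (simp add: power_less_one_iff)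
      have "(1 - (cmod z)\<^sup>2) powr \<alpha> \<le> ((1 - r\<^sup>2) * (t / ((1 - t) * r\<^sup>2))) powr \<alpha>"
        using one_minus_norm_le_moeb[OF t True] z2 al by (intro powr_mono2) (auto simp: r_def w_def)
      also have "\<dots> = (1 - r\<^sup>2) powr \<alpha> * (t powr \<alpha> * (1 - t) powr (- \<alpha>) * r powr (- 2 * \<alpha>))"
        using r r2 t by (simp add: powr_mult powr_divide powr_minus_divide powr_powr powr_numeral[symmetric] del: powr_numeral)
      finally have "(1 - (cmod z)\<^sup>2) powr \<alpha> * (r / t) powr p * cmod (f w) powr p
         \<le> (1 - r\<^sup>2) powr \<alpha> * (t powr \<alpha> * (1 - t) powr (- \<alpha>) * r powr (- 2 * \<alpha>)) * (r / t) powr p * cmod (f w) powr p"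
        by (intro mult_right_mono) auto
      also have "\<dots> = ((1 - t) * r\<^sup>2 / t)\<^sup>2 * (K * ((1 - r\<^sup>2) powr \<alpha> * r powr (p - 2 * \<alpha> - 4) * cmod (f w) powr p))"
      proof -
        have "t powr \<alpha> * (1 - t) powr (- \<alpha>) * r powr (- 2 * \<alpha>) * (r / t) powr p
           = ((1 - t) * r\<^sup>2 / t)\<^sup>2 * (K * r powr (p - 2 * \<alpha> - 4))"
        proof -
          have "((1 - t) * r\<^sup>2 / t)\<^sup>2 * (K * r powr (p - 2 * \<alpha> - 4))
            = ((1 - t) powr 2 * r powr 4 * t powr (- 2)) * (K * r powr (p - 2 * \<alpha> - 4))"
            using t r by (simp add: power_mult_distrib power_divide powr_minus_divide)
          also have "\<dots> = ((1 - t) powr 2 * (1 - t) powr (- 2 - \<alpha>)) * (r powr 4 * r powr (p - 2 * \<alpha> - 4))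
              * (t powr (- 2) * t powr (2 + \<alpha> - p))"
            unfolding K_def by (simp only: mult_ac)
          also have "\<dots> = (1 - t) powr (- \<alpha>) * (r powr (- 2 * \<alpha>) * r powr p) * (t powr \<alpha> * t powr (- p))"
            by (simp add: powr_add[symmetric])
          also have "\<dots> = t powr \<alpha> * (1 - t) powr (- \<alpha>) * r powr (- 2 * \<alpha>) * (r powr p * t powr (- p))"
            by (simp only: mult_ac)
          also have "r powr p * t powr (- p) = (r / t) powr p"
            using t r by (simp add: powr_divide powr_minus_divide)
          finally show ?thesis ..
        qed
        from arg_cong[OF this, of "\<lambda>x. (1 - r\<^sup>2) powr \<alpha> * cmod (f w) powr p * x"] show ?thesis
          by (simp only: mult_ac)
      qed
      finally have main: "(1 - (cmod z)\<^sup>2) powr \<alpha> * (r / t) powr p * cmod (f w) powr p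
        \<le> ((1 - t) * r\<^sup>2 / t)\<^sup>2 * (K * ((1 - r\<^sup>2) powr \<alpha> * r powr (p - 2 * \<alpha> - 4) * cmod (f w) powr p))" .
      have "(\<alpha> + 1) / pi * ((1 - (cmod z)\<^sup>2) powr \<alpha> * (r / t) powr p * cmod (f w) powr p)
        \<le> (\<alpha> + 1) / pi * (((1 - t) * r\<^sup>2 / t)\<^sup>2 * (K * ((1 - r\<^sup>2) powr \<alpha> * r powr (p - 2 * \<alpha> - 4) * cmod (f w) powr p)))"
        using main al by (intro mult_left_mono) auto
      moreover have "G w = (\<alpha> + 1) / pi * ((1 - r\<^sup>2) powr \<alpha> * r powr (p - 2 * \<alpha> - 4) * cmod (f w) powr p)"
        using r tr t by (simp add: G_def fi_def r_def)
      moreover have "cmod (moeb_weight t z * f w) powr p = (r / t) powr p * cmod (f w) powr p"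
      proof -
        have "cmod (moeb_weight t z * f w) = (r / t) * cmod (f w)"
          by (simp add: norm_mult moeb_weight_norm[OF t True] r_def w_def)
        moreover have "((r / t) * cmod (f w)) powr p = (r / t) powr p * cmod (f w) powr p"
          by (rule powr_mult)
        ultimately show ?thesis
          by simp
      qed
      ultimately show ?thesis
        using True by (auto intro!: ennreal_leI simp: deriv_moeb[OF t True] w_def[symmetric] r_def[symmetric] mult_ac)
    qed auto
  qed
  also have "\<dots> \<le> (\<integral>\<^sup>+w. ennreal (indicator (moeb t ` ball 0 1) w * (K * G w)) \<partial>lborel)"
    using G0 K0 moeb_differentiable[OF t]
    by (intro nn_integral_holomorphic_substitution_le inj_on_moeb[OF t])
       (auto simp: holomorphic_on_def field_differentiable_at_within)
  also have "\<dots> \<le> (\<integral>\<^sup>+w. ennreal K * ennreal (G w) \<partial>lborel)"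
    using G0 K0 by (intro nn_integral_mono) (auto simp: indicator_def ennreal_mult')
  also have "\<dots> = ennreal K * (\<integral>\<^sup>+w. ennreal (G w) \<partial>lborel)"
    by (rule nn_integral_cmult) measurable
  also have "(\<integral>\<^sup>+w. ennreal (G w) \<partial>lborel) = (\<integral>\<^sup>+w. ennreal (indicator {0<..<sqrt (cmod w)} t) * ennreal (bergman_weight \<alpha> w
            * cmod w powr (p - 2 * \<alpha> - 4) * cmod (f w) powr p) \<partial>lborel)"
    by (intro nn_integral_cong) (auto simp: G_def fi_def indicator_def)
  finally show ?thesis
    unfolding K_def .
qed

text \<open>Jensen for the probability measure \<open>m dt / B\<close>, by the tangent line of
  \<open>x^p\<close> at the mean \<open>l\<close> of \<open>T / m\<close>: Young bounds
  \<open>p l^(p-1) T\<close> by \<open>m^(1-p) T^p + (p-1) l^p m\<close>, and integration leaves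
  \<open>l^p B\<close> on the left.\<close>

lemma powr_integral_le_weighted:
  fixes T m :: "real \<Rightarrow> real"
  assumes p: "p > 1" and T: "integrable lborel T" "\<And>t. 0 \<le> T t"
    and m: "\<And>t. 0 < t \<Longrightarrow> t < 1 \<Longrightarrow> 0 < m t" and supp: "\<And>t. t \<notin> {0<..<1} \<Longrightarrow> T t = 0"
    and m_meas [measurable]: "m \<in> borel_measurable borel"
    and B: "(\<integral>\<^sup>+t. ennreal (indicator {0<..<1} t * m t) \<partial>lborel) = ennreal B" "B > 0"
  shows "ennreal ((integral\<^sup>L lborel T) powr p)
     \<le> ennreal (B powr (p - 1)) * (\<integral>\<^sup>+t. ennreal (indicator {0<..<1} t * (m t powr (1 - p) * T t powr p)) \<partial>lborel)"
    (is "_ \<le> _ * ?X")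
proof (cases ?X)
  case (real X)
  have [measurable]: "T \<in> borel_measurable borel"
    using T(1) by (simp add: borel_measurable_integrable[of lborel, simplified])
  define l where "l = integral\<^sup>L lborel T / B"
  have l: "0 \<le> l"
    unfolding l_def using B T(2) by (intro divide_nonneg_pos integral_nonneg) auto
  have young: "p * l powr (p - 1) * T t \<le> indicator {0<..<1} t * (m t powr (1 - p) * T t powr p) + (p - 1) * l powr p * (indicator {0<..<1} t * m t)" for t
  proof (cases "t \<in> {0<..<1}")
    case True
    then have mt: "0 < m t" using m by auto
    have pq: "(p - 1) * (p / (p - 1)) = p" "1 / p + 1 / (p / (p - 1)) = 1" "1 < p / (p - 1)"
      using p by (simp_all add: field_simps)
    have q: "x / (p / (p - 1)) = (1 - 1 / p) * x" for x
      using p by (simp add: field_simps)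
    have "T t / m t * l powr (p - 1) \<le> (T t / m t) powr p / p + (1 - 1 / p) * l powr p"
      using Youngs_inequality[of p "p / (p - 1)" "T t / m t" "l powr (p - 1)"] p pq mt T(2)[of t]
      unfolding q powr_powr pq(1) by simp
    then have "p * m t * (T t / m t * l powr (p - 1)) \<le> p * m t * ((T t / m t) powr p / p + (1 - 1 / p) * l powr p)"
      using mt p by (intro mult_left_mono) auto
    also have "\<dots> = m t * (T t / m t) powr p + (p - 1) * l powr p * m t"
      using p by (simp add: field_simps)
    also have "m t * (T t / m t) powr p = m t powr (1 - p) * T t powr p"
      using mt T(2)[of t] by (simp add: powr_divide powr_diff)
    finally show ?thesis
      using True mt by (simp add: mult_ac)
  qed (simp add: supp)
  have "ennreal (p * l powr (p - 1) * (B * l)) = ennreal (p * l powr (p - 1)) * ennreal (integral\<^sup>L lborel T)"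
    using B p l by (simp add: l_def ennreal_mult')
  also have "ennreal (integral\<^sup>L lborel T) = (\<integral>\<^sup>+t. ennreal (T t) \<partial>lborel)"
    using T by (intro nn_integral_eq_integral[symmetric]) auto
  also have "ennreal (p * l powr (p - 1)) * \<dots> = (\<integral>\<^sup>+t. ennreal (p * l powr (p - 1) * T t) \<partial>lborel)"
    using p T(2) by (subst nn_integral_cmult[symmetric]) (auto simp: ennreal_mult')
  also have "\<dots> \<le> (\<integral>\<^sup>+t. ennreal (indicator {0<..<1} t * (m t powr (1 - p) * T t powr p))
      + ennreal ((p - 1) * l powr p) * ennreal (indicator {0<..<1} t * m t) \<partial>lborel)"
  proof (rule nn_integral_mono)
    fix t
    have m0: "0 \<le> indicator {0<..<1} t * m t"
      using m[of t] by (auto simp: indicator_def)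
    have "ennreal (p * l powr (p - 1) * T t) \<le> ennreal (indicator {0<..<1} t * (m t powr (1 - p) * T t powr p)
        + (p - 1) * l powr p * (indicator {0<..<1} t * m t))"
      by (rule ennreal_leI[OF young])
    also have "\<dots> = ennreal (indicator {0<..<1} t * (m t powr (1 - p) * T t powr p))
      + ennreal ((p - 1) * l powr p * (indicator {0<..<1} t * m t))"
      using p m0 by (intro ennreal_plus) auto
    also have "ennreal ((p - 1) * l powr p * (indicator {0<..<1} t * m t)) = ennreal ((p - 1) * l powr p) * ennreal (indicator {0<..<1} t * m t)"
      using p by (intro ennreal_mult') auto
    finally show "ennreal (p * l powr (p - 1) * T t) \<le> ennreal (indicator {0<..<1} t * (m t powr (1 - p) * T t powr p))
      + ennreal ((p - 1) * l powr p) * ennreal (indicator {0<..<1} t * m t)" .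
  qed
  also have "\<dots> = ?X + ennreal ((p - 1) * l powr p) * ennreal B"
    by (subst nn_integral_add, measurable, subst nn_integral_cmult, measurable) (simp add: B(1))
  also have "\<dots> = ennreal (X + (p - 1) * l powr p * B)"
    using real B p by (simp add: ennreal_mult'[symmetric])
  finally have le: "p * l powr (p - 1) * (B * l) \<le> X + (p - 1) * l powr p * B"
    using real B p by (subst (asm) ennreal_le_iff) auto
  have "l powr (p - 1) * l = l powr p"
    using l p by (cases "l = 0") (auto simp: powr_diff)
  then have "p * l powr (p - 1) * (B * l) = p * (l powr p * B)"
    by (simp only: mult_ac)
  then have "p * (l powr p * B) \<le> X + (p - 1) * (l powr p * B)"
    using le by (simp only: mult_ac)
  then have "l powr p * B \<le> X"
    by (simp add: left_diff_distrib)
  then have "B powr (p - 1) * (l powr p * B) \<le> B powr (p - 1) * X"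
    by (intro mult_left_mono) auto
  moreover have "B powr (p - 1) * (l powr p * B) = (integral\<^sup>L lborel T) powr p"
    using B l by (simp add: l_def powr_divide powr_diff integral_nonneg T(2))
  ultimately show ?thesis
    using real by (simp add: ennreal_mult'[symmetric] ennreal_leI)
next
  case top
  then show ?thesis
    using B by (simp add: ennreal_mult_top)
qed

section \<open>Averaging over t and reduction to a radial weight\<close>

lemma borel_measurable_reg_inc_beta:
  assumes "0 < a" "a < 1"
  shows "(\<lambda>t. indicator {0..1} t * reg_inc_beta t a (1 - a)) \<in> borel_measurable borel"
  using borel_measurable_continuous_on_indicator[OF _ continuous_on_reg_inc_beta[OF assms]] by simp

text \<open>After Jensen at each \<open>z\<close>, Tonelli allows the substitution for each fixed
  \<open>t\<close>; a second exchange leaves, for each \<open>w\<close>, the integral of the density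
  \<open>m\<close> over \<open>0 < t < sqrt |w|\<close>, which is \<open>B\<close> times the
  regularized Beta function. This \<open>B\<close> completes the factor \<open>B^(p-1)\<close> from
  Jensen.\<close>

lemma bergman_integral_hilbert_op_le:
  assumes al: "\<alpha> \<ge> 0" and p: "p > 2 + 2 * \<alpha>" and f: "in_bergman \<alpha> p f"
  defines "a \<equiv> (2 + \<alpha>) / p"
  shows "bergman_integral \<alpha> p (hilbert_op f) \<le> ennreal (Beta a (1 - a) powr p) *
    (\<integral>\<^sup>+w. ennreal (bergman_weight \<alpha> w
            * cmod w powr (p - 2 * \<alpha> - 4) * cmod (f w) powr p)
       * ennreal (reg_inc_beta (sqrt (cmod w)) a (1 - a)) \<partial>lborel)"
    (is "_ \<le> _ * ?X")
proof -
  have a: "0 < a" "a < 1" and ap: "a * p = 2 + \<alpha>" and p1: "p > 1"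
    using al p by (auto simp: a_def)
  have hf: "f holomorphic_on ball 0 1"
    using f by (simp add: in_bergman_def)
  then have cf: "continuous_on (ball 0 1) f"
    by (rule holomorphic_on_imp_continuous_on)
  note rep = hilbert_op_eq_integral[OF hf summable_taylor_coeff_div[OF al p f]]
  define B where "B = Beta a (1 - a)"
  have B: "B > 0"
    unfolding B_def by (rule Beta_pos[OF a])
  define fi where "fi = (\<lambda>w. indicator (ball 0 1) w *\<^sub>R f w)"
  have [measurable]: "fi \<in> borel_measurable borel"
    unfolding fi_def by (rule borel_measurable_indicator_ball_scaleR[OF cf])
  define m where "m t = t powr (a - 1) * (1 - t) powr (- a)" for t :: real
  have [measurable]: "m \<in> borel_measurable borel"
    unfolding m_def by measurable
  have m0: "0 \<le> m t" for t by (simp add: m_def)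
  define W where "W z = bergman_weight \<alpha> z" for z
  have W0: "0 \<le> W z" for z using al by (simp add: W_def)
  have [measurable]: "W \<in> borel_measurable borel"
    unfolding W_def by measurable
  define T where "T z t = indicator {0<..<1} t * cmod (moeb_weight t z * fi (moeb t z))" for z t
  have T: "T z t = cmod (indicator {0<..<1} t *\<^sub>R (moeb_weight t z * f (moeb t z)))" if "cmod z < 1" for z t
    using norm_moeb_less_one[of t z] that by (auto simp: T_def fi_def indicator_def)
  define E where "E w = ennreal (W w * cmod w powr (p - 2 * \<alpha> - 4) * cmod (fi w) powr p)" for w
  have [measurable]: "E \<in> borel_measurable borel"
    unfolding E_def by measurable
  let ?Q = "\<lambda>z t. ennreal (indicator {0<..<1} t * (m t powr (1 - p) * T z t powr p))"
  let ?V = "\<lambda>t z. ennreal (bergman_weight \<alpha> z * cmod (moeb_weight t z * fi (moeb t z)) powr p)"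
  let ?E = "\<lambda>w. ennreal (bergman_weight \<alpha> w * cmod w powr (p - 2 * \<alpha> - 4) * cmod (f w) powr p)"
  have Bint: "(\<integral>\<^sup>+t. ennreal (indicator {0<..<1} t * m t) \<partial>lborel) = ennreal B"
    using nn_integral_beta_density[OF a, of 1] reg_inc_beta_1[OF a] by (simp add: m_def B_def)
  have point: "ennreal (cmod (hilbert_op f z) powr p) \<le> ennreal (B powr (p - 1)) *
      (\<integral>\<^sup>+t. ?Q z t \<partial>lborel)" if z: "cmod z < 1" for z
  proof -
    have "cmod (hilbert_op f z) \<le> integral\<^sup>L lborel (T z)"
      unfolding rep(4)[OF z] T[OF z] by (rule integral_norm_bound)
    then have "ennreal (cmod (hilbert_op f z) powr p) \<le> ennreal (integral\<^sup>L lborel (T z) powr p)"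
      using p1 by (intro ennreal_leI powr_mono2) auto
    also have "\<dots> \<le> ennreal (B powr (p - 1)) *
      (\<integral>\<^sup>+t. ?Q z t \<partial>lborel)"
    proof (rule powr_integral_le_weighted[OF p1])
      show "integrable lborel (T z)"
        using integrable_norm[OF rep(3)[OF z]] by (simp add: T[OF z, abs_def])
    qed (use Bint B in \<open>auto simp: m_def T_def\<close>)
    finally show ?thesis .
  qed
  have "bergman_integral \<alpha> p (hilbert_op f) = (\<integral>\<^sup>+z. ennreal (W z) * ennreal (cmod (hilbert_op f z) powr p) \<partial>lborel)"
    unfolding bergman_integral_def W_def[symmetric] by (simp add: ennreal_mult' W0)
  also have "\<dots> \<le> (\<integral>\<^sup>+z. ennreal (B powr (p - 1)) * (ennreal (W z) *
      (\<integral>\<^sup>+t. ?Q z t \<partial>lborel)) \<partial>lborel)"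
  proof (rule nn_integral_mono)
    fix z
    show "ennreal (W z) * ennreal (cmod (hilbert_op f z) powr p) \<le> ennreal (B powr (p - 1)) * (ennreal (W z) *
      (\<integral>\<^sup>+t. ?Q z t \<partial>lborel))"
    proof (cases "cmod z < 1")
      case True
      from mult_left_mono[OF point[OF True], of "ennreal (W z)"] show ?thesis
        by (simp add: mult_ac)
    qed (simp add: W_def)
  qed
  also have "\<dots> = ennreal (B powr (p - 1)) * (\<integral>\<^sup>+z. (\<integral>\<^sup>+t. ennreal (W z) *
      ?Q z t \<partial>lborel) \<partial>lborel)"
  proof -
    have [measurable]: "(\<lambda>z. \<integral>\<^sup>+t. ?Q z t \<partial>lborel) \<in> borel_measurable borel"
      unfolding T_def by measurable
    have [measurable]: "(\<lambda>t. ?Q z t) \<in> borel_measurable borel" for z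
      unfolding T_def by measurable
    have "(\<integral>\<^sup>+t. ennreal (W z) * ?Q z t \<partial>lborel)
      = ennreal (W z) * (\<integral>\<^sup>+t. ?Q z t \<partial>lborel)" for z
      by (rule nn_integral_cmult) measurable
    then show ?thesis
      by (simp only:) (rule nn_integral_cmult, measurable)
  qed
  also have "(\<integral>\<^sup>+z. (\<integral>\<^sup>+t. ennreal (W z) *
      ?Q z t \<partial>lborel) \<partial>lborel)
    = (\<integral>\<^sup>+t. (\<integral>\<^sup>+z. ennreal (W z) *
      ?Q z t \<partial>lborel) \<partial>lborel)"
    unfolding T_def by (rule lborel_pair.Fubini') measurable
  also have "\<dots> \<le> (\<integral>\<^sup>+t. (\<integral>\<^sup>+w. ennreal (indicator {0<..<sqrt (cmod w)} t * m t) * E w \<partial>lborel) \<partial>lborel)"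
  proof (rule nn_integral_mono)
    fix t :: real
    show "(\<integral>\<^sup>+z. ennreal (W z) * ?Q z t \<partial>lborel)
      \<le> (\<integral>\<^sup>+w. ennreal (indicator {0<..<sqrt (cmod w)} t * m t) * E w \<partial>lborel)"
    proof (cases "t \<in> {0<..<1}")
      case True
      then have t: "0 < t" "t < 1" by auto
      have [measurable]: "(\<lambda>w::complex. indicator {0<..<sqrt (cmod w)} t :: real) \<in> borel_measurable borel"
        unfolding indicator_def greaterThanLessThan_iff by measurable
      \<comment> \<open>The exponents reproduce themselves precisely because
        \<open>a * p = 2 + \<alpha>\<close>; this fixes the choice of \<open>m\<close>.\<close>
      have mm: "m t powr (1 - p) * (t powr (2 + \<alpha> - p) * (1 - t) powr (- 2 - \<alpha>)) = m t"
      proof -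
        have "(t powr (a - 1) * (1 - t) powr (- a)) powr (1 - p) * (t powr (2 + \<alpha> - p) * (1 - t) powr (- 2 - \<alpha>))
          = (t powr ((a - 1) * (1 - p)) * t powr (2 + \<alpha> - p)) * ((1 - t) powr (- a * (1 - p)) * (1 - t) powr (- 2 - \<alpha>))"
          using t by (simp add: powr_mult powr_powr)
        also have "\<dots> = t powr ((a - 1) * (1 - p) + (2 + \<alpha> - p)) * (1 - t) powr (- a * (1 - p) + (- 2 - \<alpha>))"
          by (simp only: powr_add)
        also have "(a - 1) * (1 - p) + (2 + \<alpha> - p) = a - 1"
          using ap by (simp add: algebra_simps)
        also have "- a * (1 - p) + (- 2 - \<alpha>) = - a"
          using ap by (simp add: algebra_simps)
        finally show ?thesis
          by (simp add: m_def)
      qed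
      have "(\<integral>\<^sup>+z. ennreal (W z) * ?Q z t \<partial>lborel)
        = (\<integral>\<^sup>+z. ennreal (m t powr (1 - p)) * ?V t z \<partial>lborel)"
      proof (rule nn_integral_cong)
        fix z
        show "ennreal (W z) * ?Q z t
          = ennreal (m t powr (1 - p)) * ?V t z"
          using True W0[of z] by (simp add: T_def W_def ennreal_mult'[symmetric] mult_ac)
      qed
      also have "\<dots> = ennreal (m t powr (1 - p)) * (\<integral>\<^sup>+z. ?V t z \<partial>lborel)"
        by (rule nn_integral_cmult) measurable
      also have "(\<integral>\<^sup>+z. ?V t z \<partial>lborel)
          = (\<integral>\<^sup>+z. ennreal (bergman_weight \<alpha> z
            * cmod (moeb_weight t z * f (moeb t z)) powr p) \<partial>lborel)"
        using norm_moeb_less_one[of t] t by (intro nn_integral_cong) (auto simp: fi_def indicator_def)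
      also have "ennreal (m t powr (1 - p)) * \<dots> \<le> ennreal (m t powr (1 - p)) * (ennreal (t powr (2 + \<alpha> - p) * (1 - t) powr (- 2 - \<alpha>)) *
        (\<integral>\<^sup>+w. ennreal (indicator {0<..<sqrt (cmod w)} t) * ?E w \<partial>lborel))"
        by (intro mult_left_mono bergman_integral_moeb_le t al cf) auto
      also have "\<dots> = ennreal (m t) * (\<integral>\<^sup>+w. ennreal (indicator {0<..<sqrt (cmod w)} t) * ?E w \<partial>lborel)"
        by (subst (2) mm[symmetric]) (simp add: ennreal_mult' mult.assoc)
      also have "(\<integral>\<^sup>+w. ennreal (indicator {0<..<sqrt (cmod w)} t) * ?E w \<partial>lborel)
         = (\<integral>\<^sup>+w. ennreal (indicator {0<..<sqrt (cmod w)} t) * E w \<partial>lborel)"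
        by (intro nn_integral_cong) (auto simp: E_def W_def fi_def indicator_def)
      also have "ennreal (m t) * \<dots> = (\<integral>\<^sup>+w. ennreal (m t) * (ennreal (indicator {0<..<sqrt (cmod w)} t) * E w) \<partial>lborel)"
        by (rule nn_integral_cmult[symmetric]) measurable
      also have "\<dots> = (\<integral>\<^sup>+w. ennreal (indicator {0<..<sqrt (cmod w)} t * m t) * E w \<partial>lborel)"
        using m0 by (intro nn_integral_cong) (simp add: ennreal_mult' mult_ac)
      finally show ?thesis .
    qed simp
  qed
  also have "\<dots> = (\<integral>\<^sup>+w. (\<integral>\<^sup>+t. ennreal (indicator {0<..<sqrt (cmod w)} t * m t) * E w \<partial>lborel) \<partial>lborel)"
  proof (rule lborel_pair.Fubini')
    have [measurable]: "(\<lambda>(w::complex, t::real). indicator {0<..<sqrt (cmod w)} t :: real) \<in> borel_measurable (lborel \<Otimes>\<^sub>M lborel)"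
      unfolding indicator_def greaterThanLessThan_iff by measurable
    show "(\<lambda>(w, t). ennreal (indicator {0<..<sqrt (cmod w)} t * m t) * E w) \<in> borel_measurable (lborel \<Otimes>\<^sub>M lborel)"
      by measurable
  qed
  also have "\<dots> = (\<integral>\<^sup>+w. ennreal B * (E w * ennreal (reg_inc_beta (sqrt (cmod w)) a (1 - a))) \<partial>lborel)"
  proof (rule nn_integral_cong)
    fix w :: complex
    show "(\<integral>\<^sup>+t. ennreal (indicator {0<..<sqrt (cmod w)} t * m t) * E w \<partial>lborel)
        = ennreal B * (E w * ennreal (reg_inc_beta (sqrt (cmod w)) a (1 - a)))"
    proof (cases "cmod w < 1")
      case True
      have "(\<integral>\<^sup>+t. ennreal (indicator {0<..<sqrt (cmod w)} t * m t) * E w \<partial>lborel)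
        = (\<integral>\<^sup>+t. ennreal (indicator {0<..<sqrt (cmod w)} t * m t) \<partial>lborel) * E w"
        by (rule nn_integral_multc) measurable
      also have "(\<integral>\<^sup>+t. ennreal (indicator {0<..<sqrt (cmod w)} t * m t) \<partial>lborel)
          = ennreal (B * reg_inc_beta (sqrt (cmod w)) a (1 - a))"
        unfolding m_def B_def using True by (intro nn_integral_beta_density[OF a]) auto
      finally show ?thesis
        using B by (simp add: ennreal_mult' mult_ac)
    qed (simp add: E_def W_def)
  qed
  also have "\<dots> = ennreal B * ?X"
  proof -
    define R where "R t = indicator {0..1} t * reg_inc_beta t a (1 - a)" for t
    have [measurable]: "R \<in> borel_measurable borel"
      unfolding R_def by (rule borel_measurable_reg_inc_beta[OF a])
    have "E w * ennreal (reg_inc_beta (sqrt (cmod w)) a (1 - a)) = E w * ennreal (R (sqrt (cmod w)))" for w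
      by (cases "cmod w < 1") (auto simp: R_def E_def W_def)
    then have "(\<integral>\<^sup>+w. ennreal B * (E w * ennreal (reg_inc_beta (sqrt (cmod w)) a (1 - a))) \<partial>lborel)
      = ennreal B * (\<integral>\<^sup>+w. E w * ennreal (R (sqrt (cmod w))) \<partial>lborel)"
      by (simp add: nn_integral_cmult)
    also have "(\<integral>\<^sup>+w. E w * ennreal (R (sqrt (cmod w))) \<partial>lborel) = ?X"
    proof (rule nn_integral_cong)
      fix w
      show "E w * ennreal (R (sqrt (cmod w))) = ?E w
       * ennreal (reg_inc_beta (sqrt (cmod w)) a (1 - a))"
        by (cases "cmod w < 1") (auto simp: R_def E_def W_def fi_def)
    qed
    finally show ?thesis .
  qed
  finally have "bergman_integral \<alpha> p (hilbert_op f) \<le> ennreal (B powr (p - 1)) * (ennreal B * ?X)"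
    by (simp add: mult_left_mono)
  also have "\<dots> = ennreal (B powr (p - 1) * B) * ?X"
    by (simp add: ennreal_mult' mult.assoc)
  also have "B powr (p - 1) * B = Beta a (1 - a) powr p"
    using B by (simp add: powr_diff B_def)
  finally show ?thesis .
qed

text \<open>Polar coordinates with \<open>r = t^2\<close>. The Jacobian
  \<open>r dr = 2 t^3 dt\<close> adds 3 to the exponent \<open>2 (p - 2\<alpha> - 4)\<close>, and
  the constants combine to \<open>4 (\<alpha>+1)\<close>, the reciprocal of the bound in condition
  (b).\<close>

lemma nn_integral_radial_reg_inc_beta:
  assumes a: "0 < a" "a < 1" and al: "\<alpha> \<ge> 0"
  shows "(\<integral>\<^sup>+w. ennreal (bergman_weight \<alpha> w
            * cmod w powr (p - 2 * \<alpha> - 4) * (indicator {0..1} (sqrt (cmod w)) * reg_inc_beta (sqrt (cmod w)) a (1 - a))) \<partial>lborel)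
    \<le> ennreal (4 * (\<alpha> + 1)) * (\<integral>\<^sup>+ t. ennreal (indicator {0..1} t *
                 (reg_inc_beta t a (1 - a)
                  * t powr (2 * p - 4 * \<alpha> - 5) * (1 - t ^ 4) powr \<alpha>)) \<partial>lborel)"
proof -
  define R where "R t = indicator {0..1} t * reg_inc_beta t a (1 - a)" for t
  have [measurable]: "R \<in> borel_measurable borel"
    unfolding R_def by (rule borel_measurable_reg_inc_beta[OF a])
  have R0: "0 \<le> R t" for t
    using reg_inc_beta_nonneg[OF a, of t] by (auto simp: R_def indicator_def)
  define h where "h r = indicator {..<1} r * ((\<alpha> + 1) * (1 - r\<^sup>2) powr \<alpha> / pi) * r powr (p - 2 * \<alpha> - 4) * R (sqrt r)" for r
  have [measurable]: "h \<in> borel_measurable borel"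
    unfolding h_def by measurable
  have h0: "0 \<le> h r" for r
    using al R0 by (simp add: h_def)
  have h1: "h r = 0" if "1 \<le> r" for r
    using that by (simp add: h_def)
  define C where "C = 4 * (\<alpha> + 1)"
  have C0: "0 \<le> C"
    using al by (simp add: C_def)
  have "(\<integral>\<^sup>+w. ennreal (bergman_weight \<alpha> w
            * cmod w powr (p - 2 * \<alpha> - 4) * R (sqrt (cmod w))) \<partial>lborel)
      = (\<integral>\<^sup>+w. (\<lambda>r. ennreal (h r)) (cmod w) \<partial>lborel)"
    by (intro nn_integral_cong) (auto simp: h_def indicator_def)
  also have "\<dots> = (\<integral>\<^sup>+r. ennreal (h r) * ennreal (2 * pi * r) * indicator {0..} r \<partial>lborel)"
    by (rule nn_integral_complex_norm) measurable
  also have "\<dots> = (\<integral>\<^sup>+r. ennreal (h r * (2 * pi * r) * indicator {0\<^sup>2..1\<^sup>2} r) \<partial>lborel)"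
    unfolding ennreal_mult'[OF h0, symmetric] by (intro nn_integral_cong) (auto simp: indicator_def h1)
  also have "\<dots> = (\<integral>\<^sup>+t. ennreal (h (t\<^sup>2) * (2 * pi * t\<^sup>2) * (2 * t) * indicator {0..1} t) \<partial>lborel)"
  proof (rule nn_integral_substitution)
    show "set_borel_measurable borel {0\<^sup>2..1\<^sup>2} (\<lambda>r. h r * (2 * pi * r))"
      unfolding set_borel_measurable_def by measurable
  qed (auto intro!: derivative_eq_intros continuous_intros)
  also have "\<dots> \<le> (\<integral>\<^sup>+t. ennreal C * ennreal (indicator {0..1} t * (R t * t powr (2 * p - 4 * \<alpha> - 5) * (1 - t ^ 4) powr \<alpha>)) \<partial>lborel)"
  proof (rule nn_integral_mono)
    fix t :: real
    show "ennreal (h (t\<^sup>2) * (2 * pi * t\<^sup>2) * (2 * t) * indicator {0..1} t)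
      \<le> ennreal C * ennreal (indicator {0..1} t * (R t * t powr (2 * p - 4 * \<alpha> - 5) * (1 - t ^ 4) powr \<alpha>))"
    proof (cases "0 < t \<and> t < 1")
      case True
      then have t: "0 < t" "t < 1" by auto
      have t2: "t\<^sup>2 < 1"
        using t by (simp add: power_less_one_iff)
      have e: "(t\<^sup>2) powr (p - 2 * \<alpha> - 4) * t\<^sup>2 * t = t powr (2 * p - 4 * \<alpha> - 5)"
      proof -
        have "(t\<^sup>2) powr (p - 2 * \<alpha> - 4) = t powr (2 * (p - 2 * \<alpha> - 4))"
          using t powr_powr[of t 2 "p - 2 * \<alpha> - 4"] by simp
        moreover have "t\<^sup>2 * t = t powr 3"
          using t by (simp add: power2_eq_square power3_eq_cube)
        moreover have "t powr (2 * (p - 2 * \<alpha> - 4)) * t powr 3 = t powr (2 * p - 4 * \<alpha> - 5)"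
          by (simp add: powr_add[symmetric])
        ultimately show ?thesis
          by (simp add: mult.assoc)
      qed
      have "h (t\<^sup>2) * (2 * pi * t\<^sup>2) * (2 * t) = 4 * (\<alpha> + 1) * (R t * ((t\<^sup>2) powr (p - 2 * \<alpha> - 4) * t\<^sup>2 * t) * (1 - (t\<^sup>2)\<^sup>2) powr \<alpha>)"
        using t t2 by (simp add: h_def)
      also have "\<dots> = C * (R t * t powr (2 * p - 4 * \<alpha> - 5) * (1 - t ^ 4) powr \<alpha>)"
        unfolding e C_def by simp
      finally show ?thesis
        using t C0 by (simp add: ennreal_mult'[symmetric])
    next
      case False
      then show ?thesis
        by (auto simp: indicator_def h1)
    qed
  qed
  also have "\<dots> = ennreal C * (\<integral>\<^sup>+t. ennreal (indicator {0..1} t * (R t * t powr (2 * p - 4 * \<alpha> - 5) * (1 - t ^ 4) powr \<alpha>)) \<partial>lborel)"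
    by (rule nn_integral_cmult) measurable
  also have "(\<integral>\<^sup>+t. ennreal (indicator {0..1} t * (R t * t powr (2 * p - 4 * \<alpha> - 5) * (1 - t ^ 4) powr \<alpha>)) \<partial>lborel)
     = (\<integral>\<^sup>+t. ennreal (indicator {0..1} t * (reg_inc_beta t a (1 - a) * t powr (2 * p - 4 * \<alpha> - 5) * (1 - t ^ 4) powr \<alpha>)) \<partial>lborel)"
    by (intro nn_integral_cong) (auto simp: R_def indicator_def)
  finally show ?thesis
    unfolding R_def C_def .
qed

text \<open>If \<open>\<psi>(r)\<close> is the mean of \<open>|f|\<^sup>p\<close> over the circle of radius \<open>r\<close>, then \<open>l - k\<close> and
  \<open>\<psi> - \<psi>(\<rho>)\<close> have opposite signs on both sides of \<open>\<rho>\<close>; integrate \<open>(l - k) (\<psi> - \<psi>(\<rho>)) \<le> 0\<close>.\<close>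

lemma bergman_integral_crossing_le:
  fixes f :: "complex \<Rightarrow> complex" and k l :: "real \<Rightarrow> real"
  assumes f: "f holomorphic_on ball 0 1" and p: "p > 2"
    and k [measurable]: "k \<in> borel_measurable borel" and k0: "\<And>r. 0 \<le> k r"
    and l [measurable]: "l \<in> borel_measurable borel" and l0: "\<And>r. 0 \<le> l r"
    and \<rho>: "0 \<le> \<rho>" "\<rho> < 1"
    and below: "\<And>r. 0 < r \<Longrightarrow> r < \<rho> \<Longrightarrow> k r \<le> l r"
    and above: "\<And>r. \<rho> < r \<Longrightarrow> r < 1 \<Longrightarrow> l r \<le> k r"
    and mass: "(\<integral>\<^sup>+w. ennreal (indicator (ball 0 1) w * l (cmod w)) \<partial>lborel)
      \<le> (\<integral>\<^sup>+w. ennreal (indicator (ball 0 1) w * k (cmod w)) \<partial>lborel)"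
    and fin: "(\<integral>\<^sup>+w. ennreal (indicator (ball 0 1) w * k (cmod w)) \<partial>lborel) < \<infinity>"
  shows "(\<integral>\<^sup>+w. ennreal (indicator (ball 0 1) w * (l (cmod w) * cmod (f w) powr p)) \<partial>lborel)
    \<le> (\<integral>\<^sup>+w. ennreal (indicator (ball 0 1) w * (k (cmod w) * cmod (f w) powr p)) \<partial>lborel)"
proof -
  have cp: "continuous_on (ball 0 1) (\<lambda>z. cmod (f z) powr p)"
    using p holomorphic_on_imp_continuous_on[OF f] by (intro continuous_on_powr' continuous_intros) auto
  define \<psi> where "\<psi> = circle_mean (\<lambda>z. cmod (f z) powr p)"
  have \<psi>0: "0 \<le> \<psi> w" for w
    unfolding \<psi>_def by (rule circle_mean_nonneg) auto
  define A where "A = \<psi> (of_real \<rho>)"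
  have A0: "0 \<le> A"
    unfolding A_def by (rule \<psi>0)
  let ?I = "\<lambda>g. \<integral>\<^sup>+w. ennreal (indicator (ball 0 1) w * g w) \<partial>lborel"
  have meas: "(\<lambda>w. ennreal (indicator (ball 0 1) w * (u (cmod w) * \<psi> w))) \<in> borel_measurable borel"
    and mean: "?I (\<lambda>w. u (cmod w) * cmod (f w) powr p) = ?I (\<lambda>w. u (cmod w) * \<psi> w)"
    if "u \<in> borel_measurable borel" "\<And>r. 0 \<le> u r" for u
    using borel_measurable_circle_mean[OF cp _ that] nn_integral_circle_mean[OF cp _ that]
    by (auto simp: \<psi>_def)
  have [measurable]: "(\<lambda>w. ennreal (indicator (ball 0 1) w * (k (cmod w) * \<psi> w))) \<in> borel_measurable borel"
    "(\<lambda>w. ennreal (indicator (ball 0 1) w * (l (cmod w) * \<psi> w))) \<in> borel_measurable borel"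
    by (rule meas; fact)+
  have "?I (\<lambda>w. l (cmod w) * \<psi> w) + ennreal A * ?I (\<lambda>w. k (cmod w))
     = (\<integral>\<^sup>+w. ennreal (indicator (ball 0 1) w * (l (cmod w) * \<psi> w)) + ennreal A * ennreal (indicator (ball 0 1) w * k (cmod w)) \<partial>lborel)"
    by (simp add: nn_integral_add nn_integral_cmult)
  also have "\<dots> \<le> (\<integral>\<^sup>+w. ennreal (indicator (ball 0 1) w * (k (cmod w) * \<psi> w)) + ennreal A * ennreal (indicator (ball 0 1) w * l (cmod w)) \<partial>lborel)"
  \<comment> \<open>The origin is a null set and must be left out: in the application
    \<open>l 0 = 0 < k 0\<close>, because a power of 0 has the value 0.\<close>
  proof (rule nn_integral_mono_AE, rule AE_mp[OF AE_lborel_singleton[of 0]], intro AE_I2 impI)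
    fix w :: complex assume w0: "w \<noteq> 0"
    show "ennreal (indicator (ball 0 1) w * (l (cmod w) * \<psi> w)) + ennreal A * ennreal (indicator (ball 0 1) w * k (cmod w))
      \<le> ennreal (indicator (ball 0 1) w * (k (cmod w) * \<psi> w)) + ennreal A * ennreal (indicator (ball 0 1) w * l (cmod w))"
    proof (cases "cmod w < 1")
      case True
      have "(l (cmod w) - k (cmod w)) * (\<psi> w - A) \<le> 0"
      proof (rule linorder_cases[of "cmod w" \<rho>])
        assume lt: "cmod w < \<rho>"
        then have "\<psi> w \<le> A"
          unfolding \<psi>_def A_def using \<rho> p by (intro circle_mean_powr_mono[OF f]) auto
        with below[of "cmod w"] lt w0 show ?thesis
          by (simp add: mult_nonneg_nonpos)
      next
        assume eq: "cmod w = \<rho>"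
        then have "\<psi> w = A"
          unfolding \<psi>_def A_def using \<rho> by (intro circle_mean_rotate[OF cp]) auto
        then show ?thesis
          by simp
      next
        assume gt: "\<rho> < cmod w"
        then have "A \<le> \<psi> w"
          unfolding \<psi>_def A_def using \<rho> p True by (intro circle_mean_powr_mono[OF f]) auto
        with above[of "cmod w"] gt True show ?thesis
          by (simp add: mult_nonpos_nonneg)
      qed
      then have "l (cmod w) * \<psi> w + A * k (cmod w) \<le> k (cmod w) * \<psi> w + A * l (cmod w)"
        by (simp add: algebra_simps)
      then have "ennreal (l (cmod w) * \<psi> w + A * k (cmod w)) \<le> ennreal (k (cmod w) * \<psi> w + A * l (cmod w))"
        by (rule ennreal_leI)
      then show ?thesis
        using True A0 k0 l0 \<psi>0 by (simp add: ennreal_plus ennreal_mult')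
    qed simp
  qed
  also have "\<dots> = ?I (\<lambda>w. k (cmod w) * \<psi> w) + ennreal A * ?I (\<lambda>w. l (cmod w))"
    by (simp add: nn_integral_add nn_integral_cmult)
  also have "\<dots> \<le> ?I (\<lambda>w. k (cmod w) * \<psi> w) + ennreal A * ?I (\<lambda>w. k (cmod w))"
    by (intro add_left_mono mult_left_mono mass) auto
  finally have "?I (\<lambda>w. l (cmod w) * \<psi> w) + ennreal A * ?I (\<lambda>w. k (cmod w)) \<le> ?I (\<lambda>w. k (cmod w) * \<psi> w) + ennreal A * ?I (\<lambda>w. k (cmod w))" .
  \<comment> \<open>Extended reals admit cancellation only of a finite summand.\<close>
  moreover have "ennreal A * ?I (\<lambda>w. k (cmod w)) < \<infinity>"
    using fin by (simp add: ennreal_mult_less_top)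
  moreover have "x \<le> y" if "x + z \<le> y + z" "z < \<infinity>" for x y z :: ennreal
    using that ennreal_add_left_cancel_le[of z x y] by (auto simp: add.commute)
  ultimately have "?I (\<lambda>w. l (cmod w) * \<psi> w) \<le> ?I (\<lambda>w. k (cmod w) * \<psi> w)"
    by blast
  then show ?thesis
    by (simp add: mean k l k0 l0)
qed

lemma bergman_integral_hilbert_op_le_Beta:
  fixes \<alpha> p :: real
  assumes al: "\<alpha> \<ge> 0"
    and ab: "(2 + \<alpha> + sqrt (\<alpha>\<^sup>2 + 7/2 * \<alpha> + 3) \<le> p \<and> p < 2 * (2 + \<alpha>))
         \<or> (2 + 2 * \<alpha> < p \<and> p < 2 + \<alpha> + sqrt (\<alpha>\<^sup>2 + 7/2 * \<alpha> + 3) \<and>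
            (\<integral>\<^sup>+ t. ennreal (indicator {0..1} t *
                 (reg_inc_beta t ((2 + \<alpha>) / p) (1 - (2 + \<alpha>) / p)
                  * t powr (2 * p - 4 * \<alpha> - 5) * (1 - t ^ 4) powr \<alpha>)) \<partial>lborel)
              \<le> ennreal (1 / (4 * (\<alpha> + 1))))"
    and p: "p > 2 + 2 * \<alpha>" "p < 2 * (2 + \<alpha>)" and f: "in_bergman \<alpha> p f"
  defines "a \<equiv> (2 + \<alpha>) / p"
  shows "bergman_integral \<alpha> p (hilbert_op f) \<le> ennreal (Beta a (1 - a) powr p) * bergman_integral \<alpha> p f"
proof -
  have a: "0 < a" "a < 1"
    using al p by (auto simp: a_def)
  have hf: "f holomorphic_on ball 0 1"
    using f by (simp add: in_bergman_def)
  define c where "c = 4 + 2 * \<alpha> - p"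
  have c: "c > 0"
    using p by (simp add: c_def)
  have pc: "p - 2 * \<alpha> - 4 = - c"
    by (simp add: c_def)
  \<comment> \<open>Clearing denominators gives
    \<open>p^2 - 2 (2+\<alpha>) p + (2+\<alpha>)/2 \<ge> 0\<close>; completing the square produces
    the radicand \<open>(2+\<alpha>)^2 - (2+\<alpha>)/2\<close> of condition (a).\<close>
  have iff: "2 * c \<le> a \<longleftrightarrow> \<alpha>\<^sup>2 + 7/2 * \<alpha> + 3 \<le> (p - (2 + \<alpha>))\<^sup>2"
    using p al unfolding a_def c_def by (simp add: field_simps power2_eq_square)
  define R where "R t = indicator {0..1} t * reg_inc_beta t a (1 - a)" for t
  have [measurable]: "R \<in> borel_measurable borel"
    unfolding R_def by (rule borel_measurable_reg_inc_beta[OF a])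
  have R0: "0 \<le> R t" for t
    using reg_inc_beta_nonneg[OF a, of t] by (auto simp: R_def indicator_def)
  define k where "k r = (\<alpha> + 1) * (1 - r\<^sup>2) powr \<alpha> / pi" for r
  define l where "l r = k r * r powr (p - 2 * \<alpha> - 4) * R (sqrt r)" for r
  have k0: "0 \<le> k r" and l0: "0 \<le> l r" for r
    using al R0 by (simp_all add: k_def l_def)
  have [measurable]: "k \<in> borel_measurable borel" "l \<in> borel_measurable borel"
    unfolding k_def l_def by measurable
  have rhs: "bergman_integral \<alpha> p f = (\<integral>\<^sup>+w. ennreal (indicator (ball 0 1) w * (k (cmod w) * cmod (f w) powr p)) \<partial>lborel)"
    by (simp add: bergman_integral_def k_def mult.assoc)
  have lhs: "(\<integral>\<^sup>+w. ennreal (bergman_weight \<alpha> w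
            * cmod w powr (p - 2 * \<alpha> - 4) * cmod (f w) powr p)
       * ennreal (reg_inc_beta (sqrt (cmod w)) a (1 - a)) \<partial>lborel)
     = (\<integral>\<^sup>+w. ennreal (indicator (ball 0 1) w * (l (cmod w) * cmod (f w) powr p)) \<partial>lborel)"
  proof (rule nn_integral_cong)
    fix w :: complex
    show "ennreal (bergman_weight \<alpha> w
            * cmod w powr (p - 2 * \<alpha> - 4) * cmod (f w) powr p)
       * ennreal (reg_inc_beta (sqrt (cmod w)) a (1 - a)) = ennreal (indicator (ball 0 1) w * (l (cmod w) * cmod (f w) powr p))"
    proof (cases "cmod w < 1")
      case True
      then have e: "reg_inc_beta (sqrt (cmod w)) a (1 - a) = R (sqrt (cmod w))"
        by (simp add: R_def)
      show ?thesis
        unfolding e ennreal_mult''[OF R0, symmetric] l_def k_def by (simp add: mult_ac)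
    qed simp
  qed
  have sqrt_powr: "sqrt r powr (2 * c) = r powr c" if "0 \<le> r" for r
    using that by (simp add: powr_half_sqrt[symmetric] powr_powr)
  have "(\<integral>\<^sup>+w. ennreal (indicator (ball 0 1) w * (l (cmod w) * cmod (f w) powr p)) \<partial>lborel)
     \<le> (\<integral>\<^sup>+w. ennreal (indicator (ball 0 1) w * (k (cmod w) * cmod (f w) powr p)) \<partial>lborel)"
  proof (cases "2 * c \<le> a")
    case True
    have "l r \<le> k r" if r: "0 \<le> r" "r < 1" for r
    proof (cases "r = 0")
      case False
      with r have r: "0 < r" "r < 1" by auto
      have "R (sqrt r) \<le> r powr c"
        using reg_inc_beta_le_powr[OF a _ True, of "sqrt r"] c r sqrt_powr[of r] by (simp add: R_def)
      then have "k r * r powr (- c) * R (sqrt r) \<le> k r * r powr (- c) * r powr c"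
        using k0 by (intro mult_left_mono) auto
      also have "\<dots> = k r"
        using r by (simp add: powr_minus)
      finally show ?thesis
        by (simp add: l_def pc)
    qed (simp add: l_def k0)
    then show ?thesis
      by (intro nn_integral_mono) (auto simp: indicator_def intro!: ennreal_leI mult_right_mono)
  next
    case False
    have cond: "(\<integral>\<^sup>+ t. ennreal (indicator {0..1} t *
                 (reg_inc_beta t a (1 - a) * t powr (2 * p - 4 * \<alpha> - 5) * (1 - t ^ 4) powr \<alpha>)) \<partial>lborel)
              \<le> ennreal (1 / (4 * (\<alpha> + 1)))"
    proof -
      have "\<not> (2 + \<alpha> + sqrt (\<alpha>\<^sup>2 + 7/2 * \<alpha> + 3) \<le> p)"
      proof
        assume "2 + \<alpha> + sqrt (\<alpha>\<^sup>2 + 7/2 * \<alpha> + 3) \<le> p"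
        then have "sqrt (\<alpha>\<^sup>2 + 7/2 * \<alpha> + 3) \<le> p - (2 + \<alpha>)"
          by simp
        then have "\<alpha>\<^sup>2 + 7/2 * \<alpha> + 3 \<le> (p - (2 + \<alpha>))\<^sup>2"
          by (rule sqrt_le_D)
        with False iff show False
          by simp
      qed
      with ab show ?thesis
        by (simp add: a_def)
    qed
    have massk: "(\<integral>\<^sup>+w. ennreal (indicator (ball 0 1) w * k (cmod w)) \<partial>lborel) = 1"
      unfolding k_def by (rule nn_integral_bergman_weight[OF al])
    have "(\<integral>\<^sup>+w. ennreal (indicator (ball 0 1) w * l (cmod w)) \<partial>lborel) \<le> ennreal (4 * (\<alpha> + 1)) * ennreal (1 / (4 * (\<alpha> + 1)))"
      using order_trans[OF nn_integral_radial_reg_inc_beta[OF a al] mult_left_mono[OF cond]]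
      by (simp add: l_def k_def R_def mult_ac)
    also have "\<dots> = 1"
    proof -
      have "ennreal x * ennreal (1 / x) = 1" if "x > 0" for x
        using that by (simp add: ennreal_mult'[symmetric])
      moreover have "0 < 4 * (\<alpha> + 1)"
        using al by simp
      ultimately show ?thesis
        by blast
    qed
    finally have massl: "(\<integral>\<^sup>+w. ennreal (indicator (ball 0 1) w * l (cmod w)) \<partial>lborel) \<le> 1" .
    obtain \<tau> where \<tau>: "0 \<le> \<tau>" "\<tau> < 1"
      "\<And>t. 0 < t \<Longrightarrow> t < \<tau> \<Longrightarrow> t powr (2 * c) \<le> reg_inc_beta t a (1 - a)"
      "\<And>t. \<tau> < t \<Longrightarrow> t \<le> 1 \<Longrightarrow> reg_inc_beta t a (1 - a) \<le> t powr (2 * c)"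
      using reg_inc_beta_powr_crossing[OF a, of "2 * c"] c False by auto
    have lr: "l r = k r * r powr (- c) * R (sqrt r)" for r
      by (simp add: l_def pc)
    have kl: "k r = k r * r powr (- c) * r powr c" if "0 < r" for r
      using that by (simp add: powr_minus)
    show ?thesis
    \<comment> \<open>The Beta function is evaluated at \<open>sqrt r\<close>, so a crossing at
      \<open>\<tau>\<close> in its own variable is one at radius \<open>\<tau>^2\<close>. The common
      factor \<open>k r * r powr (- c)\<close> does not change signs.\<close>
    proof (rule bergman_integral_crossing_le[OF hf, where \<rho> = "\<tau>\<^sup>2"])
      show "k r \<le> l r" if r: "0 < r" "r < \<tau>\<^sup>2" for r
      proof -
        have "sqrt r < \<tau>"
          using r \<tau>(1) by (simp add: real_less_lsqrt)
        moreover have "r \<le> 1"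
          using r \<tau>(1,2) power_le_one[of \<tau> 2] by simp
        ultimately have "r powr c \<le> R (sqrt r)"
          using \<tau>(3)[of "sqrt r"] r sqrt_powr[of r] by (simp add: R_def)
        then have "k r * r powr (- c) * r powr c \<le> k r * r powr (- c) * R (sqrt r)"
          using k0 by (intro mult_left_mono) auto
        then show ?thesis
          unfolding lr using kl[OF r(1)] by linarith
      qed
      show "l r \<le> k r" if r: "\<tau>\<^sup>2 < r" "r < 1" for r
      proof -
        have "0 < r"
          using r zero_le_power2[of \<tau>] by linarith
        have "\<tau> < sqrt r"
          using r by (simp add: real_less_rsqrt)
        then have "R (sqrt r) \<le> r powr c"
          using \<tau>(4)[of "sqrt r"] r \<open>0 < r\<close> sqrt_powr[of r] by (simp add: R_def)
        then have "k r * r powr (- c) * R (sqrt r) \<le> k r * r powr (- c) * r powr c"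
          using k0 by (intro mult_left_mono) auto
        then show ?thesis
          unfolding lr using kl[OF \<open>0 < r\<close>] by linarith
      qed
    qed (use p al massk massl \<tau> k0 l0 in \<open>auto simp: power_less_one_iff\<close>)
  qed
  then have "ennreal (Beta a (1 - a) powr p) * (\<integral>\<^sup>+w. ennreal (indicator (ball 0 1) w * (l (cmod w) * cmod (f w) powr p)) \<partial>lborel)
     \<le> ennreal (Beta a (1 - a) powr p) * bergman_integral \<alpha> p f"
    unfolding rhs by (rule mult_left_mono) simp
  with bergman_integral_hilbert_op_le[OF al p(1) f] show ?thesis
    unfolding a_def[symmetric] lhs by (rule order_trans)
qed

section \<open>The lower bound\<close>

lemma nn_integral_cmod_powr_less_top:
  assumes s: "s > - 2"
  shows "(\<integral>\<^sup>+w. ennreal (indicator {..<2} (cmod w) * cmod w powr s) \<partial>lborel) < \<infinity>"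
proof -
  have "(\<integral>\<^sup>+w. ennreal (indicator {..<2} (cmod w) * cmod w powr s) \<partial>lborel)
      = (\<integral>\<^sup>+r. ennreal (indicator {..<2} r * r powr s) * ennreal (2 * pi * r) * indicator {0..} r \<partial>lborel)"
    using nn_integral_complex_norm[of "\<lambda>r. ennreal (indicator {..<2} r * r powr s)"] by simp
  also have "\<dots> \<le> (\<integral>\<^sup>+r. ennreal (2 * pi * r powr (s + 1)) * indicator {0..2} r \<partial>lborel)"
  proof (rule nn_integral_mono)
    fix r :: real
    have "r powr s * (2 * pi * r) = 2 * pi * r powr (s + 1)" if "0 \<le> r"
      using that by (cases "r = 0") (auto simp: powr_add)
    then show "ennreal (indicator {..<2} r * r powr s) * ennreal (2 * pi * r) * indicator {0..} r
      \<le> ennreal (2 * pi * r powr (s + 1)) * indicator {0..2} r"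
      by (subst ennreal_mult'[symmetric]) (auto simp: indicator_def)
  qed
  also have "\<dots> = ennreal (2 * pi * (2 powr (s + 1 + 1) / (s + 1 + 1)))"
    using s by (intro nn_integral_has_integral_lebesgue' has_integral_mult_right has_integral_powr_from_0) auto
  also have "\<dots> < \<infinity>"
    by simp
  finally show ?thesis .
qed

lemma nn_integral_subst_one_minus:
  fixes G :: "complex \<Rightarrow> real"
  assumes "G \<in> borel_measurable borel" "\<And>w. 0 \<le> G w"
  shows "(\<integral>\<^sup>+z. ennreal (G (1 - z)) \<partial>lborel) \<le> (\<integral>\<^sup>+w. ennreal (G w) \<partial>lborel)"
proof -
  have "deriv (\<lambda>z::complex. 1 - z) z = - 1" for z
    by (rule DERIV_imp_deriv) (auto intro!: derivative_eq_intros)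
  moreover have "range (\<lambda>z::complex. 1 - z) = UNIV"
    by (auto simp: surj_def intro: exI[of _ "1 - _"])
  moreover have "(\<lambda>z::complex. 1 - z) holomorphic_on UNIV"
    by (intro holomorphic_intros)
  ultimately show ?thesis
    using nn_integral_holomorphic_substitution_le[of UNIV "\<lambda>z. 1 - z" G] assms
    by (simp add: inj_on_def)
qed

section \<open>The test functions and the critical exponent\<close>

lemma one_minus_norm_sq_le:
  assumes "cmod z < 1"
  shows "1 - (cmod z)\<^sup>2 \<le> 2 * cmod (1 - z)"
proof -
  have "1 - (cmod z)\<^sup>2 = (1 - cmod z) * (1 + cmod z)"
    by (simp add: power2_eq_square algebra_simps)
  also have "\<dots> \<le> (1 - cmod z) * 2"
    using assms by (intro mult_left_mono) auto
  also have "1 - cmod z \<le> cmod (1 - z)"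
    using norm_triangle_ineq2[of 1 z] by simp
  finally show ?thesis
    by simp
qed

lemma Re_one_minus_pos:
  assumes "cmod z < 1"
  shows "0 < Re (1 - z)" "1 - z \<noteq> 0"
  using complex_Re_le_cmod[of z] assms by auto

text \<open>Since \<open>1 - |z|^2 \<le> 2 |1-z|\<close>, the integrand is at most a constant times
  \<open>|1-z|^(\<alpha> - \<gamma> p)\<close>, and the hypothesis makes this exponent larger than
  \<open>-2\<close>, the threshold in the plane.\<close>

lemma power_function_in_bergman:
  assumes al: "\<alpha> \<ge> 0" and p: "p > 0" and g: "\<gamma> * p < 2 + \<alpha>"
  shows "in_bergman \<alpha> p (\<lambda>z. (1 - z) powr of_real (- \<gamma>))"
proof -
  have holo: "(\<lambda>z. (1 - z) powr of_real (- \<gamma>)) holomorphic_on ball 0 1"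
    using Re_one_minus_pos(1) by (intro holomorphic_intros) (force simp: complex_nonpos_Reals_iff)
  define c where "c = (\<alpha> + 1) * 2 powr \<alpha> / pi"
  have c: "c \<ge> 0"
    using al by (simp add: c_def)
  define G where "G w = indicator {..<2} (cmod w) * cmod w powr (\<alpha> - \<gamma> * p)" for w :: complex
  have [measurable]: "G \<in> borel_measurable borel"
    unfolding G_def by measurable
  have "bergman_integral \<alpha> p (\<lambda>z. (1 - z) powr of_real (- \<gamma>)) \<le> (\<integral>\<^sup>+z. ennreal c * ennreal (G (1 - z)) \<partial>lborel)"
    unfolding bergman_integral_def
  proof (rule nn_integral_mono)
    fix z :: complex
    show "ennreal (bergman_weight \<alpha> z * cmod ((1 - z) powr of_real (- \<gamma>)) powr p)
      \<le> ennreal c * ennreal (G (1 - z))"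
    proof (cases "cmod z < 1")
      case True
      define u where "u = cmod (1 - z)"
      have u: "0 < u" "u < 2"
        using Re_one_minus_pos(2)[OF True] norm_triangle_ineq4[of 1 z] True by (auto simp: u_def)
      have "(1 - (cmod z)\<^sup>2) powr \<alpha> \<le> (2 * u) powr \<alpha>"
        using one_minus_norm_sq_le[OF True] True al unfolding u_def
        by (intro powr_mono2) (auto simp: power_le_one_iff abs_square_le_1)
      also have "\<dots> = 2 powr \<alpha> * u powr \<alpha>"
        by (rule powr_mult)
      finally have "(\<alpha> + 1) / pi * (1 - (cmod z)\<^sup>2) powr \<alpha> * u powr (- \<gamma> * p) \<le> (\<alpha> + 1) / pi * (2 powr \<alpha> * u powr \<alpha>) * u powr (- \<gamma> * p)"
        using al by (intro mult_right_mono mult_left_mono) auto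
      also have "\<dots> = c * (u powr \<alpha> * u powr (- \<gamma> * p))"
        by (simp add: c_def)
      also have "u powr \<alpha> * u powr (- \<gamma> * p) = G (1 - z)"
        using u by (simp add: G_def powr_add[symmetric] u_def)
      finally show ?thesis
        using True c Re_one_minus_pos(2)[OF True]
        by (simp add: norm_powr_real_powr' powr_powr u_def ennreal_mult'[symmetric] ennreal_leI del: of_real_minus)
    qed simp
  qed
  also have "\<dots> = ennreal c * (\<integral>\<^sup>+z. ennreal (G (1 - z)) \<partial>lborel)"
    by (rule nn_integral_cmult) measurable
  also have "\<dots> \<le> ennreal c * (\<integral>\<^sup>+w. ennreal (G w) \<partial>lborel)"
    by (intro mult_left_mono nn_integral_subst_one_minus) (auto simp: G_def)
  also have "\<dots> < \<infinity>"
    using nn_integral_cmod_powr_less_top[of "\<alpha> - \<gamma> * p"] g by (simp add: G_def ennreal_mult_less_top)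
  finally show ?thesis
    using holo by (simp add: in_bergman_def)
qed

text \<open>Scale invariance at the critical exponent: on a box of size \<open>h\<close> near 1, at
  distance about \<open>h\<close> from the circle, the integrand is of order
  \<open>h^\<alpha> h^(-2-\<alpha>) = h^(-2)\<close>, so each of infinitely many disjoint boxes
  contributes at least the same amount \<open>c / 2\<close>.\<close>

lemma nn_integral_critical_power_top:
  assumes al: "\<alpha> \<ge> 0" and \<delta>: "0 < \<delta>" "\<delta> \<le> 1"
  shows "(\<integral>\<^sup>+z. ennreal (indicator (ball 0 1 \<inter> ball 1 \<delta>) z * ((\<alpha> + 1) * (1 - (cmod z)\<^sup>2) powr \<alpha> / pi)
            * cmod (1 - z) powr (- (2 + \<alpha>))) \<partial>lborel) = \<infinity>"
proof (rule ccontr)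
  define F where "F z = ennreal (indicator (ball 0 1 \<inter> ball 1 \<delta>) z * ((\<alpha> + 1) * (1 - (cmod z)\<^sup>2) powr \<alpha> / pi)
            * cmod (1 - z) powr (- (2 + \<alpha>)))" for z
  have [measurable]: "F \<in> borel_measurable borel"
    unfolding F_def by measurable
  assume "(\<integral>\<^sup>+z. ennreal (indicator (ball 0 1 \<inter> ball 1 \<delta>) z * ((\<alpha> + 1) * (1 - (cmod z)\<^sup>2) powr \<alpha> / pi)
            * cmod (1 - z) powr (- (2 + \<alpha>))) \<partial>lborel) \<noteq> \<infinity>"
  then have "integral\<^sup>N lborel F \<noteq> \<infinity>"
    unfolding F_def .
  then obtain r where r: "integral\<^sup>N lborel F = ennreal r" "0 \<le> r"
    by (cases "integral\<^sup>N lborel F") auto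
  \<comment> \<open>The factor \<open>\<delta> / 4\<close> keeps every box inside the disk and
    within distance \<open>2 * h n < \<delta>\<close> of 1; halving makes consecutive boxes
    disjoint.\<close>
  define h where "h n = \<delta> / 4 * (1 / 2) ^ n" for n :: nat
  have h: "0 < h n" "h n \<le> \<delta> / 4" for n
    using \<delta> power_le_one[of "1/2::real" n] by (auto simp: h_def mult_left_le)
  define A where "A n = box (Complex (1 - h n) (- h n / 2)) (Complex (1 - h n / 2) (h n / 2))" for n
  have A: "z \<in> A n \<longleftrightarrow> 1 - h n < Re z \<and> Re z < 1 - h n / 2 \<and> - h n / 2 < Im z \<and> Im z < h n / 2" for z n
    by (auto simp: A_def mem_box Basis_complex_def)
  have disj: "disjoint_family A"
  proof -
    have "A m \<inter> A n = {}" if "m < n" for m n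
    proof -
      have "(1 / 2) ^ n \<le> ((1 / 2) ^ Suc m :: real)"
        using that by (intro power_decreasing) auto
      then have "h n \<le> h m / 2"
        using mult_left_mono[of "(1 / 2) ^ n" "(1 / 2) ^ Suc m" "\<delta> / 4"] \<delta> by (simp add: h_def)
      then show ?thesis
        by (auto simp: A)
    qed
    then show ?thesis
      unfolding disjoint_family_on_def by (metis inf_commute linorder_neqE_nat)
  qed
  define c where "c = (1 / pi) * (1 / 2) powr \<alpha> * 2 powr (- (2 + \<alpha>))"
  have c: "c > 0"
    by (simp add: c_def)
  have low: "ennreal (c / (h n)\<^sup>2) \<le> F z" if z: "z \<in> A n" for z n
  proof -
    define x where "x = 1 - Re z"
    have x: "h n / 2 < x" "x < h n" and y: "\<bar>Im z\<bar> < h n / 2"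
      using z by (auto simp: A x_def)
    have y2: "(Im z)\<^sup>2 < (h n / 2)\<^sup>2"
      using y h(1)[of n] power_strict_mono[of "\<bar>Im z\<bar>" "h n / 2" 2] by simp
    have hx: "h n \<le> 1 / 4"
      using h(2)[of n] \<delta> by simp
    have "1 - (cmod z)\<^sup>2 = x * (2 - x) - (Im z)\<^sup>2"
      unfolding cmod_power2 x_def by (simp add: power2_eq_square algebra_simps)
    moreover have "h n / 2 * (2 - h n) \<le> x * (2 - x)"
      using x hx h(1)[of n] by (intro mult_mono) auto
    moreover have "(h n / 2)\<^sup>2 \<le> h n * (1 / 16)"
      using mult_left_mono[OF hx, of "h n"] h(1)[of n] by (simp add: power2_eq_square)
    moreover have "h n / 2 * (2 - h n) \<ge> h n / 2 * (7 / 4)"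
      using hx h(1)[of n] by (intro mult_left_mono) auto
    ultimately have z1: "h n / 2 \<le> 1 - (cmod z)\<^sup>2"
      using y2 h(1)[of n] by linarith
    then have "(cmod z)\<^sup>2 < 1"
      using h(1)[of n] by simp
    then have zb: "cmod z < 1"
      by (simp add: power_less_one_iff)
    have "cmod (1 - z) \<le> \<bar>Re (1 - z)\<bar> + \<bar>Im (1 - z)\<bar>"
      by (rule cmod_le)
    also have "\<dots> < 2 * h n"
      using x y h(1)[of n] by (simp add: x_def)
    finally have z2: "cmod (1 - z) < 2 * h n" .
    have zd: "z \<in> ball 1 \<delta>"
      using z2 h(2)[of n] \<delta> by (simp add: dist_norm)
    have "c / (h n)\<^sup>2 = (1 / pi) * (h n / 2) powr \<alpha> * (2 * h n) powr (- (2 + \<alpha>))"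
    proof -
      have "(h n / 2) powr \<alpha> * (2 * h n) powr (- (2 + \<alpha>)) = (1 / 2) powr \<alpha> * 2 powr (- (2 + \<alpha>)) * (h n powr \<alpha> * h n powr (- (2 + \<alpha>)))"
        using powr_mult[of "1 / 2" "h n" \<alpha>] powr_mult[of 2 "h n" "- (2 + \<alpha>)"] by simp
      also have "h n powr \<alpha> * h n powr (- (2 + \<alpha>)) = h n powr (- 2)"
        by (simp add: powr_add[symmetric])
      also have "\<dots> = 1 / (h n)\<^sup>2"
        using h(1)[of n] by (simp add: powr_minus_divide)
      finally show ?thesis
        by (simp add: c_def)
    qed
    also have "\<dots> \<le> ((\<alpha> + 1) / pi) * (1 - (cmod z)\<^sup>2) powr \<alpha> * cmod (1 - z) powr (- (2 + \<alpha>))"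
      using al z1 z2 h(1)[of n] Re_one_minus_pos(2)[OF zb]
      by (intro mult_mono powr_mono2 powr_mono2' divide_right_mono) auto
    finally show ?thesis
      using zb zd by (simp add: F_def ennreal_leI)
  qed
  have term_ge: "ennreal (c / 2) \<le> emeasure (density lborel F) (A n)" for n
  proof -
    have "emeasure lborel (A n) = ennreal ((h n)\<^sup>2 / 2)"
      using h(1)[of n] unfolding A_def
      by (subst emeasure_lborel_box) (auto simp: Basis_complex_def power2_eq_square)
    then have "ennreal (c / 2) = (\<integral>\<^sup>+z. ennreal (c / (h n)\<^sup>2) * indicator (A n) z \<partial>lborel)"
      using c h(1)[of n] by (subst nn_integral_cmult_indicator) (auto simp: A_def ennreal_mult'[symmetric])
    also have "\<dots> \<le> (\<integral>\<^sup>+z. F z * indicator (A n) z \<partial>lborel)"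
      using low by (intro nn_integral_mono) (auto simp: indicator_def)
    also have "\<dots> = emeasure (density lborel F) (A n)"
      by (subst emeasure_density) (auto simp: A_def)
    finally show ?thesis .
  qed
  have "real N * (c / 2) \<le> r" for N
  proof -
    have "ennreal (real N * (c / 2)) = (\<Sum>n<N. ennreal (c / 2))"
      using c by (simp add: ennreal_mult'[symmetric] ennreal_of_nat_eq_real_of_nat)
    also have "\<dots> \<le> (\<Sum>n<N. emeasure (density lborel F) (A n))"
      by (intro sum_mono term_ge)
    also have "\<dots> = emeasure (density lborel F) (\<Union>n<N. A n)"
      by (intro sum_emeasure disjoint_family_on_mono[OF subset_UNIV disj]) (auto simp: A_def)
    also have "\<dots> \<le> emeasure (density lborel F) UNIV"
      by (intro emeasure_mono) auto
    also have "\<dots> = ennreal r"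
      using r by (subst emeasure_density) auto
    finally show ?thesis
      using r by (simp add: ennreal_le_iff)
  qed
  moreover obtain N where "r < real N * (c / 2)"
    using reals_Archimedean3[of "c / 2"] c by auto
  ultimately show False
    by (meson not_le)
qed

text \<open>The factor \<open>g\<^sub>\<gamma>\<close> in \<open>H f = f g\<^sub>\<gamma>\<close> for \<open>f(z) = (1 - z)\<^sup>-\<^sup>\<gamma>\<close>.\<close>

definition kernel_integral :: "real \<Rightarrow> complex \<Rightarrow> complex" where
  "kernel_integral \<gamma> z = integral\<^sup>L lborel
     (\<lambda>t. indicator {0<..<1} t *\<^sub>R ((1 - t) powr (- \<gamma>) *\<^sub>R (1 - of_real (1 - t) * z) powr of_real (\<gamma> - 1)))"

text \<open>From \<open>1 - moeb t z = (1-t) (1-z) / d\<close>: the power of \<open>1 - z\<close>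
  leaves the integral over \<open>t\<close> as the factor \<open>f z\<close>, and the rest is the
  integrand of \<open>kernel_integral\<close>.\<close>

lemma moeb_power_function:
  assumes t: "0 < t" "t < 1" and z: "cmod z < 1"
  shows "moeb_weight t z * (1 - moeb t z) powr of_real (- \<gamma>)
    = (1 - z) powr of_real (- \<gamma>) * ((1 - t) powr (- \<gamma>) *\<^sub>R (1 - of_real (1 - t) * z) powr of_real (\<gamma> - 1))"
proof -
  define d where "d = 1 - of_real (1 - t) * z"
  have d: "d \<noteq> 0"
    using moeb_denom_pos(2)[of t z] t z by (simp add: d_def)
  have "cmod (of_real (1 - t) * z) < 1"
    using mult_strict_mono[of "1 - t" 1 "cmod z" 1] t z by (simp add: norm_mult del: of_real_diff)
  then have Red: "0 < Re d"
    unfolding d_def by (rule Re_one_minus_pos(1))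
  have z1: "1 - z \<noteq> 0" and Rez: "0 < Re (1 - z)"
    using Re_one_minus_pos[OF z] by auto
  have eq: "1 - moeb t z = of_real (1 - t) * (1 - z) / d"
    using d by (simp add: moeb_def moeb_weight_def d_def field_simps)
  \<comment> \<open>No multiple of \<open>2 pi i\<close> appears: \<open>d\<close> and
    \<open>1 - z\<close> have positive real part, so the imaginary parts of their logarithms lie in
    \<open>(- pi/2, pi/2)\<close> and differ by less than \<open>pi\<close>.\<close>
  have Ln_eq: "Ln (1 - moeb t z) = of_real (ln (1 - t)) + Ln (1 - z) - Ln d"
  proof (rule Ln_unique)
    have "exp (complex_of_real (ln (1 - t))) = of_real (1 - t)"
      unfolding exp_of_real using t by simp
    then show "exp (of_real (ln (1 - t)) + Ln (1 - z) - Ln d) = 1 - moeb t z"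
      unfolding eq exp_diff exp_add exp_Ln[OF z1] exp_Ln[OF d] by simp
    show "- pi < Im (of_real (ln (1 - t)) + Ln (1 - z) - Ln d)"
      "Im (of_real (ln (1 - t)) + Ln (1 - z) - Ln d) \<le> pi"
      using Re_Ln_pos_lt_imp[OF Red] Re_Ln_pos_lt_imp[OF Rez] by auto
  qed
  have "1 - moeb t z \<noteq> 0"
    using d t z1 by (simp add: eq del: of_real_diff)
  then have "(1 - moeb t z) powr of_real (- \<gamma>) = exp (of_real (- \<gamma>) * Ln (1 - moeb t z))"
    by (simp add: powr_def)
  also have "of_real (- \<gamma>) * Ln (1 - moeb t z)
      = of_real (- \<gamma>) * of_real (ln (1 - t)) + of_real (- \<gamma>) * Ln (1 - z) + of_real \<gamma> * Ln d"
    unfolding Ln_eq by (simp add: algebra_simps)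
  finally have "(1 - moeb t z) powr of_real (- \<gamma>)
      = exp (of_real (- \<gamma>) * of_real (ln (1 - t))) * exp (of_real (- \<gamma>) * Ln (1 - z)) * exp (of_real \<gamma> * Ln d)"
    by (simp only: exp_add)
  moreover have "exp (complex_of_real (- \<gamma>) * of_real (ln (1 - t))) = of_real ((1 - t) powr (- \<gamma>))"
    using t by (simp add: powr_def exp_of_real[symmetric])
  moreover have "moeb_weight t z * exp (of_real \<gamma> * Ln d) = d powr of_real (\<gamma> - 1)"
    unfolding moeb_weight_def d_def[symmetric] using d by (simp add: powr_def exp_diff left_diff_distrib)
  ultimately show ?thesis
    unfolding d_def[symmetric] using z1 by (simp add: scaleR_conv_of_real powr_def[of "1 - z"] mult_ac)
qed

text \<open>Dominated convergence: \<open>|1 - (1-t) z| \<ge> t\<close> throughout the disk, and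
  \<open>\<gamma> \<ge> a/2\<close> gives the integrable majorant
  \<open>t^(a/2-1) (1-t)^(-a)\<close>, independent of \<open>z\<close> and
  \<open>\<gamma>\<close>.\<close>

lemma kernel_integral_tendsto:
  assumes a: "0 < a" "a < 1" and \<gamma>: "\<And>n. a / 2 \<le> \<gamma> n" "\<And>n. \<gamma> n < a" "\<gamma> \<longlonglongrightarrow> a"
    and z: "\<And>n. cmod (z n) < 1" "z \<longlonglongrightarrow> 1"
  shows "(\<lambda>n. kernel_integral (\<gamma> n) (z n)) \<longlonglongrightarrow> of_real (Beta a (1 - a))"
proof -
  let ?f = "\<lambda>t. indicator {0<..<1} t *\<^sub>R complex_of_real (t powr (a - 1) * (1 - t) powr (- a))"
  let ?g = "\<lambda>n t. indicator {0<..<1} t *\<^sub>R ((1 - t) powr (- \<gamma> n) *\<^sub>R (1 - of_real (1 - t) * z n) powr of_real (\<gamma> n - 1))"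
  let ?w = "\<lambda>t. indicator {0<..<1} t * (t powr (a / 2 - 1) * (1 - t) powr (- a))"
  have "(\<lambda>n. integral\<^sup>L lborel (\<lambda>t. ?g n t))
     \<longlonglongrightarrow> integral\<^sup>L lborel ?f"
  proof (rule integral_dominated_convergence[where w = ?w])
    show "?f \<in> borel_measurable lborel"
      by measurable
    show "(\<lambda>t. ?g n t) \<in> borel_measurable lborel" for n
      unfolding powr_def[of "_ :: complex"] by measurable
    show "integrable lborel ?w"
    proof -
      have "(\<lambda>t. t powr (a / 2 - 1) * (1 - t) powr (- a)) absolutely_integrable_on {0..1}"
        using has_integral_Beta_real[of "a / 2" "1 - a"] a by (intro nonnegative_absolutely_integrable_1) auto
      then have "(\<lambda>t. t powr (a / 2 - 1) * (1 - t) powr (- a)) absolutely_integrable_on {0<..<1}"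
        by (rule set_integrable_subset) auto
      then show ?thesis
        by (simp add: set_integrable_def integrable_completion)
    qed
    show "AE t in lborel. (\<lambda>n. ?g n t) \<longlonglongrightarrow> ?f t"
    proof (rule AE_I2)
      fix t :: real
      show "(\<lambda>n. ?g n t) \<longlonglongrightarrow> ?f t"
      proof (cases "0 < t \<and> t < 1")
        case True
        then have t: "0 < t" "t < 1" by auto
        have 1: "(\<lambda>n. (1 - t) powr (- \<gamma> n)) \<longlonglongrightarrow> (1 - t) powr (- a)"
          using t by (intro tendsto_intros \<gamma>) auto
        have "(\<lambda>n. 1 - of_real (1 - t) * z n) \<longlonglongrightarrow> 1 - of_real (1 - t) * 1"
          by (intro tendsto_intros z)
        then have "(\<lambda>n. 1 - of_real (1 - t) * z n) \<longlonglongrightarrow> of_real t"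
          by simp
        then have "(\<lambda>n. (1 - of_real (1 - t) * z n) powr of_real (\<gamma> n - 1)) \<longlonglongrightarrow> of_real t powr of_real (a - 1)"
          using t by (intro tendsto_powr_complex tendsto_of_real tendsto_diff \<gamma> tendsto_const) auto
        also have "complex_of_real t powr of_real (a - 1) = of_real (t powr (a - 1))"
          using t by (simp add: powr_of_real del: of_real_diff)
        finally have "(\<lambda>n. (1 - t) powr (- \<gamma> n) *\<^sub>R (1 - of_real (1 - t) * z n) powr of_real (\<gamma> n - 1))
           \<longlonglongrightarrow> (1 - t) powr (- a) *\<^sub>R complex_of_real (t powr (a - 1))"
          by (intro tendsto_scaleR 1)
        with True show ?thesis
          by (simp add: scaleR_conv_of_real mult.commute)
      qed auto
    qed
    show "AE t in lborel. norm (?g n t) \<le> ?w t" for n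
    proof (rule AE_I2)
      fix t :: real
      show "norm (?g n t) \<le> ?w t"
      proof (cases "0 < t \<and> t < 1")
        case True
        then have t: "0 < t" "t < 1" by auto
        define d where "d = 1 - of_real (1 - t) * z n"
        have "t \<le> 1 - (1 - t) * cmod (z n)"
        proof -
          have "(1 - t) * cmod (z n) \<le> 1 - t"
            using z(1)[of n] t by (intro mult_left_le) auto
          then show ?thesis
            by linarith
        qed
        also have "\<dots> \<le> cmod d"
          unfolding d_def using t by (intro moeb_denom_lower) auto
        finally have td: "t \<le> cmod d" .
        have "cmod (d powr of_real (\<gamma> n - 1)) = cmod d powr (\<gamma> n - 1)"
          by (simp add: norm_powr_real_powr')
        also have "\<dots> \<le> t powr (\<gamma> n - 1)"
          using td t \<gamma>(2)[of n] a by (intro powr_mono2') auto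
        also have "\<dots> \<le> t powr (a / 2 - 1)"
          using t \<gamma>(1)[of n] by (intro powr_mono') auto
        finally have 1: "cmod (d powr of_real (\<gamma> n - 1)) \<le> t powr (a / 2 - 1)" .
        have "(1 - t) powr (- \<gamma> n) \<le> (1 - t) powr (- a)"
          using t \<gamma>(2)[of n] by (intro powr_mono') auto
        with 1 have "(1 - t) powr (- \<gamma> n) * cmod (d powr of_real (\<gamma> n - 1)) \<le> (1 - t) powr (- a) * t powr (a / 2 - 1)"
          by (intro mult_mono) auto
        with True show ?thesis
          unfolding d_def[symmetric] by (simp add: mult.commute)
      qed auto
    qed
  qed
  moreover have "integral\<^sup>L lborel ?f = of_real (Beta a (1 - a))"
  proof -
    have "integral\<^sup>L lborel (\<lambda>t. indicator {0<..<1} t *\<^sub>R (t powr (a - 1) * (1 - t) powr (- a))) = Beta a (1 - a)"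
      using set_borel_integral_eq_integral(2)[OF beta_density_absolutely_integrable[OF a, of 1]]
        integral_unique[OF has_integral_beta_density[OF a]]
      by (simp add: set_lebesgue_integral_def integral_open_interval_real)
    then have "integral\<^sup>L lborel (\<lambda>t. complex_of_real (indicator {0<..<1} t * (t powr (a - 1) * (1 - t) powr (- a)))) = of_real (Beta a (1 - a))"
      by (subst integral_complex_of_real) simp
    then show ?thesis
      by (simp add: scaleR_conv_of_real)
  qed
  ultimately show ?thesis
    by (simp add: kernel_integral_def)
qed

text \<open>Turns the sequential limit into a bound uniform near \<open>(a, 1)\<close>: if no
  \<open>\<delta>\<close> worked, counterexamples for \<open>\<delta> = e n\<close> would form
  sequences contradicting \<open>kernel_integral_tendsto\<close>. The cap \<open>a/2\<close> keeps
  the exponents in the range of that lemma.\<close>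

lemma kernel_integral_lower:
  assumes a: "0 < a" "a < 1" and C: "C < Beta a (1 - a)"
  obtains \<delta> where "0 < \<delta>" "\<delta> \<le> 1" "\<delta> \<le> a / 2"
    "\<And>\<gamma> z. a - \<delta> < \<gamma> \<Longrightarrow> \<gamma> < a \<Longrightarrow> cmod z < 1 \<Longrightarrow> cmod (1 - z) < \<delta> \<Longrightarrow> C \<le> cmod (kernel_integral \<gamma> z)"
proof -
  have "\<exists>\<delta>. 0 < \<delta> \<and> \<delta> \<le> 1 \<and> \<delta> \<le> a / 2 \<and>
    (\<forall>\<gamma> z. a - \<delta> < \<gamma> \<longrightarrow> \<gamma> < a \<longrightarrow> cmod z < 1 \<longrightarrow> cmod (1 - z) < \<delta> \<longrightarrow> C \<le> cmod (kernel_integral \<gamma> z))"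
  proof (rule ccontr)
    assume neg: "\<not> ?thesis"
    define e where "e n = min (a / 2) (1 / (real n + 1))" for n
    have e: "0 < e n" "e n \<le> 1" "e n \<le> a / 2" "e n \<le> 1 / (real n + 1)" for n
      using a by (auto simp: e_def min_le_iff_disj)
    have "\<forall>n. \<exists>\<gamma> z. a - e n < \<gamma> \<and> \<gamma> < a \<and> cmod z < 1 \<and> cmod (1 - z) < e n \<and> cmod (kernel_integral \<gamma> z) < C"
      using neg e(1-3) by (meson not_le)
    then obtain \<gamma> z where gz: "\<And>n. a - e n < \<gamma> n" "\<And>n. \<gamma> n < a" "\<And>n. cmod (z n) < 1"
      "\<And>n. cmod (1 - z n) < e n" "\<And>n. cmod (kernel_integral (\<gamma> n) (z n)) < C"
      by metis
    have lim0: "(\<lambda>n. 1 / (real n + 1)) \<longlonglongrightarrow> 0"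
      by real_asymp
    have "(\<lambda>n. \<gamma> n - a) \<longlonglongrightarrow> 0"
    proof (rule Lim_null_comparison[OF _ lim0], rule always_eventually, rule allI)
      show "norm (\<gamma> n - a) \<le> 1 / (real n + 1)" for n
        using gz(1,2)[of n] e(4)[of n] by simp
    qed
    then have "\<gamma> \<longlonglongrightarrow> a"
      by (simp add: LIM_zero_iff)
    moreover have "(\<lambda>n. z n - 1) \<longlonglongrightarrow> 0"
    proof (rule Lim_null_comparison[OF _ lim0], rule always_eventually, rule allI)
      show "norm (z n - 1) \<le> 1 / (real n + 1)" for n
        using gz(4)[of n] e(4)[of n] by (simp add: norm_minus_commute)
    qed
    then have "z \<longlonglongrightarrow> 1"
      by (simp add: LIM_zero_iff)
    moreover have "a / 2 \<le> \<gamma> n" for n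
      using gz(1)[of n] e(3)[of n] by simp
    ultimately have "(\<lambda>n. kernel_integral (\<gamma> n) (z n)) \<longlonglongrightarrow> of_real (Beta a (1 - a))"
      using gz by (intro kernel_integral_tendsto a) auto
    then have "(\<lambda>n. cmod (kernel_integral (\<gamma> n) (z n))) \<longlonglongrightarrow> cmod (of_real (Beta a (1 - a)))"
      by (rule tendsto_norm)
    then have "cmod (of_real (Beta a (1 - a))) \<le> C"
      by (rule LIMSEQ_le_const2) (use gz(5) in \<open>auto intro: less_imp_le\<close>)
    with C Beta_pos[OF a] show False
      by simp
  qed
  then show ?thesis
    using that by blast
qed

text \<open>If \<open>C < C' < B\<close>, the operator multiplies \<open>|f|^p\<close> by at least
  \<open>C'^p\<close> near 1, but the total by at most \<open>C^p\<close>. As the part of the norm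
  away from 1 is bounded uniformly in \<open>\<gamma>\<close>, so is the part near 1; by Fatou the
  critical integral at \<open>\<gamma> = a\<close> would then be finite.\<close>

lemma Beta_le_hilbert_bound:
  assumes al: "\<alpha> \<ge> 0" and p: "p > 2 + 2 * \<alpha>" and C: "0 \<le> C"
    and bound: "\<And>f. in_bergman \<alpha> p f \<Longrightarrow>
      bergman_integral \<alpha> p (hilbert_op f) \<le> ennreal (C powr p) * bergman_integral \<alpha> p f"
  defines "a \<equiv> (2 + \<alpha>) / p"
  shows "Beta a (1 - a) \<le> C"
proof (rule ccontr)
  assume "\<not> ?thesis"
  then obtain C' where C': "C < C'" "C' < Beta a (1 - a)"
    using dense not_le by blast
  have a: "0 < a" "a < 1" and ap: "a * p = 2 + \<alpha>" and p1: "p > 1"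
    using al p by (auto simp: a_def)
  obtain \<delta> where \<delta>: "0 < \<delta>" "\<delta> \<le> 1" "\<delta> \<le> a / 2"
    and low: "\<And>\<gamma> z. a - \<delta> < \<gamma> \<Longrightarrow> \<gamma> < a \<Longrightarrow> cmod z < 1 \<Longrightarrow> cmod (1 - z) < \<delta> \<Longrightarrow> C' \<le> cmod (kernel_integral \<gamma> z)"
    using kernel_integral_lower[OF a C'(2)] by metis
  have CC: "C powr p < C' powr p"
    using C C' p1 by (intro powr_less_mono2) auto
  define W where "W z = bergman_weight \<alpha> z" for z
  have W0: "0 \<le> W z" for z using al by (simp add: W_def)
  have [measurable]: "W \<in> borel_measurable borel"
    unfolding W_def by measurable
  have massW: "(\<integral>\<^sup>+z. ennreal (W z) \<partial>lborel) = 1"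
    unfolding W_def by (rule nn_integral_bergman_weight[OF al])
  define near where "near \<gamma> z = W z * (indicator (ball 1 \<delta>) z * cmod (1 - z) powr (- \<gamma> * p))" for \<gamma> z
  have [measurable]: "near \<gamma> \<in> borel_measurable borel" for \<gamma>
    unfolding near_def by measurable
  have near0: "0 \<le> near \<gamma> z" for \<gamma> z
    using W0 by (simp add: near_def)
  \<comment> \<open>Bounds \<open>|1-z|^(-\<gamma> p)\<close> where
    \<open>|1-z| \<ge> \<delta>\<close>, uniformly in \<open>\<gamma> < a\<close> because
    \<open>\<delta> \<le> 1\<close>.\<close>
  define M where "M = \<delta> powr (- a * p)"
  have M0: "0 \<le> M"
    by (simp add: M_def)
  \<comment> \<open>The largest \<open>x\<close> with
    \<open>C'^p x \<le> C^p (x + M)\<close>.\<close>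
  define L where "L = C powr p * M / (C' powr p - C powr p)"
  have near_le: "(\<integral>\<^sup>+z. ennreal (near \<gamma> z) \<partial>lborel) \<le> ennreal L" if \<gamma>: "a - \<delta> < \<gamma>" "\<gamma> < a" for \<gamma>
  proof -
    define f where "f z = (1 - z) powr of_real (- \<gamma>)" for z :: complex
    have "\<gamma> * p < a * p"
      using \<gamma> p1 by (intro mult_strict_right_mono) auto
    then have fb: "in_bergman \<alpha> p f"
      unfolding f_def using al p1 ap by (intro power_function_in_bergman) auto
    then have hf: "f holomorphic_on ball 0 1"
      by (simp add: in_bergman_def)
    have nf: "cmod (f z) powr p = cmod (1 - z) powr (- \<gamma> * p)" for z
      by (simp add: f_def norm_powr_real_powr' powr_powr)
    have Hf: "hilbert_op f z = f z * kernel_integral \<gamma> z" if z: "cmod z < 1" for z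
    proof -
      have "hilbert_op f z = integral\<^sup>L lborel (\<lambda>t. indicator {0<..<1} t *\<^sub>R (moeb_weight t z * f (moeb t z)))"
        by (rule hilbert_op_eq_integral(4)[OF hf summable_taylor_coeff_div[OF al p fb] z])
      also have "(\<lambda>t. indicator {0<..<1} t *\<^sub>R (moeb_weight t z * f (moeb t z)))
        = (\<lambda>t. f z * (indicator {0<..<1} t *\<^sub>R ((1 - t) powr (- \<gamma>) *\<^sub>R (1 - of_real (1 - t) * z) powr of_real (\<gamma> - 1))))"
      proof
        fix t :: real
        show "indicator {0<..<1} t *\<^sub>R (moeb_weight t z * f (moeb t z))
          = f z * (indicator {0<..<1} t *\<^sub>R ((1 - t) powr (- \<gamma>) *\<^sub>R (1 - of_real (1 - t) * z) powr of_real (\<gamma> - 1)))"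
        proof (cases "t \<in> {0<..<1}")
          case True
          then show ?thesis
            using moeb_power_function[of t z \<gamma>] z by (simp add: f_def del: of_real_diff of_real_minus)
        qed simp
      qed
      finally show ?thesis
        by (simp only: kernel_integral_def integral_mult_right_zero)
    qed
    have le: "cmod (1 - z) powr (- \<gamma> * p) \<le> indicator (ball 1 \<delta>) z * cmod (1 - z) powr (- \<gamma> * p) + M" for z
    proof (cases "cmod (1 - z) < \<delta>")
      case True
      then show ?thesis
        using M0 by (simp add: dist_norm)
    next
      case False
      have "cmod (1 - z) powr (- \<gamma> * p) \<le> \<delta> powr (- \<gamma> * p)"
        using False \<delta> \<gamma> p1 a by (intro powr_mono2') auto
      also have "\<dots> \<le> M"
        unfolding M_def using \<delta> \<gamma> p1 by (intro powr_mono') auto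
      finally show ?thesis
        by (smt (verit) indicator_pos_le mult_nonneg_nonneg powr_ge_zero)
    qed
    have "ennreal (C' powr p) * (\<integral>\<^sup>+z. ennreal (near \<gamma> z) \<partial>lborel) = (\<integral>\<^sup>+z. ennreal (C' powr p) * ennreal (near \<gamma> z) \<partial>lborel)"
      by (rule nn_integral_cmult[symmetric]) measurable
    also have "\<dots> \<le> (\<integral>\<^sup>+z. ennreal (W z * cmod (hilbert_op f z) powr p) \<partial>lborel)"
    proof (rule nn_integral_mono)
      fix z :: complex
      show "ennreal (C' powr p) * ennreal (near \<gamma> z) \<le> ennreal (W z * cmod (hilbert_op f z) powr p)"
      proof (cases "cmod z < 1 \<and> cmod (1 - z) < \<delta>")
        case True
        then have z: "cmod z < 1" "cmod (1 - z) < \<delta>" by auto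
        have "C' powr p \<le> cmod (kernel_integral \<gamma> z) powr p"
          using low[OF \<gamma> z] C C' p1 by (intro powr_mono2) auto
        then have "C' powr p * near \<gamma> z \<le> cmod (kernel_integral \<gamma> z) powr p * near \<gamma> z"
          using near0 by (rule mult_right_mono)
        also have "\<dots> = W z * cmod (hilbert_op f z) powr p"
          using z by (simp add: near_def Hf norm_mult powr_mult nf dist_norm mult_ac)
        finally show ?thesis
          by (simp add: ennreal_mult'[symmetric] ennreal_leI)
      qed (auto simp: near_def W_def dist_norm)
    qed
    also have "\<dots> = bergman_integral \<alpha> p (hilbert_op f)"
      unfolding bergman_integral_def W_def ..
    also have "\<dots> \<le> ennreal (C powr p) * bergman_integral \<alpha> p f"
      by (rule bound[OF fb])
    also have "bergman_integral \<alpha> p f = (\<integral>\<^sup>+z. ennreal (W z * cmod (1 - z) powr (- \<gamma> * p)) \<partial>lborel)"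
      unfolding bergman_integral_def W_def nf ..
    also have "\<dots> \<le> (\<integral>\<^sup>+z. ennreal (near \<gamma> z) + ennreal M * ennreal (W z) \<partial>lborel)"
    proof (rule nn_integral_mono)
      fix z
      have "W z * cmod (1 - z) powr (- \<gamma> * p) \<le> W z * (indicator (ball 1 \<delta>) z * cmod (1 - z) powr (- \<gamma> * p) + M)"
        by (intro mult_left_mono le W0)
      also have "\<dots> = near \<gamma> z + M * W z"
        by (simp add: near_def algebra_simps)
      finally have "ennreal (W z * cmod (1 - z) powr (- \<gamma> * p)) \<le> ennreal (near \<gamma> z + M * W z)"
        by (rule ennreal_leI)
      also have "\<dots> = ennreal (near \<gamma> z) + ennreal (M * W z)"
        using near0 M0 W0 by (intro ennreal_plus) auto
      finally show "ennreal (W z * cmod (1 - z) powr (- \<gamma> * p)) \<le> ennreal (near \<gamma> z) + ennreal M * ennreal (W z)"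
        using M0 by (simp add: ennreal_mult')
    qed
    also have "\<dots> = (\<integral>\<^sup>+z. ennreal (near \<gamma> z) \<partial>lborel) + ennreal M"
      by (simp add: nn_integral_add nn_integral_cmult massW)
    finally have ineq: "ennreal (C' powr p) * (\<integral>\<^sup>+z. ennreal (near \<gamma> z) \<partial>lborel)
        \<le> ennreal (C powr p) * ((\<integral>\<^sup>+z. ennreal (near \<gamma> z) \<partial>lborel) + ennreal M)"
      by (simp add: mult_left_mono)
    have "(\<integral>\<^sup>+z. ennreal (near \<gamma> z) \<partial>lborel) \<le> bergman_integral \<alpha> p f"
      unfolding bergman_integral_def W_def[symmetric] nf
      using W0 by (intro nn_integral_mono ennreal_leI) (auto simp: near_def indicator_def)
    also have "\<dots> < \<infinity>"
      using fb by (simp add: in_bergman_def)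
    finally obtain x where x: "0 \<le> x" "(\<integral>\<^sup>+z. ennreal (near \<gamma> z) \<partial>lborel) = ennreal x"
      by (cases "\<integral>\<^sup>+z. ennreal (near \<gamma> z) \<partial>lborel") auto
    have "ennreal (C' powr p * x) \<le> ennreal (C powr p * (x + M))"
      using ineq x M0 by (simp add: ennreal_mult')
    then have "C' powr p * x \<le> C powr p * (x + M)"
      using x M0 by (subst (asm) ennreal_le_iff) auto
    then have "x \<le> L"
      using CC by (simp add: L_def pos_le_divide_eq algebra_simps)
    then show ?thesis
      by (simp add: x ennreal_leI)
  qed
  \<comment> \<open>The shift by 2 keeps \<open>\<gamma> 0\<close> strictly above
    \<open>a - \<delta>\<close>.\<close>
  define \<gamma> where "\<gamma> n = a - \<delta> / (real n + 2)" for n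
  have \<gamma>: "a - \<delta> < \<gamma> n" "\<gamma> n < a" for n
    using \<delta> by (auto simp: \<gamma>_def field_simps intro!: add_pos_nonneg)
  have lim: "\<gamma> \<longlonglongrightarrow> a"
    unfolding \<gamma>_def by real_asymp
  have pointwise: "(\<lambda>n. ennreal (near (\<gamma> n) z)) \<longlonglongrightarrow> ennreal (near a z)" for z
    unfolding near_def by (cases "z = 1") (auto intro!: tendsto_intros lim)
  have "(\<integral>\<^sup>+z. ennreal (near a z) \<partial>lborel) = (\<integral>\<^sup>+z. liminf (\<lambda>n. ennreal (near (\<gamma> n) z)) \<partial>lborel)"
    by (intro nn_integral_cong lim_imp_Liminf[symmetric] pointwise) simp
  also have "\<dots> \<le> liminf (\<lambda>n. \<integral>\<^sup>+z. ennreal (near (\<gamma> n) z) \<partial>lborel)"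
    by (rule nn_integral_liminf) measurable
  also have "\<dots> \<le> ennreal L"
    using Liminf_mono[of "\<lambda>n. \<integral>\<^sup>+z. ennreal (near (\<gamma> n) z) \<partial>lborel" "\<lambda>_. ennreal L" sequentially] near_le[OF \<gamma>]
    by (simp add: Liminf_const)
  finally have "(\<integral>\<^sup>+z. ennreal (near a z) \<partial>lborel) < \<infinity>"
    by (rule le_less_trans) simp
  moreover have "(\<integral>\<^sup>+z. ennreal (near a z) \<partial>lborel)
    = (\<integral>\<^sup>+z. ennreal (indicator (ball 0 1 \<inter> ball 1 \<delta>) z * ((\<alpha> + 1) * (1 - (cmod z)\<^sup>2) powr \<alpha> / pi)
            * cmod (1 - z) powr (- (2 + \<alpha>))) \<partial>lborel)"
    by (intro nn_integral_cong) (simp add: near_def W_def ap indicator_inter_arith mult_ac)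
  ultimately show False
    using nn_integral_critical_power_top[OF al \<delta>(1,2)] by simp
qed

section \<open>Homogeneity and the operator norm\<close>

lemma in_bergman_scale:
  fixes c :: real
  assumes f: "in_bergman \<alpha> p f" and c: "0 \<le> c" and al: "\<alpha> \<ge> 0"
  shows "bergman_integral \<alpha> p (\<lambda>z. of_real c * f z) = ennreal (c powr p) * bergman_integral \<alpha> p f"
    and "in_bergman \<alpha> p (\<lambda>z. of_real c * f z)"
proof -
  have hf: "f holomorphic_on ball 0 1"
    using f by (simp add: in_bergman_def)
  define fi where "fi = (\<lambda>w. indicator (ball 0 1) w *\<^sub>R f w)"
  have [measurable]: "fi \<in> borel_measurable borel"
    unfolding fi_def by (intro borel_measurable_indicator_ball_scaleR holomorphic_on_imp_continuous_on hf)
  define F where "F w = ennreal (bergman_weight \<alpha> w * cmod (fi w) powr p)" for w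
  have [measurable]: "F \<in> borel_measurable borel"
    unfolding F_def by measurable
  have "bergman_integral \<alpha> p (\<lambda>z. of_real c * f z) = (\<integral>\<^sup>+w. ennreal (c powr p) * F w \<partial>lborel)"
    unfolding bergman_integral_def
  proof (rule nn_integral_cong)
    fix w
    show "ennreal (bergman_weight \<alpha> w * cmod (of_real c * f w) powr p)
      = ennreal (c powr p) * F w"
      using c al by (cases "cmod w < 1") (auto simp: F_def fi_def norm_mult powr_mult ennreal_mult'[symmetric] mult_ac)
  qed
  also have "\<dots> = ennreal (c powr p) * integral\<^sup>N lborel F"
    by (rule nn_integral_cmult) measurable
  also have "integral\<^sup>N lborel F = bergman_integral \<alpha> p f"
    unfolding bergman_integral_def F_def fi_def by (intro nn_integral_cong) (auto simp: indicator_def)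
  finally show eq: "bergman_integral \<alpha> p (\<lambda>z. of_real c * f z) = ennreal (c powr p) * bergman_integral \<alpha> p f" .
  show "in_bergman \<alpha> p (\<lambda>z. of_real c * f z)"
    using f unfolding in_bergman_def eq by (auto intro!: holomorphic_intros simp: ennreal_mult_less_top)
qed

text \<open>Homogeneity is read off the integral representation, in which \<open>f\<close> enters
  linearly, rather than off the Taylor coefficients.\<close>

lemma bergman_integral_hilbert_op_scale:
  fixes c :: real
  assumes al: "\<alpha> \<ge> 0" and p: "p > 2 + 2 * \<alpha>" and f: "in_bergman \<alpha> p f" and c: "0 \<le> c"
    and Hf: "in_bergman \<alpha> p (hilbert_op f)"
  shows "bergman_integral \<alpha> p (hilbert_op (\<lambda>z. of_real c * f z)) = ennreal (c powr p) * bergman_integral \<alpha> p (hilbert_op f)"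
proof -
  let ?g = "\<lambda>z. of_real c * f z"
  have g: "in_bergman \<alpha> p ?g"
    by (rule in_bergman_scale[OF f c al])
  have "hilbert_op ?g z = of_real c * hilbert_op f z" if z: "cmod z < 1" for z
  proof -
    have "hilbert_op ?g z = integral\<^sup>L lborel (\<lambda>t. of_real c * (indicator {0<..<1} t *\<^sub>R (moeb_weight t z * f (moeb t z))))"
      using g hilbert_op_eq_integral(4)[OF _ summable_taylor_coeff_div[OF al p g] z]
      by (simp add: in_bergman_def mult_ac)
    also have "\<dots> = of_real c * hilbert_op f z"
      using f hilbert_op_eq_integral(4)[OF _ summable_taylor_coeff_div[OF al p f] z]
      by (simp only: integral_mult_right_zero in_bergman_def)
    finally show ?thesis .
  qed
  then have "bergman_integral \<alpha> p (hilbert_op ?g) = bergman_integral \<alpha> p (\<lambda>z. of_real c * hilbert_op f z)"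
    unfolding bergman_integral_def by (intro nn_integral_cong) (auto simp: indicator_def)
  also have "\<dots> = ennreal (c powr p) * bergman_integral \<alpha> p (hilbert_op f)"
    by (rule in_bergman_scale(1)[OF Hf c al])
  finally show ?thesis .
qed

text \<open>Membership of both functions guards against \<open>enn2real\<close> sending an infinite
  integral to 0; the rest is monotonicity of the \<open>p\<close>-th root.\<close>

lemma bergman_norm_le_iff:
  assumes p: "p > 0" and C: "0 \<le> C" and f: "in_bergman \<alpha> p f" and g: "in_bergman \<alpha> p g"
  shows "bergman_norm \<alpha> p g \<le> C * bergman_norm \<alpha> p f
    \<longleftrightarrow> bergman_integral \<alpha> p g \<le> ennreal (C powr p) * bergman_integral \<alpha> p f"
proof -
  obtain x where x: "0 \<le> x" "bergman_integral \<alpha> p f = ennreal x"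
    using f by (cases "bergman_integral \<alpha> p f") (auto simp: in_bergman_def)
  obtain y where y: "0 \<le> y" "bergman_integral \<alpha> p g = ennreal y"
    using g by (cases "bergman_integral \<alpha> p g") (auto simp: in_bergman_def)
  have "C * x powr (1 / p) = (C powr p * x) powr (1 / p)"
    using C p by (simp add: powr_mult powr_powr)
  then have "bergman_norm \<alpha> p g \<le> C * bergman_norm \<alpha> p f \<longleftrightarrow> y powr (1 / p) \<le> (C powr p * x) powr (1 / p)"
    using x y by (simp add: bergman_norm_def)
  also have "\<dots> \<longleftrightarrow> y \<le> C powr p * x"
  proof
    assume "y \<le> C powr p * x"
    then show "y powr (1 / p) \<le> (C powr p * x) powr (1 / p)"
      using y p by (intro powr_mono2) auto
  next
    assume "y powr (1 / p) \<le> (C powr p * x) powr (1 / p)"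
    then show "y \<le> C powr p * x"
      using powr_less_mono2[of "1 / p" "C powr p * x" y] x p by (meson linorder_not_le mult_nonneg_nonneg powr_ge_zero zero_less_divide_1_iff)
  qed
  also have "\<dots> \<longleftrightarrow> bergman_integral \<alpha> p g \<le> ennreal (C powr p) * bergman_integral \<alpha> p f"
    using x y by (simp add: ennreal_mult'[symmetric] ennreal_le_iff)
  finally show ?thesis .
qed

theorem theorem1p1:
  fixes \<alpha> p :: real
  assumes "\<alpha> \<ge> 0"
    and "(2 + \<alpha> + sqrt (\<alpha>\<^sup>2 + 7/2 * \<alpha> + 3) \<le> p \<and> p < 2 * (2 + \<alpha>))
         \<or> (2 + 2 * \<alpha> < p \<and> p < 2 + \<alpha> + sqrt (\<alpha>\<^sup>2 + 7/2 * \<alpha> + 3) \<and>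
            (\<integral>\<^sup>+ t. ennreal (indicator {0..1} t *
                 (reg_inc_beta t ((2 + \<alpha>) / p) (1 - (2 + \<alpha>) / p)
                  * t powr (2 * p - 4 * \<alpha> - 5) * (1 - t ^ 4) powr \<alpha>)) \<partial>lborel)
              \<le> ennreal (1 / (4 * (\<alpha> + 1))))"
  shows "hilbert_bounded \<alpha> p \<and> hilbert_opnorm \<alpha> p = pi / sin ((2 + \<alpha>) * pi / p)"
proof -
  \<comment> \<open>The root lies strictly between \<open>\<alpha>\<close> and
    \<open>2 + \<alpha>\<close>, so either alternative forces
    \<open>2 + 2 \<alpha> < p < 2 (2 + \<alpha>)\<close>.\<close>
  have "sqrt (\<alpha>\<^sup>2) < sqrt (\<alpha>\<^sup>2 + 7/2 * \<alpha> + 3)"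
    using assms(1) by (intro real_sqrt_less_mono) auto
  moreover have "sqrt (\<alpha>\<^sup>2 + 7/2 * \<alpha> + 3) < sqrt ((2 + \<alpha>)\<^sup>2)"
    using assms(1) by (intro real_sqrt_less_mono) (simp add: power2_eq_square algebra_simps)
  ultimately have p: "2 + 2 * \<alpha> < p" "p < 2 * (2 + \<alpha>)"
    using assms by auto
  then have p0: "p > 0"
    using assms(1) by simp
  define a where "a = (2 + \<alpha>) / p"
  define B where "B = Beta a (1 - a)"
  have a: "0 < a" "a < 1"
    using p assms(1) by (auto simp: a_def)
  have B_eq: "B = pi / sin ((2 + \<alpha>) * pi / p)"
    unfolding B_def Beta_one_minus[OF a] by (simp add: a_def mult.commute)
  have B: "B > 0"
    unfolding B_def by (rule Beta_pos[OF a])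
  have upper: "bergman_integral \<alpha> p (hilbert_op f) \<le> ennreal (B powr p) * bergman_integral \<alpha> p f"
    if "in_bergman \<alpha> p f" for f
    unfolding B_def a_def by (rule bergman_integral_hilbert_op_le_Beta[OF assms p that])
  have H: "in_bergman \<alpha> p (hilbert_op f)" if f: "in_bergman \<alpha> p f" for f
  proof -
    have "ennreal (B powr p) * bergman_integral \<alpha> p f < \<infinity>"
      using f by (simp add: in_bergman_def ennreal_mult_less_top)
    then show ?thesis
      using le_less_trans[OF upper[OF f]] f hilbert_op_eq_integral(5)[OF _ summable_taylor_coeff_div[OF assms(1) p(1) f]]
      by (simp add: in_bergman_def)
  qed
  have norm_le: "bergman_norm \<alpha> p (hilbert_op f) \<le> B * bergman_norm \<alpha> p f" if f: "in_bergman \<alpha> p f" for f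
    using upper[OF f] bergman_norm_le_iff[OF p0 less_imp_le[OF B] f H[OF f]] by simp
  have "hilbert_bounded \<alpha> p"
    unfolding hilbert_bounded_def
  proof (intro exI[of _ B] allI impI)
    fix f assume f: "in_bergman \<alpha> p f"
    then have hf: "f holomorphic_on ball 0 1"
      by (simp add: in_bergman_def)
    note rep = hilbert_op_eq_integral[OF hf summable_taylor_coeff_div[OF assms(1) p(1) f]]
    show "(\<forall>n. summable (\<lambda>k. taylor_coeff f k / of_nat (n + k + 1))) \<and>
        (\<forall>z\<in>ball 0 1. summable (\<lambda>n. (\<Sum>k. taylor_coeff f k / of_nat (n + k + 1)) * z ^ n)) \<and>
        in_bergman \<alpha> p (hilbert_op f) \<and>
        bergman_norm \<alpha> p (hilbert_op f) \<le> B * bergman_norm \<alpha> p f"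
      using rep(1,2) H[OF f] norm_le[OF f] by simp
  qed
  moreover have "hilbert_opnorm \<alpha> p = B"
  proof (rule antisym)
    let ?S = "{f. in_bergman \<alpha> p f \<and> bergman_norm \<alpha> p f \<le> 1}"
    have le_B: "bergman_norm \<alpha> p (hilbert_op f) \<le> B" if "f \<in> ?S" for f
    proof -
      have "bergman_norm \<alpha> p (hilbert_op f) \<le> B * bergman_norm \<alpha> p f"
        using norm_le that by auto
      also have "\<dots> \<le> B * 1"
        using that B by (intro mult_left_mono) auto
      finally show ?thesis
        by simp
    qed
    have zero: "(\<lambda>_. 0) \<in> ?S"
      by (simp add: in_bergman_def bergman_norm_def bergman_integral_def)
    show "hilbert_opnorm \<alpha> p \<le> B"
      unfolding hilbert_opnorm_def using zero le_B by (intro cSUP_least) auto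
    \<comment> \<open>A real supremum bounds its members only once the set is known to be bounded,
      so the upper bound must come first.\<close>
    have bdd: "bdd_above ((\<lambda>f. bergman_norm \<alpha> p (hilbert_op f)) ` ?S)"
      using le_B by (auto intro!: bdd_aboveI[of _ B])
    have le_opnorm: "bergman_norm \<alpha> p (hilbert_op f) \<le> hilbert_opnorm \<alpha> p" if "f \<in> ?S" for f
      unfolding hilbert_opnorm_def by (rule cSUP_upper[OF that bdd])
    have nonneg: "0 \<le> bergman_norm \<alpha> p f" for f
      by (simp add: bergman_norm_def)
    have op0: "0 \<le> hilbert_opnorm \<alpha> p"
      using order_trans[OF nonneg le_opnorm[OF zero]] .
    \<comment> \<open>The operator norm itself serves as the constant \<open>C\<close>. Since it is
      a supremum over the unit ball, a general \<open>f\<close> is first normalized; a function of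
      norm 0 cannot be, and is covered by \<open>upper\<close>.\<close>
    show "B \<le> hilbert_opnorm \<alpha> p"
      unfolding B_def a_def
    proof (rule Beta_le_hilbert_bound[OF assms(1) p(1) op0])
      fix f assume f: "in_bergman \<alpha> p f"
      obtain x where x: "0 \<le> x" "bergman_integral \<alpha> p f = ennreal x"
        using f by (cases "bergman_integral \<alpha> p f") (auto simp: in_bergman_def)
      show "bergman_integral \<alpha> p (hilbert_op f) \<le> ennreal (hilbert_opnorm \<alpha> p powr p) * bergman_integral \<alpha> p f"
      proof (cases "x = 0")
        case True
        then show ?thesis
          using upper[OF f] x by simp
      next
        case False
        define c where "c = x powr (- 1 / p)"
        have "c powr p = x powr (- 1)"
          unfolding c_def powr_powr using p0 by simp
        then have c: "0 \<le> c" "c powr p * x = 1"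
          using x False by (simp_all add: c_def powr_minus_divide)
        let ?g = "\<lambda>z. of_real c * f z"
        have g: "in_bergman \<alpha> p ?g" and "bergman_integral \<alpha> p ?g = 1"
          using in_bergman_scale[OF f c(1) assms(1)] x c by (simp_all add: ennreal_mult'[symmetric])
        then have gS: "?g \<in> ?S" and g1: "bergman_norm \<alpha> p ?g = 1"
          by (simp_all add: bergman_norm_def)
        have "bergman_norm \<alpha> p (hilbert_op ?g) \<le> hilbert_opnorm \<alpha> p * bergman_norm \<alpha> p ?g"
          using le_opnorm[OF gS] by (simp add: g1)
        then have "bergman_integral \<alpha> p (hilbert_op ?g) \<le> ennreal (hilbert_opnorm \<alpha> p powr p) * 1"
          using bergman_norm_le_iff[OF p0 op0 g H[OF g]] \<open>bergman_integral \<alpha> p ?g = 1\<close> by simp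
        then have "ennreal (c powr p) * bergman_integral \<alpha> p (hilbert_op f) \<le> ennreal (hilbert_opnorm \<alpha> p powr p)"
          using bergman_integral_hilbert_op_scale[OF assms(1) p(1) f c(1) H[OF f]] by simp
        then have "ennreal x * (ennreal (c powr p) * bergman_integral \<alpha> p (hilbert_op f)) \<le> ennreal x * ennreal (hilbert_opnorm \<alpha> p powr p)"
          by (rule mult_left_mono) simp
        moreover have "ennreal x * (ennreal (c powr p) * bergman_integral \<alpha> p (hilbert_op f)) = bergman_integral \<alpha> p (hilbert_op f)"
          using c x by (simp add: mult.assoc[symmetric] ennreal_mult'[symmetric] mult.commute[of x])
        ultimately show ?thesis
          using x by (simp add: mult.commute)
      qed
    qed
  qed
  ultimately show ?thesis
    using B_eq by simp
qed

end
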